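(* Let $f$ and $g$ be two transcendental entire functions and let $m,n$ be positive integers. Then $f^ng$ and $g^mf$ cannot simultaneously have non-zero generalized Picard exceptional small functions, except when $\min\{m,n\}=1$. That is, if $\min\{m,n\}\ge 2$, there do not exist meromorphic functions $a_1\not\equiv 0$ and $a_2\not\equiv 0$ such that $a_1$ is a generalized Picard exceptional small function of $f^ng$ and $a_2$ is a generalized Picard exceptional small function of $g^mf$.
   Context: $T(r,f)$ denotes the Nevanlinna characteristic of a meromorphic function $f$ on $\mathbb{C}$. A meromorphic function $a$ is a small function of $F$ if $T(r,a)=S(r,F)$, where $S(r,F)$ denotes any quantity with $S(r,F)=o(T(r,F))$ as $r\to\infty$ outside a possible exceptional set of finite linear measure. A meromorphic function $\alpha$ is a generalized Picard exceptional small function of a meromorphic function $F$ if $\alpha$ is a small function of $F$ and $F-\alpha$ has finitely many zeros. The functions $a_1$ and $a_2$ need not be equal. Here $f^n$, $g^m$ denote powers. *)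

theory Defs
  imports "HOL-Complex_Analysis.Complex_Analysis" "HOL-Library.Landau_Symbols"
begin

text \<open>
  Nevanlinna theory on the complex plane. Meromorphic functions are functions satisfying
  \<^term>\<open>f meromorphic_on UNIV\<close>. In the library, such a function may take arbitrary values on a
  sparse set (in particular at poles), so all notions below are set up not to depend on these
  values.
\<close>

definition log_plus :: "real \<Rightarrow> real" where
  "log_plus x = max 0 (ln x)"

text \<open>The value at \<open>0\<close> is also the intended one, since \<^term>\<open>ln (0::real) = 0\<close>.\<close>

definition proximity :: "real \<Rightarrow> (complex \<Rightarrow> complex) \<Rightarrow> real" where
  "proximity r f =
     1 / (2 * pi) * integral {0..2 * pi} (\<lambda>\<theta>. log_plus (norm (f (of_real r * cis \<theta>))))"

text \<open>Number of poles in the closed disc of radius \<open>t\<close>, counted with multiplicity.\<close>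

definition pole_count :: "real \<Rightarrow> (complex \<Rightarrow> complex) \<Rightarrow> nat" where
  "pole_count t f = (\<Sum>z | norm z \<le> t \<and> is_pole f z. nat (- zorder f z))"

definition pole_counting :: "real \<Rightarrow> (complex \<Rightarrow> complex) \<Rightarrow> real" where
  "pole_counting r f =
     integral {0..r} (\<lambda>t. (real (pole_count t f) - real (pole_count 0 f)) / t)
     + real (pole_count 0 f) * ln r"

definition nevanlinna_T :: "real \<Rightarrow> (complex \<Rightarrow> complex) \<Rightarrow> real" where
  "nevanlinna_T r f = proximity r f + pole_counting r f"

text \<open>
  The filter below expresses that \<open>r\<close> tends to infinity outside the exceptional set \<open>E\<close> of finite
  linear measure.
\<close>

definition small_function :: "(complex \<Rightarrow> complex) \<Rightarrow> (complex \<Rightarrow> complex) \<Rightarrow> bool" where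
  "small_function a F \<longleftrightarrow> a meromorphic_on UNIV \<and>
     (\<exists>E::real set. E \<in> sets lebesgue \<and> emeasure lebesgue E < \<infinity> \<and>
        (\<lambda>r. nevanlinna_T r a) \<in> o[inf at_top (principal (- E))](\<lambda>r. nevanlinna_T r F))"

text \<open>
  A zero of the meromorphic function \<^term>\<open>\<lambda>w. F w - a w\<close> is a point where it has limit \<open>0\<close>. The
  pointwise condition \<^term>\<open>F z - a z = 0\<close> would also catch poles of \<^term>\<open>a\<close> at which the
  conventional value happens to agree with \<^term>\<open>F z\<close>, and would miss removable singularities.
\<close>

definition gen_picard_exceptional :: "(complex \<Rightarrow> complex) \<Rightarrow> (complex \<Rightarrow> complex) \<Rightarrow> bool" where
  "gen_picard_exceptional a F \<longleftrightarrow>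
     small_function a F \<and> finite {z. (\<lambda>w. F w - a w) \<midarrow>z\<rightarrow> 0}"

definition transcendental_entire :: "(complex \<Rightarrow> complex) \<Rightarrow> bool" where
  "transcendental_entire f \<longleftrightarrow> f holomorphic_on UNIV \<and> \<not> (\<exists>p. f = poly p)"

text \<open>
  As values on a sparse set are irrelevant, \<open>a \<equiv> 0\<close> means vanishing outside a sparse set.
\<close>

definition identically_zero :: "(complex \<Rightarrow> complex) \<Rightarrow> bool" where
  "identically_zero a \<longleftrightarrow> (\<forall>\<^sub>\<approx>z. a z = 0)"

end

theory Submission
  imports Defs
begin

text \<open>
  Put \<open>F = f^n * g\<close> and \<open>G = g^m * f\<close>. Write \<open>m(h)\<close> for the mean of \<open>log_plus \<bar>h\<bar>\<close> over the circle of
  radius \<open>r\<close>, which for entire \<open>h\<close> is the Nevanlinna characteristic, and \<open>J(h)\<close> for the mean of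
  \<open>ln \<bar>h\<bar>\<close>, which by Jensen's formula counts the zeros of \<open>h\<close> up to a constant. Trivially
  \<open>n * J(f) + J(g) = J(F) \<le> m(F)\<close>. In the other direction, if \<open>a \<noteq> 0\<close> is small with respect to \<open>F\<close>
  and \<open>F - a\<close> has finitely many zeros, then the second main theorem for the targets \<open>0\<close>, \<open>\<infinity>\<close> and
  \<open>a\<close> bounds \<open>m(F)\<close> by the truncated counting function of the zeros of \<open>F\<close>, in which the zeros of \<open>f^n\<close>
  count no more than those of \<open>f\<close>: up to a small error, \<open>m(F) \<le> J(f) + J(g)\<close>. Comparison gives
  that \<open>(n - 1) * J(f)\<close> is small, and symmetrically that \<open>(m - 1) * J(g)\<close> is small. As \<open>m, n \<ge> 2\<close>, both
  \<open>J(f)\<close> and \<open>J(g)\<close> are small compared with \<open>S = m(F) + m(G)\<close>, hence so are \<open>m(F)\<close> and \<open>m(G)\<close>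
  themselves, and \<open>S \<le> S / 2\<close> for suitable \<open>r\<close>. Since \<open>g^(m * n - 1) = G^n / F\<close> and \<open>g\<close> is
  transcendental, \<open>S\<close> grows faster than any multiple of \<open>ln r\<close>, so that the errors of logarithmic size
  are indeed small; this is a contradiction. If one of \<open>F\<close> and \<open>G\<close> is a polynomial the argument is
  unaffected, because all errors are measured against the sum \<open>S\<close>.

  The second main theorem is proved in Cartan's style. Write \<open>a = u / v\<close> with entire \<open>u\<close> and \<open>v\<close>, and
  let \<open>A = F * v\<close> and \<open>C = A - u\<close>. The Wronskian \<open>W\<close> of \<open>A\<close> and \<open>u\<close> is divisible by \<open>f^(n - 1)\<close>, and
  \<open>W / (C * u)\<close> and \<open>W / (C * A)\<close> are differences of logarithmic derivatives
  (\<open>second_main_pointwise\<close>). Thus only entire functions and means over circles occur, and multiplicities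
  enter only through Jensen's formula. Three analytic ingredients are developed for this purpose: the
  monotonicity of the characteristic (\<open>log_max_mean_mono\<close>), the lemma on the logarithmic derivative
  (\<open>log_derivative_lemma\<close>), and Borel's growth lemma (\<open>Borel_growth\<close>), which is applied once to the sum
  of the characteristics of \<open>F / a1\<close> and \<open>G / a2\<close> to get radii good for both products.

  Throughout, circles that meet zeros of the functions involved are avoided. This excludes
  countably many radii, a null set, and makes all integrands continuous.
\<close>

section \<open>Means over circles\<close>

definition circle_mean :: "real \<Rightarrow> (complex \<Rightarrow> real) \<Rightarrow> real" where
  "circle_mean r \<phi> = 1 / (2 * pi) * integral {0..2 * pi} (\<lambda>\<theta>. \<phi> (of_real r * cis \<theta>))"

text \<open>
  For an entire function \<open>h\<close> this is the counting function \<open>N(r, 1/h)\<close> of its zeros up to an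
  additive constant, by Jensen's formula. Working with this mean instead of a sum over zeros turns
  products of functions into sums without any discussion of multiplicities.
\<close>

definition log_mean :: "real \<Rightarrow> (complex \<Rightarrow> complex) \<Rightarrow> real" where
  "log_mean r h = circle_mean r (\<lambda>z. ln (norm (h z)))"

text \<open>
  Cartan's form of the Nevanlinna characteristic of \<open>A / B\<close>, up to an additive constant; common
  zeros of \<open>A\<close> and \<open>B\<close> are allowed and contribute their counting function.
\<close>

definition log_max_mean :: "real \<Rightarrow> (complex \<Rightarrow> complex) \<Rightarrow> (complex \<Rightarrow> complex) \<Rightarrow> real" where
  "log_max_mean r A B = circle_mean r (\<lambda>z. ln (max (norm (A z)) (norm (B z))))"

lemma continuous_on_circle_param:
  fixes \<phi> :: "complex \<Rightarrow> 'a::topological_space"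
  assumes "continuous_on (sphere 0 r) \<phi>" "r > 0"
  shows "continuous_on S (\<lambda>\<theta>. \<phi> (of_real r * cis \<theta>))"
proof -
  have "continuous_on S (\<phi> \<circ> (\<lambda>\<theta>. of_real r * cis \<theta>))"
    by (intro continuous_on_compose continuous_intros continuous_on_subset[OF assms(1)])
      (use assms in \<open>auto simp: norm_mult\<close>)
  then show ?thesis by (simp add: o_def)
qed

lemma circle_integrable:
  fixes \<phi> :: "complex \<Rightarrow> 'a::euclidean_space"
  assumes "continuous_on (sphere 0 r) \<phi>" "r > 0"
  shows "(\<lambda>\<theta>. \<phi> (of_real r * cis \<theta>)) integrable_on {a..b}"
  by (intro integrable_continuous_real continuous_on_circle_param assms)

lemma circle_mean_cong:
  assumes "\<And>z. norm z = r \<Longrightarrow> \<phi> z = \<psi> z" "r > 0"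
  shows "circle_mean r \<phi> = circle_mean r \<psi>"
proof -
  have "\<phi> (of_real r * cis \<theta>) = \<psi> (of_real r * cis \<theta>)" for \<theta>
    by (rule assms(1)) (use assms(2) in \<open>auto simp: norm_mult\<close>)
  then show ?thesis by (simp add: circle_mean_def)
qed

lemma circle_mean_const [simp]: "circle_mean r (\<lambda>_. c) = c"
  by (simp add: circle_mean_def)

lemma circle_mean_add:
  assumes "continuous_on (sphere 0 r) \<phi>" "continuous_on (sphere 0 r) \<psi>" "r > 0"
  shows "circle_mean r (\<lambda>z. \<phi> z + \<psi> z) = circle_mean r \<phi> + circle_mean r \<psi>"
  unfolding circle_mean_def
  by (subst integral_add[OF circle_integrable circle_integrable]) (use assms in \<open>auto simp: field_simps\<close>)

lemma circle_mean_cmult: "circle_mean r (\<lambda>z. c * \<phi> z) = c * circle_mean r \<phi>"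
  by (simp add: circle_mean_def)

lemma circle_mean_diff:
  assumes "continuous_on (sphere 0 r) \<phi>" "continuous_on (sphere 0 r) \<psi>" "r > 0"
  shows "circle_mean r (\<lambda>z. \<phi> z - \<psi> z) = circle_mean r \<phi> - circle_mean r \<psi>"
  unfolding circle_mean_def
  by (subst integral_diff[OF circle_integrable circle_integrable]) (use assms in \<open>auto simp: field_simps\<close>)

lemma circle_mean_sum:
  assumes "finite I" "\<And>i. i \<in> I \<Longrightarrow> continuous_on (sphere 0 r) (\<phi> i)" "r > 0"
  shows "circle_mean r (\<lambda>z. \<Sum>i\<in>I. \<phi> i z) = (\<Sum>i\<in>I. circle_mean r (\<phi> i))"
  unfolding circle_mean_def
  by (subst integral_sum) (auto intro!: circle_integrable assms simp: sum_divide_distrib)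

lemma circle_mean_mono:
  assumes "continuous_on (sphere 0 r) \<phi>" "continuous_on (sphere 0 r) \<psi>" "r > 0"
    "\<And>z. norm z = r \<Longrightarrow> \<phi> z \<le> \<psi> z"
  shows "circle_mean r \<phi> \<le> circle_mean r \<psi>"
  unfolding circle_mean_def
  by (intro mult_left_mono integral_le circle_integrable assms(1-3))
     (use assms(3) in \<open>auto intro!: assms(4) simp: norm_mult\<close>)

lemma circle_mean_le_const:
  assumes "continuous_on (sphere 0 r) \<phi>" "r > 0" "\<And>z. norm z = r \<Longrightarrow> \<phi> z \<le> c"
  shows "circle_mean r \<phi> \<le> c"
  using circle_mean_mono[of r \<phi> "\<lambda>_. c"] assms by auto

lemma circle_mean_ge_const:
  assumes "continuous_on (sphere 0 r) \<phi>" "r > 0" "\<And>z. norm z = r \<Longrightarrow> c \<le> \<phi> z"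
  shows "c \<le> circle_mean r \<phi>"
  using circle_mean_mono[of r "\<lambda>_. c" \<phi>] assms by auto

lemma integral_periodic_shift:
  fixes \<psi> :: "real \<Rightarrow> real"
  assumes cont: "continuous_on UNIV \<psi>" and per: "\<And>x. \<psi> (x + p) = \<psi> x" and \<alpha>: "0 \<le> \<alpha>" "\<alpha> \<le> p"
  shows "integral {0..p} (\<lambda>x. \<psi> (x + \<alpha>)) = integral {0..p} \<psi>"
proof -
  have int: "\<psi> integrable_on {a..b}" for a b
    by (intro integrable_continuous_real continuous_on_subset[OF cont]) auto
  have shift: "integral {a..b} (\<lambda>x. \<psi> (x + c)) = integral {a+c..b+c} \<psi>" if "a \<le> b" for a b c
  proof -
    have "(\<psi> has_integral integral {a+c..b+c} \<psi>) (cbox (a+c) (b+c))"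
      using int by (simp add: integrable_integral)
    from has_integral_affinity[OF this, of 1 c]
    have "((\<lambda>x. \<psi> (x + c)) has_integral integral {a+c..b+c} \<psi>) ((\<lambda>x. x - c) ` {a+c..b+c})"
      by (simp add: o_def)
    moreover have "(\<lambda>x. x - c) ` {a+c..b+c} = {a..b}"
      using that by (auto simp: image_iff intro!: bexI[of _ "_ + c"])
    ultimately show ?thesis by (simp add: integral_unique)
  qed
  have "integral {0..p} (\<lambda>x. \<psi> (x + \<alpha>)) = integral {\<alpha>..p+\<alpha>} \<psi>"
    using shift[of 0 p \<alpha>] \<alpha> by simp
  also have "\<dots> = integral {\<alpha>..p} \<psi> + integral {p..p+\<alpha>} \<psi>"
    by (rule Henstock_Kurzweil_Integration.integral_combine[symmetric]) (use \<alpha> int in auto)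
  also have "integral {p..p+\<alpha>} \<psi> = integral {0..\<alpha>} (\<lambda>x. \<psi> (x + p))"
    using shift[of 0 \<alpha> p] \<alpha> by (simp add: add.commute)
  also have "\<dots> = integral {0..\<alpha>} \<psi>" by (simp add: per)
  also have "integral {\<alpha>..p} \<psi> + integral {0..\<alpha>} \<psi> = integral {0..p} \<psi>"
    by (subst add.commute, rule Henstock_Kurzweil_Integration.integral_combine) (use \<alpha> int in auto)
  finally show ?thesis .
qed

lemma circle_mean_rotate:
  assumes "continuous_on (sphere 0 r) \<phi>" "r > 0" "norm w = 1"
  shows "circle_mean r (\<lambda>z. \<phi> (z * w)) = circle_mean r \<phi>"
proof -
  define \<alpha> where "\<alpha> = Arg2pi w"
  have \<alpha>: "w = cis \<alpha>" "0 \<le> \<alpha>" "\<alpha> < 2 * pi"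
    using assms(3) Arg2pi[of w] by (auto simp: \<alpha>_def is_Arg_def cis_conv_exp)
  have "integral {0..2*pi} (\<lambda>x. \<phi> (of_real r * cis (x + \<alpha>))) = integral {0..2*pi} (\<lambda>x. \<phi> (of_real r * cis x))"
    by (rule integral_periodic_shift[where \<psi> = "\<lambda>x. \<phi> (of_real r * cis x)"])
       (use assms \<alpha> in \<open>auto intro!: continuous_on_circle_param simp flip: cis_mult\<close>)
  then show ?thesis
    by (simp add: circle_mean_def \<alpha>(1) cis_mult mult.assoc)
qed

section \<open>Jensen's formula\<close>

lemma circle_integral_mean_value:
  fixes f :: "complex \<Rightarrow> complex"
  assumes "f holomorphic_on ball 0 R" "0 < r" "r < R"
  shows "((\<lambda>\<theta>. f (of_real r * cis \<theta>)) has_integral (2 * pi * f 0)) {0..2*pi}"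
proof -
  have "((\<lambda>u. f u / (u - 0)) has_contour_integral (2 * of_real pi * \<i> * f 0)) (circlepath 0 r)"
    by (rule Cauchy_integral_circlepath_simple)
       (use assms in \<open>auto intro!: holomorphic_on_subset[OF assms(1)]\<close>)
  then have "((\<lambda>t. f (of_real r * cis t) / (of_real r * cis t) * r * \<i> * cis t) has_integral (2 * of_real pi * \<i> * f 0)) {0..2*pi}"
    unfolding circlepath_def by (subst (asm) has_contour_integral_part_circlepath_iff) auto
  then have "((\<lambda>t. \<i> * f (of_real r * cis t)) has_integral (2 * of_real pi * \<i> * f 0)) {0..2*pi}"
    by (rule has_integral_eq[rotated]) (use assms in auto)
  from has_integral_mult_right[OF this, of "-\<i>"] show ?thesis
    by (simp add: mult_ac)
qed

text \<open>
  \<open>ln \<bar>f\<bar>\<close> is the real part of a holomorphic logarithm, to which the mean value property applies.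
\<close>

lemma log_mean_zero_free:
  assumes "f holomorphic_on ball 0 R" "0 < r" "r < R" "\<And>z. norm z < R \<Longrightarrow> f z \<noteq> 0"
  shows "log_mean r f = ln (norm (f 0))"
proof -
  obtain L where L: "L holomorphic_on ball 0 R" "\<And>x. x \<in> ball 0 R \<Longrightarrow> exp (L x) = f x"
    using holomorphic_logarithm_exists[OF convex_ball open_ball assms(1), of 0] assms(2-) by (auto simp: dist_norm)
  have eq: "ln (norm (f z)) = Re (L z)" if "norm z < R" for z
    using L(2)[of z] that by (metis ln_exp norm_exp_eq_Re mem_ball_0)
  have "((\<lambda>\<theta>. Re (L (of_real r * cis \<theta>))) has_integral (Re (2 * pi * L 0))) {0..2*pi}"
    by (intro has_integral_Re circle_integral_mean_value[OF L(1)]) (use assms in auto)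
  then have "circle_mean r (\<lambda>z. Re (L z)) = Re (L 0)"
    by (simp add: circle_mean_def integral_unique)
  moreover have "circle_mean r (\<lambda>z. Re (L z)) = circle_mean r (\<lambda>z. ln (norm (f z)))"
    by (rule circle_mean_cong) (use assms eq in auto)
  ultimately show ?thesis using eq[of 0] assms by (simp add: log_mean_def)
qed

text \<open>
  On the circle \<open>\<bar>z\<bar> = r\<close> the factor \<open>z - b\<close> may be exchanged for one that vanishes at most at the
  reflected point \<open>r\<^sup>2 / cnj b\<close>, because \<open>r\<^sup>2 = z * cnj z\<close> there.
\<close>

lemma norm_Blaschke_denominator:
  assumes "r > 0" "norm z = r"
  shows "norm (of_real r - cnj b * z / of_real r) = norm (z - b)"
proof -
  have "z * cnj z = of_real r * of_real r"
    using assms complex_norm_square[of z] by (simp add: power2_eq_square)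
  then have "(of_real r - cnj b * z / of_real r) * of_real r = z * (cnj z - cnj b)"
    using assms by (auto simp: field_simps)
  then have "norm ((of_real r - cnj b * z / of_real r) * of_real r) = norm (z * cnj (z - b))" by simp
  then show ?thesis using assms by (simp add: norm_mult del: complex_cnj_diff)
qed

lemma log_mean_linear:
  assumes "r > 0" "norm b \<noteq> r"
  shows "log_mean r (\<lambda>z. z - b) = ln (max r (norm b))"
proof (cases "norm b > r")
  case True
  then show ?thesis
    by (subst log_mean_zero_free[where R = "norm b"]) (use assms in \<open>auto intro!: holomorphic_intros\<close>)
next
  case False
  then have b: "norm b < r" using assms by auto
  define q where "q = (\<lambda>z. of_real r - cnj b * z / of_real r)"
  have "norm (z - b) = norm (q z)" if "norm z = r" for z
    unfolding q_def by (rule norm_Blaschke_denominator[OF assms(1) that, symmetric])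
  then have "log_mean r (\<lambda>z. z - b) = log_mean r q"
    unfolding log_mean_def by (intro circle_mean_cong) (use assms in auto)
  also have "\<dots> = ln (norm (q 0))"
  proof (rule log_mean_zero_free)
    define R where "R = (if b = 0 then r + 1 else r * r / norm b)"
    show "q holomorphic_on ball 0 R" unfolding q_def by (intro holomorphic_intros) (use assms in auto)
    show "r < R" using b assms by (auto simp: R_def field_simps)
    show "q z \<noteq> 0" if "norm z < R" for z
    proof
      assume "q z = 0"
      then have "cnj b * z = of_real r * of_real r" using assms by (auto simp: q_def field_simps)
      then have "norm (cnj b * z) = norm (of_real r * of_real r :: complex)" by simp
      then have "norm b * norm z = r * r" using assms by (simp add: norm_mult)
      with that assms show False by (auto simp: R_def field_simps split: if_splits)
    qed
  qed (use assms in auto)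
  finally show ?thesis using b assms by (simp add: q_def max_def)
qed

lemma finite_zeros_disc:
  assumes "h holomorphic_on UNIV" "h w \<noteq> 0"
  shows "finite {z. norm z \<le> R \<and> h z = 0}"
proof (cases "h constant_on UNIV")
  case True
  then have "{z. norm z \<le> R \<and> h z = 0} = {}"
    using assms(2) by (auto simp: constant_on_def)
  then show ?thesis by (simp only: finite.emptyI)
next
  case False
  have "finite {z \<in> cball 0 R. h z = 0}"
    by (rule holomorphic_compact_finite_zeros[of h UNIV]) (use assms False in auto)
  then show ?thesis by (simp add: Collect_conj_eq cball_def dist_norm)
qed

lemma entire_nonzero_near:
  assumes "h holomorphic_on UNIV" "h w \<noteq> 0"
  shows "\<forall>\<^sub>F x in at z. h x \<noteq> 0"
  using non_zero_neighbour_alt[of h UNIV z w] assms by (simp add: Convex.connected_UNIV)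

lemma zorder_entire_pos:
  assumes "h holomorphic_on UNIV" "h w \<noteq> 0" "h z = 0"
  shows "zorder h z > 0"
  using zorder_pos_iff[OF assms(1), of z] entire_nonzero_near[OF assms(1,2), of z] assms(3)
  by (simp add: eventually_frequently)

lemma zorder_prod_linear_powers:
  fixes \<nu> :: "complex \<Rightarrow> nat"
  assumes "finite Z"
  shows "zorder (\<lambda>w. \<Prod>b\<in>Z. (w - b) ^ \<nu> b) z = (if z \<in> Z then int (\<nu> z) else 0)"
proof (rule zorder_eqI[where g = "\<lambda>w. \<Prod>b\<in>Z-{z}. (w - b) ^ \<nu> b" and S = UNIV])
  fix w
  show "(\<Prod>b\<in>Z. (w - b) ^ \<nu> b) = (\<Prod>b\<in>Z-{z}. (w - b) ^ \<nu> b) * (w - z) powi (if z \<in> Z then int (\<nu> z) else 0)"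
    using assms by (auto simp: prod.remove[of Z z])
qed (use assms in \<open>auto intro!: holomorphic_intros\<close>)

text \<open>
  The factorization is stated on a disc slightly larger than the closed one, so that \<open>q\<close> has a
  holomorphic logarithm near the closed disc. Such a disc exists because only finitely many zeros
  lie in a bounded region.
\<close>

lemma zero_factorization:
  assumes h: "h holomorphic_on UNIV" "h w \<noteq> 0" and "R > 0"
  obtains q R' where "R < R'" "q holomorphic_on ball 0 R'" "\<forall>z\<in>ball 0 R'. q z \<noteq> 0"
    "\<forall>z\<in>ball 0 R'. h z = q z * (\<Prod>b | norm b \<le> R \<and> h b = 0. (z - b) ^ nat (zorder h b))"
proof -
  define Z where "Z = {b. norm b \<le> R \<and> h b = 0}"
  define P where "P = (\<lambda>z. \<Prod>b\<in>Z. (z - b) ^ nat (zorder h b))"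
  have "finite {z. norm z \<le> R + 1 \<and> h z = 0}" "finite Z"
    using finite_zeros_disc[OF h] by (auto simp: Z_def)
  \<comment> \<open>The moduli of the next zeros beyond \<open>R\<close>, cut off at \<open>R + 1\<close> in case there are none nearby.\<close>
  define N where "N = insert (R + 1) (norm ` {z. R < norm z \<and> norm z \<le> R + 1 \<and> h z = 0})"
  have N: "finite N" "N \<noteq> {}"
    using \<open>finite {z. norm z \<le> R + 1 \<and> h z = 0}\<close> by (auto simp: N_def elim: finite_subset[rotated])
  define R' where "R' = Min N"
  have "R < R'" using N by (auto simp: R'_def N_def)
  have "R' \<le> R + 1" unfolding R'_def by (rule Min_le) (use N in \<open>auto simp: N_def\<close>)
  have zeros: "norm z \<le> R" if "h z = 0" "norm z < R'" for z
  proof (rule ccontr)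
    assume "\<not> norm z \<le> R"
    then have "norm z \<in> N" using that \<open>R' \<le> R + 1\<close> by (auto simp: N_def)
    then have "R' \<le> norm z" unfolding R'_def using N by auto
    with that show False by simp
  qed
  have pos: "zorder h z > 0" if "h z = 0" for z
    using zorder_entire_pos[OF h that] .
  obtain q where q: "q holomorphic_on ball 0 R'" "\<And>z. z \<in> ball 0 R' \<Longrightarrow> q z \<noteq> 0" "\<And>z. z \<in> ball 0 R' \<Longrightarrow> h z = q z * P z"
  proof (rule holomorphic_zorder_factorization[of h "ball 0 R'" P])
    show "h holomorphic_on ball 0 R'" using h(1) holomorphic_on_subset by blast
    show "P holomorphic_on ball 0 R'" unfolding P_def by (intro holomorphic_intros)
    show "(P z = 0) = (h z = 0)" if "z \<in> ball 0 R'" for z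
      using that zeros[of z] pos \<open>finite Z\<close> by (auto simp: P_def Z_def)
    show "zorder P z = zorder h z" if "z \<in> ball 0 R'" for z
    proof (cases "h z = 0")
      case True
      then show ?thesis using that zeros[of z] pos[of z] \<open>finite Z\<close>
        by (simp add: P_def zorder_prod_linear_powers Z_def)
    next
      case False
      have "zorder h z = 0"
        by (rule zorder_eq_0I) (use False h(1) analytic_on_open[of UNIV h] analytic_on_subset in auto)
      then show ?thesis using False \<open>finite Z\<close>
        by (simp add: P_def zorder_prod_linear_powers Z_def)
    qed
  qed auto
  then show thesis
    using that[of R' q] \<open>R < R'\<close> by (auto simp: P_def Z_def)
qed

lemma continuous_on_ln_norm:
  assumes "h holomorphic_on S" "sphere 0 r \<subseteq> S" "\<And>z. norm z = r \<Longrightarrow> h z \<noteq> 0"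
  shows "continuous_on (sphere 0 r) (\<lambda>z. ln (norm (h z)))"
  by (intro continuous_intros holomorphic_on_imp_continuous_on holomorphic_on_subset[OF assms(1,2)])
     (use assms(3) in auto)

lemmas continuous_on_ln_norm_entire = continuous_on_ln_norm[of _ UNIV, OF _ subset_UNIV]

text \<open>
  Jensen's formula, as a comparison of two radii: inserting the factorization of \<open>h\<close>, the
  contribution of the zero-free factor is the same for both. This form avoids a special treatment of
  a zero at the origin. Restricting to circles free of zeros keeps every integrand continuous; this
  excludes only countably many radii.
\<close>

lemma Jensen_difference:
  assumes h: "h holomorphic_on UNIV" "h w \<noteq> 0" and r: "0 < r" "r \<le> R"
    and nz: "\<And>z. norm z = r \<Longrightarrow> h z \<noteq> 0" "\<And>z. norm z = R \<Longrightarrow> h z \<noteq> 0"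
  shows "log_mean R h - log_mean r h =
    (\<Sum>b | norm b \<le> R \<and> h b = 0. real (nat (zorder h b)) * (ln R - ln (max r (norm b))))"
proof -
  define Z where "Z = {b. norm b \<le> R \<and> h b = 0}"
  define \<nu> where "\<nu> b = nat (zorder h b)" for b
  have "finite Z" using finite_zeros_disc[OF h] by (auto simp: Z_def)
  obtain q R' where q0: "R < R'" "q holomorphic_on ball 0 R'" "\<forall>z\<in>ball 0 R'. q z \<noteq> 0"
    "\<forall>z\<in>ball 0 R'. h z = q z * (\<Prod>b\<in>Z. (z - b) ^ \<nu> b)"
    by (rule zero_factorization[OF h less_le_trans[OF r], folded Z_def \<nu>_def])
  note q = q0(1,2) q0(3)[rule_format, unfolded mem_ball_0] q0(4)[rule_format, unfolded mem_ball_0]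
  have mean: "log_mean s h = ln (norm (q 0)) + (\<Sum>b\<in>Z. \<nu> b * ln (max s (norm b)))"
    if s: "0 < s" "s \<le> R" "\<And>z. norm z = s \<Longrightarrow> h z \<noteq> 0" for s
  proof -
    have ne: "z \<noteq> b" if "norm z = s" "b \<in> Z" for z b
      using s(3)[OF that(1)] that(2) by (auto simp: Z_def)
    have eq: "ln (norm (h z)) = ln (norm (q z)) + (\<Sum>b\<in>Z. \<nu> b * ln (norm (z - b)))" if "norm z = s" for z
    proof -
      have "norm z < R'" using that s q(1) by simp
      then have "ln (norm (h z)) = ln (norm (q z) * (\<Prod>b\<in>Z. norm (z - b) ^ \<nu> b))"
        using q(4)[of z] by (simp add: norm_mult prod_norm[symmetric] norm_power)
      also have "\<dots> = ln (norm (q z)) + ln (\<Prod>b\<in>Z. norm (z - b) ^ \<nu> b)"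
        using q(3)[OF \<open>norm z < R'\<close>] ne that \<open>finite Z\<close> by (intro ln_mult_pos prod_pos) auto
      also have "ln (\<Prod>b\<in>Z. norm (z - b) ^ \<nu> b) = (\<Sum>b\<in>Z. ln (norm (z - b) ^ \<nu> b))"
        using ne that \<open>finite Z\<close> by (intro ln_prod) auto
      also have "\<dots> = (\<Sum>b\<in>Z. \<nu> b * ln (norm (z - b)))"
        by (simp add: ln_realpow)
      finally show ?thesis .
    qed
    have c1: "continuous_on (sphere 0 s) (\<lambda>z. ln (norm (q z)))"
      by (rule continuous_on_ln_norm[OF q(2)]) (use s q in auto)
    have c2: "continuous_on (sphere 0 s) (\<lambda>z. \<nu> b * ln (norm (z - b)))" if "b \<in> Z" for b
      by (intro continuous_intros) (use ne that in auto)
    have "log_mean s h = circle_mean s (\<lambda>z. ln (norm (q z)) + (\<Sum>b\<in>Z. \<nu> b * ln (norm (z - b))))"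
      unfolding log_mean_def by (rule circle_mean_cong) (use eq s in auto)
    also have "\<dots> = circle_mean s (\<lambda>z. ln (norm (q z))) + circle_mean s (\<lambda>z. (\<Sum>b\<in>Z. \<nu> b * ln (norm (z - b))))"
      by (intro circle_mean_add c1 continuous_on_sum c2 s)
    also have "circle_mean s (\<lambda>z. (\<Sum>b\<in>Z. \<nu> b * ln (norm (z - b)))) = (\<Sum>b\<in>Z. \<nu> b * log_mean s (\<lambda>z. z - b))"
      by (subst circle_mean_sum) (auto intro!: c2 s \<open>finite Z\<close> simp: circle_mean_cmult log_mean_def)
    also have "\<dots> = (\<Sum>b\<in>Z. \<nu> b * ln (max s (norm b)))"
      by (intro sum.cong refl arg_cong2[where f = "(*)"] log_mean_linear s) (use ne in auto)
    also have "circle_mean s (\<lambda>z. ln (norm (q z))) = ln (norm (q 0))"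
      using log_mean_zero_free[OF q(2), of s] s q by (simp add: log_mean_def)
    finally show ?thesis .
  qed
  have "log_mean R h - log_mean r h = (\<Sum>b\<in>Z. \<nu> b * ln (max R (norm b))) - (\<Sum>b\<in>Z. \<nu> b * ln (max r (norm b)))"
    using mean[of R] mean[of r] r nz by simp
  also have "\<dots> = (\<Sum>b\<in>Z. \<nu> b * (ln R - ln (max r (norm b))))"
    unfolding sum_subtractf[symmetric] by (intro sum.cong) (auto simp: Z_def algebra_simps max_def)
  finally show ?thesis by (simp add: Z_def \<nu>_def)
qed

lemma Jensen_term_nonneg:
  assumes "0 < r" "r \<le> R" "norm b \<le> R"
  shows "0 \<le> real (nat (zorder h b)) * (ln R - ln (max r (norm b)))"
  using assms by (intro mult_nonneg_nonneg) auto

lemma log_mean_mono: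
  assumes "h holomorphic_on UNIV" "h w \<noteq> 0" "0 < r" "r \<le> R"
    "\<And>z. norm z = r \<Longrightarrow> h z \<noteq> 0" "\<And>z. norm z = R \<Longrightarrow> h z \<noteq> 0"
  shows "log_mean r h \<le> log_mean R h"
proof -
  have "0 \<le> (\<Sum>b | norm b \<le> R \<and> h b = 0. real (nat (zorder h b)) * (ln R - ln (max r (norm b))))"
    by (intro sum_nonneg Jensen_term_nonneg) (use assms in auto)
  then show ?thesis using Jensen_difference[OF assms] by simp
qed

text \<open>
  A zero in the smaller disc has gained at least \<open>ln R2 - ln R1\<close> in Jensen's formula when the radius
  reaches \<open>R2\<close>.
\<close>

lemma zero_count_bound:
  assumes h: "h holomorphic_on UNIV" "h w \<noteq> 0" and r: "0 < r" "r \<le> R1" "R1 \<le> R2"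
    and nz: "\<And>z. norm z = r \<Longrightarrow> h z \<noteq> 0" "\<And>z. norm z = R2 \<Longrightarrow> h z \<noteq> 0"
  shows "(\<Sum>b | norm b \<le> R1 \<and> h b = 0. real (nat (zorder h b))) * (ln R2 - ln R1) \<le> log_mean R2 h - log_mean r h"
proof -
  have "(\<Sum>b | norm b \<le> R1 \<and> h b = 0. real (nat (zorder h b))) * (ln R2 - ln R1)
    = (\<Sum>b | norm b \<le> R1 \<and> h b = 0. real (nat (zorder h b)) * (ln R2 - ln R1))"
    by (simp add: sum_distrib_right)
  also have "\<dots> \<le> (\<Sum>b | norm b \<le> R1 \<and> h b = 0. real (nat (zorder h b)) * (ln R2 - ln (max r (norm b))))"
    by (intro sum_mono mult_left_mono) (use r in auto)
  also have "\<dots> \<le> (\<Sum>b | norm b \<le> R2 \<and> h b = 0. real (nat (zorder h b)) * (ln R2 - ln (max r (norm b))))"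
    by (intro sum_mono2 finite_zeros_disc[OF h] Jensen_term_nonneg) (use r in auto)
  also have "\<dots> = log_mean R2 h - log_mean r h"
    by (rule Jensen_difference[symmetric, OF h]) (use r nz in auto)
  finally show ?thesis .
qed

lemma log_mean_finite_zeros:
  assumes h: "h holomorphic_on UNIV" "h w \<noteq> 0" and fin: "finite {z. h z = 0}"
    and r: "0 < r" "\<And>z. norm z = r \<Longrightarrow> h z \<noteq> 0"
  obtains d where "\<And>R. r \<le> R \<Longrightarrow> (\<And>z. norm z = R \<Longrightarrow> h z \<noteq> 0) \<Longrightarrow>
    log_mean R h \<le> log_mean r h + d * (ln R - ln r)" "d \<ge> 0"
proof (rule that)
  show "0 \<le> (\<Sum>b | h b = 0. real (nat (zorder h b)))" by (intro sum_nonneg) auto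
  fix R assume R: "r \<le> R" "\<And>z. norm z = R \<Longrightarrow> h z \<noteq> 0"
  have "log_mean R h - log_mean r h =
    (\<Sum>b | norm b \<le> R \<and> h b = 0. real (nat (zorder h b)) * (ln R - ln (max r (norm b))))"
    using Jensen_difference[OF h r(1) R(1) r(2) R(2)] by simp
  also have "\<dots> \<le> (\<Sum>b | norm b \<le> R \<and> h b = 0. real (nat (zorder h b)) * (ln R - ln r))"
    by (intro sum_mono mult_left_mono) (use r in auto)
  also have "\<dots> \<le> (\<Sum>b | h b = 0. real (nat (zorder h b)) * (ln R - ln r))"
    by (intro sum_mono2 fin) (use r R in auto)
  finally show "log_mean R h \<le> log_mean r h + (\<Sum>b | h b = 0. real (nat (zorder h b))) * (ln R - ln r)"
    by (simp add: sum_distrib_right)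
qed

lemma log_mean_many_zeros:
  assumes h: "h holomorphic_on UNIV" "h w \<noteq> 0" and Z: "finite Z" "\<And>z. z \<in> Z \<Longrightarrow> h z = 0"
    and r: "0 < r" "r \<le> R" "\<And>z. z \<in> Z \<Longrightarrow> norm z \<le> R"
    and nz: "\<And>z. norm z = r \<Longrightarrow> h z \<noteq> 0" "\<And>z. norm z = R \<Longrightarrow> h z \<noteq> 0"
  shows "log_mean r h + card Z * ln R - (\<Sum>b\<in>Z. ln (max r (norm b))) \<le> log_mean R h"
proof -
  have "card Z * ln R - (\<Sum>b\<in>Z. ln (max r (norm b))) = (\<Sum>b\<in>Z. 1 * (ln R - ln (max r (norm b))))"
    by (simp add: sum_subtractf)
  also have "\<dots> \<le> (\<Sum>b\<in>Z. real (nat (zorder h b)) * (ln R - ln (max r (norm b))))"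
  proof (intro sum_mono mult_right_mono)
    fix b assume "b \<in> Z"
    then show "1 \<le> real (nat (zorder h b))" "0 \<le> ln R - ln (max r (norm b))"
      using zorder_entire_pos[OF h, of b] Z(2)[of b] r by auto
  qed
  also have "\<dots> \<le> (\<Sum>b | norm b \<le> R \<and> h b = 0. real (nat (zorder h b)) * (ln R - ln (max r (norm b))))"
    by (intro sum_mono2 finite_zeros_disc[OF h] Jensen_term_nonneg) (use r Z in auto)
  also have "\<dots> = log_mean R h - log_mean r h"
    by (rule Jensen_difference[symmetric, OF h r(1,2) nz])
  finally show ?thesis by simp
qed

section \<open>Monotonicity of the characteristic\<close>

text \<open>
  The average of \<open>\<phi>\<close> over the rotations by the \<open>N\<close>-th roots of unity. Its values at single points
  approximate the circle mean, and for \<open>\<phi> = ln \<bar>h\<bar>\<close> it is \<open>1/N\<close> times the logarithm of the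
  modulus of one holomorphic function, so that the maximum principle applies.
\<close>

definition rot_mean :: "nat \<Rightarrow> (complex \<Rightarrow> real) \<Rightarrow> complex \<Rightarrow> real" where
  "rot_mean N \<phi> z = (\<Sum>k<N. \<phi> (z * cis (2 * pi * real k / N))) / N"

lemma rot_mean_invariant:
  assumes "N > 0"
  shows "rot_mean N \<phi> (z * cis (2 * pi / N)) = rot_mean N \<phi> z"
proof -
  have "(\<Sum>k<N. \<phi> (z * cis (2 * pi / N) * cis (2 * pi * real k / N))) = (\<Sum>k<N. \<phi> (z * cis (2 * pi * Suc k / N)))"
    by (intro sum.cong refl arg_cong[where f = \<phi>]) (simp add: cis_mult mult.assoc field_simps)
  also have "\<dots> = (\<Sum>k<N. \<phi> (z * cis (2 * pi * real k / N))) + \<phi> (z * cis (2 * pi * N / N)) - \<phi> (z * cis (2 * pi * 0 / N))"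
    using sum.lessThan_Suc_shift[of "\<lambda>k. \<phi> (z * cis (2 * pi * real k / N))" N] by simp
  also have "\<dots> = (\<Sum>k<N. \<phi> (z * cis (2 * pi * real k / N)))"
    using assms by simp
  finally show ?thesis by (simp add: rot_mean_def)
qed

lemma rot_mean_invariant_power:
  assumes "N > 0"
  shows "rot_mean N \<phi> (z * cis (2 * pi * real j / N)) = rot_mean N \<phi> z"
proof (induction j)
  case (Suc j)
  have "2 * pi * real (Suc j) / N = 2 * pi * real j / N + 2 * pi / N"
    by (simp add: add_divide_distrib distrib_left)
  then have "z * cis (2 * pi * real (Suc j) / N) = (z * cis (2 * pi * real j / N)) * cis (2 * pi / N)"
    by (simp only: cis_mult mult.assoc)
  then show ?case using rot_mean_invariant[OF assms] Suc by (simp only:)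
qed simp

lemma continuous_on_circle_rotate:
  fixes \<phi> :: "complex \<Rightarrow> real"
  assumes "continuous_on (sphere 0 r) \<phi>" "norm w = 1"
  shows "continuous_on (sphere 0 r) (\<lambda>z. \<phi> (z * w))"
proof -
  have "continuous_on (sphere 0 r) (\<phi> \<circ> (\<lambda>z. z * w))"
    by (intro continuous_on_compose continuous_intros continuous_on_subset[OF assms(1)])
      (use assms(2) in \<open>auto simp: norm_mult\<close>)
  then show ?thesis by (simp add: o_def)
qed

lemma circle_mean_rot_mean:
  assumes "continuous_on (sphere 0 r) \<phi>" "r > 0" "N > 0"
  shows "circle_mean r (rot_mean N \<phi>) = circle_mean r \<phi>"
proof -
  note c = continuous_on_circle_rotate[OF assms(1)]
  have "circle_mean r (rot_mean N \<phi>) = circle_mean r (\<lambda>z. (1 / N) * (\<Sum>k<N. \<phi> (z * cis (2 * pi * real k / N))))"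
    unfolding rot_mean_def by simp
  also have "\<dots> = (1 / N) * (\<Sum>k<N. circle_mean r (\<lambda>z. \<phi> (z * cis (2 * pi * real k / N))))"
    unfolding circle_mean_cmult by (subst circle_mean_sum) (auto intro!: c assms)
  also have "\<dots> = circle_mean r \<phi>"
    using assms by (simp add: circle_mean_rotate)
  finally show ?thesis .
qed

lemma continuous_on_rot_mean:
  assumes "continuous_on (sphere 0 r) \<phi>"
  shows "continuous_on (sphere 0 r) (rot_mean N \<phi>)"
proof -
  note c = continuous_on_circle_rotate[OF assms(1)]
  have "continuous_on (sphere 0 r) (\<lambda>z. (1 / N) * (\<Sum>k<N. \<phi> (z * cis (2 * pi * real k / N))))"
    by (intro continuous_intros c) auto
  then show ?thesis unfolding rot_mean_def by simp
qed

text \<open>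
  Up to a rotation by a root of unity, which does not affect \<open>rot_mean N \<phi>\<close>, two points of the
  circle differ by an angle below \<open>2 * pi / N\<close>. Hence by uniform continuity \<open>rot_mean N \<phi>\<close>
  oscillates by at most \<open>e\<close>, and so it is \<open>e\<close>-close to its own mean, which is that of \<open>\<phi>\<close>.
\<close>

lemma rot_mean_close:
  assumes cont: "continuous_on (sphere 0 r) \<phi>" and "r > 0" "e > 0"
  obtains M where "\<And>N z. N \<ge> M \<Longrightarrow> N > 0 \<Longrightarrow> norm z = r \<Longrightarrow> \<bar>rot_mean N \<phi> z - circle_mean r \<phi>\<bar> \<le> e"
proof -
  have "uniformly_continuous_on (sphere 0 r) \<phi>"
    by (intro compact_uniformly_continuous cont) auto
  then obtain d where d: "d > 0" "\<And>z z'. z \<in> sphere 0 r \<Longrightarrow> z' \<in> sphere 0 r \<Longrightarrow> dist z' z < d \<Longrightarrow> dist (\<phi> z') (\<phi> z) < e"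
    using \<open>e > 0\<close> unfolding uniformly_continuous_on_def by metis
  obtain M :: nat where M: "real M > 2 * pi * r / d" using reals_Archimedean2 by blast
  show thesis
  proof (rule that)
    fix N z assume N: "N \<ge> M" "N > 0" and z: "norm (z::complex) = r"
    have osc: "\<bar>rot_mean N \<phi> z - rot_mean N \<phi> z'\<bar> \<le> e" if z': "norm z' = r" for z'
    proof -
      obtain \<beta> where \<beta>: "z' = z * cis \<beta>" "0 \<le> \<beta>"
      proof (rule that)
        show "z' = z * cis (Arg2pi (z' / z))"
          using Arg2pi[of "z' / z"] z z' \<open>r > 0\<close>
          by (auto simp: is_Arg_def cis_conv_exp norm_divide field_simps)
        show "0 \<le> Arg2pi (z' / z)" by (rule Arg2pi_ge_0)
      qed
      define h where "h = 2 * pi / N"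
      have h: "h > 0" using N by (simp add: h_def)
      \<comment> \<open>Split the angle \<open>\<beta>\<close> into a multiple of \<open>h\<close> and a remainder \<open>t < h\<close>.\<close>
      define j where "j = nat \<lfloor>\<beta> / h\<rfloor>"
      define t where "t = \<beta> - j * h"
      have j: "real j = of_int \<lfloor>\<beta> / h\<rfloor>" using \<beta> h by (simp add: j_def)
      have "real j * h \<le> \<beta>" "\<beta> < (real j + 1) * h"
        using h unfolding j by (auto simp flip: pos_le_divide_eq pos_divide_less_eq intro: floor_correct)
      then have t: "0 \<le> t" "t < h" by (auto simp: t_def algebra_simps)
      have z'_eq: "z' = (z * cis t) * cis (2 * pi * real j / N)"
        using \<beta> by (simp add: cis_mult mult.assoc t_def h_def)
      have "rot_mean N \<phi> z' = rot_mean N \<phi> (z * cis t)"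
        unfolding z'_eq by (rule rot_mean_invariant_power) fact
      also have "\<bar>rot_mean N \<phi> z - rot_mean N \<phi> (z * cis t)\<bar> \<le> e"
      proof -
        have "\<bar>\<phi> (z * cis (2 * pi * real k / N)) - \<phi> (z * cis t * cis (2 * pi * real k / N))\<bar> \<le> e" for k
        proof -
          have "norm (cis t - 1) \<le> t"
            using dist_exp_i_1[of t] abs_sin_x_le_abs_x[of "t / 2"] t by (simp add: cis_conv_exp)
          have "dist (z * cis (2 * pi * real k / N)) (z * cis t * cis (2 * pi * real k / N)) = r * norm (cis t - 1)"
          proof -
            have "z * cis (2 * pi * real k / N) - z * cis t * cis (2 * pi * real k / N) = z * cis (2 * pi * real k / N) * (1 - cis t)"
              by (simp add: algebra_simps)
            then show ?thesis by (simp add: dist_norm norm_mult z norm_minus_commute)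
          qed
          also have "\<dots> \<le> r * t" using \<open>norm (cis t - 1) \<le> t\<close> \<open>r > 0\<close> by (intro mult_left_mono) auto
          also have "\<dots> < r * h" using t \<open>r > 0\<close> by simp
          also have "\<dots> < d"
          proof -
            have "2 * pi * r / d < N" using M N by linarith
            then show ?thesis using d N by (simp add: h_def field_simps)
          qed
          finally have "dist (\<phi> (z * cis (2 * pi * real k / N))) (\<phi> (z * cis t * cis (2 * pi * real k / N))) < e"
            by (intro d(2)) (use z in \<open>auto simp: norm_mult\<close>)
          then show ?thesis by (simp add: dist_real_def)
        qed
        then have "\<bar>\<Sum>k<N. \<phi> (z * cis (2 * pi * real k / N)) - \<phi> (z * cis t * cis (2 * pi * real k / N))\<bar> \<le> (\<Sum>k<N. e)"
          by (intro order_trans[OF sum_abs] sum_mono)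
        then show ?thesis using N
          by (simp add: rot_mean_def sum_subtractf field_simps flip: diff_divide_distrib)
      qed
      finally show ?thesis .
    qed
    have c: "continuous_on (sphere 0 r) (rot_mean N \<phi>)" by (rule continuous_on_rot_mean[OF cont])
    have "circle_mean r (rot_mean N \<phi>) \<le> rot_mean N \<phi> z + e"
      by (rule circle_mean_le_const[OF c \<open>r > 0\<close>]) (use osc in force)
    moreover have "rot_mean N \<phi> z - e \<le> circle_mean r (rot_mean N \<phi>)"
      by (rule circle_mean_ge_const[OF c \<open>r > 0\<close>]) (use osc in force)
    ultimately show "\<bar>rot_mean N \<phi> z - circle_mean r \<phi>\<bar> \<le> e"
      unfolding circle_mean_rot_mean[OF cont \<open>r > 0\<close> \<open>N > 0\<close>] by linarith
  qed
qed

text \<open>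
  At the fixed point \<open>z\<close> each maximum is attained by one of \<open>A\<close> and \<open>B\<close>. The product of these
  choices is one entire function, it is dominated everywhere by the product of the maxima, and the
  maximum modulus principle applies to it.
\<close>

lemma rot_prod_max_principle:
  fixes A B :: "complex \<Rightarrow> complex" and w :: "nat \<Rightarrow> complex"
  assumes A: "A holomorphic_on UNIV" and B: "B holomorphic_on UNIV" and "r \<le> R" "norm z = r"
    and bound: "\<And>y. norm y = R \<Longrightarrow> (\<Prod>k<N. max (norm (A (y * w k))) (norm (B (y * w k)))) \<le> c"
  shows "(\<Prod>k<N. max (norm (A (z * w k))) (norm (B (z * w k)))) \<le> c"
proof -
  define G where "G k = (if norm (B (z * w k)) \<le> norm (A (z * w k)) then A else B)" for k
  define P where "P y = (\<Prod>k<N. G k (y * w k))" for y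
  have G: "G k holomorphic_on UNIV" for k using A B by (simp add: G_def)
  have hol: "P holomorphic_on UNIV"
    unfolding P_def
    by (intro holomorphic_intros holomorphic_on_compose_gen[OF _ G, unfolded o_def]) auto
  have "norm (P z) \<le> c"
  proof (rule maximum_modulus_frontier[of P "cball 0 R"])
    fix y assume "y \<in> frontier (cball (0::complex) R)"
    then have y: "norm y = R" using frontier_cball[of "0::complex" R] by (auto simp: sphere_def)
    have "norm (P y) = (\<Prod>k<N. norm (G k (y * w k)))"
      by (simp add: P_def prod_norm)
    also have "\<dots> \<le> (\<Prod>k<N. max (norm (A (y * w k))) (norm (B (y * w k))))"
      by (intro prod_mono) (auto simp: G_def)
    also have "\<dots> \<le> c" by (rule bound[OF y])
    finally show "norm (P y) \<le> c" .
  qed (use assms hol in \<open>auto intro: holomorphic_on_subset holomorphic_on_imp_continuous_on\<close>)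
  moreover have "norm (P z) = (\<Prod>k<N. max (norm (A (z * w k))) (norm (B (z * w k))))"
    by (auto simp: P_def G_def prod_norm[symmetric] max_def intro!: prod.cong)
  ultimately show ?thesis by simp
qed

text \<open>
  Monotonicity of the characteristic. It replaces the usual appeal to subharmonicity of
  \<open>ln (max \<bar>A\<bar> \<bar>B\<bar>)\<close>: both means are approximated by averages over finitely many rotations,
  and these are comparable by the maximum principle.
\<close>

lemma log_max_mean_mono:
  assumes A: "A holomorphic_on UNIV" and B: "B holomorphic_on UNIV" and r: "0 < r" "r \<le> R"
    and nz: "\<And>z. norm z = r \<Longrightarrow> A z \<noteq> 0 \<or> B z \<noteq> 0" "\<And>z. norm z = R \<Longrightarrow> A z \<noteq> 0 \<or> B z \<noteq> 0"
  shows "log_max_mean r A B \<le> log_max_mean R A B"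
proof (rule field_le_epsilon)
  fix e :: real assume "e > 0"
  define \<phi> where "\<phi> z = ln (max (norm (A z)) (norm (B z)))" for z
  have cont: "continuous_on (sphere 0 s) \<phi>" if "\<And>z. norm z = s \<Longrightarrow> A z \<noteq> 0 \<or> B z \<noteq> 0" for s
    unfolding \<phi>_def
    by (intro continuous_intros holomorphic_on_imp_continuous_on holomorphic_on_subset[OF A] holomorphic_on_subset[OF B])
       (use that in \<open>auto simp: max_def split: if_splits\<close>)
  obtain M where M: "\<And>N z. N \<ge> M \<Longrightarrow> N > 0 \<Longrightarrow> norm z = r \<Longrightarrow> \<bar>rot_mean N \<phi> z - circle_mean r \<phi>\<bar> \<le> e/2"
    using rot_mean_close[OF cont[OF nz(1)] r(1), of "e/2"] \<open>e > 0\<close> by auto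
  have "R > 0" using r by simp
  obtain M' where M': "\<And>N z. N \<ge> M' \<Longrightarrow> N > 0 \<Longrightarrow> norm z = R \<Longrightarrow> \<bar>rot_mean N \<phi> z - circle_mean R \<phi>\<bar> \<le> e/2"
    using rot_mean_close[OF cont[OF nz(2)] \<open>R > 0\<close>, of "e/2"] \<open>e > 0\<close> by auto
  define N where "N = Suc (max M M')"
  have N: "N \<ge> M" "N \<ge> M'" "N > 0" by (auto simp: N_def)
  define w where "w k = cis (2 * pi * real k / N)" for k
  have prod: "(\<Prod>k<N. max (norm (A (z * w k))) (norm (B (z * w k)))) = exp (N * rot_mean N \<phi> z)"
    if "\<And>y. norm y = norm z \<Longrightarrow> A y \<noteq> 0 \<or> B y \<noteq> 0" for z
  proof -
    have "max (norm (A (z * w k))) (norm (B (z * w k))) = exp (\<phi> (z * w k))" for k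
      unfolding \<phi>_def using that[of "z * w k"] by (subst exp_ln) (auto simp: w_def norm_mult max_def)
    then show ?thesis using N by (simp add: rot_mean_def w_def exp_sum)
  qed
  have zr: "norm (complex_of_real r) = r" using r by simp
  have "exp (N * rot_mean N \<phi> (of_real r)) \<le> exp (N * (circle_mean R \<phi> + e/2))"
  proof -
    have "(\<Prod>k<N. max (norm (A (of_real r * w k))) (norm (B (of_real r * w k)))) \<le> exp (N * (circle_mean R \<phi> + e/2))"
    proof (rule rot_prod_max_principle[OF A B r(2) zr])
      fix y assume y: "norm (y::complex) = R"
      have "rot_mean N \<phi> y \<le> circle_mean R \<phi> + e/2" using M'[OF N(2,3) y] by linarith
      then show "(\<Prod>k<N. max (norm (A (y * w k))) (norm (B (y * w k)))) \<le> exp (N * (circle_mean R \<phi> + e/2))"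
        by (subst prod) (use y nz in \<open>auto intro!: mult_left_mono\<close>)
    qed
    then show ?thesis by (subst (asm) prod) (use zr nz in auto)
  qed
  then have "rot_mean N \<phi> (of_real r) \<le> circle_mean R \<phi> + e/2" using N by simp
  with M[OF N(1,3) zr] have "circle_mean r \<phi> \<le> circle_mean R \<phi> + e" by linarith
  then show "log_max_mean r A B \<le> log_max_mean R A B + e"
    by (simp add: log_max_mean_def \<phi>_def[abs_def])
qed

section \<open>The lemma on the logarithmic derivative\<close>

text \<open>
  A consequence of the Poisson formula for the derivative. With \<open>K \<zeta> = \<zeta> / (\<zeta> - z)\<^sup>2\<close>, Cauchy's formula says
  that \<open>L * K\<close> has mean \<open>L' z\<close> over the circle, while \<open>cnj L * K\<close> has mean \<open>0\<close>, since on the circle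
  its conjugate agrees with a function that is holomorphic in the disc and vanishes at \<open>0\<close>. Adding
  the two leaves only the real part of \<open>L\<close>.
\<close>

lemma norm_deriv_le_circle_mean_Re:
  assumes L: "L holomorphic_on ball 0 R'" and R: "0 < R" "R < R'" and z: "norm z < R"
  shows "norm (deriv L z) \<le> 2 * R / (R - norm z)\<^sup>2 * circle_mean R (\<lambda>\<zeta>. \<bar>Re (L \<zeta>)\<bar>)"
proof -
  define e where "e \<theta> = of_real R * cis \<theta>" for \<theta>
  define K where "K \<zeta> = \<zeta> / (\<zeta> - z)\<^sup>2" for \<zeta>
  have ne: "norm (e \<theta>) = R" for \<theta> using R by (simp add: e_def norm_mult)
  have "cball (0::complex) R \<subseteq> ball 0 R'" using R by auto
  have "((\<lambda>u. L u / (u - z) ^ Suc 1) has_contour_integral ((2 * pi * \<i>) / fact 1 * (deriv ^^ 1) L z)) (circlepath 0 R)"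
    by (rule Cauchy_has_contour_integral_higher_derivative_circlepath)
       (use z \<open>cball (0::complex) R \<subseteq> ball 0 R'\<close> ball_subset_cball in
         \<open>auto intro!: holomorphic_on_imp_continuous_on holomorphic_on_subset[OF L]\<close>)
  then have "((\<lambda>\<theta>. L (e \<theta>) / (e \<theta> - z)\<^sup>2 * R * \<i> * cis \<theta>) has_integral (2 * pi * \<i> * deriv L z)) {0..2*pi}"
    unfolding circlepath_def by (subst (asm) has_contour_integral_part_circlepath_iff) (auto simp: e_def power2_eq_square)
  from has_integral_mult_right[OF this, of "-\<i>"]
  have 1: "((\<lambda>\<theta>. L (e \<theta>) * K (e \<theta>)) has_integral (2 * pi * deriv L z)) {0..2*pi}"
    by (simp add: K_def e_def mult_ac)
  \<comment> \<open>Obtained from \<open>L * cnj K\<close> by substituting \<open>cnj \<zeta> = R\<^sup>2 / \<zeta>\<close>, valid on the circle.\<close>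
  define G where "G \<zeta> = L \<zeta> * of_real (R\<^sup>2) * \<zeta> / (of_real (R\<^sup>2) - cnj z * \<zeta>)\<^sup>2" for \<zeta>
  define R2 where "R2 = (if z = 0 then R' else min R' (R\<^sup>2 / norm z))"
  have R2: "R < R2" "R2 \<le> R'" using R z by (auto simp: R2_def field_simps power2_eq_square)
  have den: "of_real (R\<^sup>2) - cnj z * \<zeta> \<noteq> 0" if "norm \<zeta> < R2" for \<zeta>
  proof
    assume "of_real (R\<^sup>2) - cnj z * \<zeta> = 0"
    then have "norm (cnj z * \<zeta>) = norm (of_real (R\<^sup>2) :: complex)" by simp
    then have "norm z * norm \<zeta> = R\<^sup>2" by (simp only: norm_mult norm_of_real complex_mod_cnj) simp
    with that R show False by (auto simp: R2_def field_simps split: if_splits)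
  qed
  have "((\<lambda>\<theta>. G (e \<theta>)) has_integral (2 * pi * G 0)) {0..2*pi}"
    unfolding e_def
  proof (rule circle_integral_mean_value[OF _ R(1) R2(1)])
    show "G holomorphic_on ball 0 R2"
      unfolding G_def
      by (intro holomorphic_intros holomorphic_on_subset[OF L]) (use den R2 in auto)
  qed
  then have "((\<lambda>\<theta>. G (e \<theta>)) has_integral 0) {0..2*pi}" by (simp add: G_def)
  from has_integral_linear[OF this bounded_linear_cnj]
  have "((\<lambda>\<theta>. cnj (G (e \<theta>))) has_integral 0) {0..2*pi}"
    by (simp add: o_def)
  moreover have "cnj (G (e \<theta>)) = cnj (L (e \<theta>)) * K (e \<theta>)" for \<theta>
  proof -
    have *: "of_real (R\<^sup>2) = e \<theta> * cnj (e \<theta>)"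
      using complex_norm_square[of "e \<theta>"] ne[of \<theta>] by simp
    have nz: "e \<theta> \<noteq> 0" "e \<theta> \<noteq> z" using ne[of \<theta>] R z by auto
    have "e \<theta> * cnj (e \<theta>) - cnj z * e \<theta> = e \<theta> * (cnj (e \<theta>) - cnj z)"
      by (simp add: algebra_simps)
    then have "G (e \<theta>) = L (e \<theta>) * (e \<theta> * cnj (e \<theta>)) * e \<theta> / ((e \<theta>)\<^sup>2 * (cnj (e \<theta>) - cnj z)\<^sup>2)"
      by (simp only: G_def * power_mult_distrib)
    also have "L (e \<theta>) * (e \<theta> * cnj (e \<theta>)) * e \<theta> = (e \<theta>)\<^sup>2 * (L (e \<theta>) * cnj (e \<theta>))"
      by (simp add: power2_eq_square mult_ac)
    finally have "G (e \<theta>) = L (e \<theta>) * cnj (e \<theta>) / (cnj (e \<theta>) - cnj z)\<^sup>2"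
      using nz by simp
    then show ?thesis by (simp add: K_def)
  qed
  ultimately have 2: "((\<lambda>\<theta>. cnj (L (e \<theta>)) * K (e \<theta>)) has_integral 0) {0..2*pi}" by simp
  have sum: "((\<lambda>\<theta>. of_real (2 * Re (L (e \<theta>))) * K (e \<theta>)) has_integral (2 * pi * deriv L z)) {0..2*pi}"
    using has_integral_add[OF 1 2] by (simp add: complex_add_cnj flip: distrib_right)
  have contRe: "continuous_on (sphere 0 R) (\<lambda>\<zeta>. \<bar>Re (L \<zeta>)\<bar>)"
    by (intro continuous_intros holomorphic_on_imp_continuous_on holomorphic_on_subset[OF L]) (use R in auto)
  have "norm (2 * pi * deriv L z) \<le> integral {0..2*pi} (\<lambda>\<theta>. 2 * R / (R - norm z)\<^sup>2 * \<bar>Re (L (e \<theta>))\<bar>)"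
    unfolding integral_unique[OF sum, symmetric]
  proof (rule integral_norm_bound_integral)
    show "(\<lambda>\<theta>. of_real (2 * Re (L (e \<theta>))) * K (e \<theta>)) integrable_on {0..2*pi}" using sum by blast
    show "(\<lambda>\<theta>. 2 * R / (R - norm z)\<^sup>2 * \<bar>Re (L (e \<theta>))\<bar>) integrable_on {0..2*pi}"
      unfolding e_def
      by (rule circle_integrable[where \<phi> = "\<lambda>\<zeta>. 2 * R / (R - norm z)\<^sup>2 * \<bar>Re (L \<zeta>)\<bar>",
            OF continuous_on_mult_left[OF contRe] R(1)])
    fix \<theta>
    have "R - norm z \<le> norm (e \<theta> - z)" using ne[of \<theta>] by (metis norm_triangle_ineq2)
    then have "norm (K (e \<theta>)) \<le> R / (R - norm z)\<^sup>2"
      using z R unfolding K_def norm_divide norm_power ne by (intro divide_left_mono power_mono mult_pos_pos zero_less_power) auto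
    then have "2 * \<bar>Re (L (e \<theta>))\<bar> * norm (K (e \<theta>)) \<le> 2 * \<bar>Re (L (e \<theta>))\<bar> * (R / (R - norm z)\<^sup>2)"
      by (intro mult_left_mono) auto
    then show "norm (of_real (2 * Re (L (e \<theta>))) * K (e \<theta>)) \<le> 2 * R / (R - norm z)\<^sup>2 * \<bar>Re (L (e \<theta>))\<bar>"
      by (simp add: norm_mult abs_mult mult_ac)
  qed
  also have "\<dots> = 2 * pi * (2 * R / (R - norm z)\<^sup>2 * circle_mean R (\<lambda>\<zeta>. \<bar>Re (L \<zeta>)\<bar>))"
    unfolding circle_mean_def e_def by simp
  also have "norm (2 * pi * deriv L z) = 2 * pi * norm (deriv L z)" by (simp add: norm_mult)
  finally show ?thesis by (rule mult_left_le_imp_le) simp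
qed

text \<open>
  The values of \<open>1 - c * z\<close> lie in the right half plane, so those of \<open>1 / csqrt (1 - c * z)\<close> lie in the
  sector of half opening \<open>pi / 4\<close>, where the modulus is at most \<open>sqrt 2\<close> times the real part. The
  real part has mean \<open>1\<close> by the mean value property.
\<close>

lemma circle_mean_inverse_sqrt_one_minus:
  assumes c: "norm c * r < 1" and r: "r > 0"
  shows "circle_mean r (\<lambda>z. 1 / sqrt (norm (1 - c * z))) \<le> sqrt 2"
proof -
  define R where "R = (if c = 0 then r + 1 else 1 / norm c)"
  have R: "r < R" using c r by (auto simp: R_def field_simps)
  have pos: "Re (1 - c * z) > 0" if "norm z < R" for z
  proof -
    have "norm c * norm z < 1" using that by (auto simp: R_def field_simps split: if_splits)
    then show ?thesis using complex_Re_le_cmod[of "c * z"] by (simp add: norm_mult del: complex_Re_le_cmod)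
  qed
  have np: "1 - c * z \<notin> \<real>\<^sub>\<le>\<^sub>0" "1 - c * z \<noteq> 0" if "norm z < R" for z
    using pos[OF that] complex_nonpos_Reals_iff[of "1 - c * z"]
    by (auto simp del: minus_complex.sel times_complex.sel)
  define S where "S z = 1 / csqrt (1 - c * z)" for z
  have hol: "S holomorphic_on ball 0 R"
    unfolding S_def
    by (intro holomorphic_intros) (use np in auto)
  have "((\<lambda>\<theta>. Re (S (of_real r * cis \<theta>))) has_integral (Re (2 * pi * S 0))) {0..2*pi}"
    by (intro has_integral_Re circle_integral_mean_value[OF hol]) (use r R in auto)
  then have mean: "circle_mean r (\<lambda>z. Re (S z)) = 1"
    by (simp add: circle_mean_def integral_unique S_def)
  have cont: "continuous_on (sphere 0 r) S"
    by (intro holomorphic_on_imp_continuous_on holomorphic_on_subset[OF hol]) (use R in auto)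
  have le: "1 / sqrt (norm (1 - c * z)) \<le> sqrt 2 * Re (S z)" if z: "norm z = r" for z
  proof -
    define w where "w = csqrt (1 - c * z)"
    have w2: "w ^ 2 = 1 - c * z" by (simp add: w_def)
    have "Re (w ^ 2) > 0" using pos[of z] z R w2 by simp
    then have "(Im w)\<^sup>2 < (Re w)\<^sup>2" by (simp add: power2_eq_square)
    moreover have "(norm w)\<^sup>2 = (Re w)\<^sup>2 + (Im w)\<^sup>2" by (rule cmod_power2)
    ultimately have "(norm w)\<^sup>2 \<le> 2 * (Re w)\<^sup>2" "w \<noteq> 0" by auto
    moreover have "Re w \<ge> 0" unfolding w_def by (rule Re_csqrt)
    ultimately have *: "norm w \<le> sqrt 2 * Re w"
      by (metis real_le_rsqrt real_sqrt_mult real_sqrt_unique)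
    have "norm (1 - c * z) = (norm w)\<^sup>2" by (metis norm_power w2)
    then have "1 / sqrt (norm (1 - c * z)) = 1 / norm w" by simp
    also have "\<dots> = norm w / (norm w)\<^sup>2" using \<open>w \<noteq> 0\<close> by (simp add: power2_eq_square)
    also have "\<dots> \<le> (sqrt 2 * Re w) / (norm w)\<^sup>2" using * by (intro divide_right_mono) auto
    also have "\<dots> = sqrt 2 * Re (S z)"
      unfolding S_def w_def[symmetric] by (simp add: Re_divide cmod_power2)
    finally show ?thesis .
  qed
  have "circle_mean r (\<lambda>z. 1 / sqrt (norm (1 - c * z))) \<le> circle_mean r (\<lambda>z. sqrt 2 * Re (S z))"
  proof (rule circle_mean_mono)
    have "1 - c * z \<noteq> 0" if "norm z = r" for z using pos[of z] R that by force
    then show "continuous_on (sphere 0 r) (\<lambda>z. 1 / sqrt (norm (1 - c * z)))"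
      by (intro continuous_intros) auto
  qed (use cont le r in \<open>auto intro!: continuous_intros\<close>)
  then show ?thesis by (simp add: circle_mean_cmult mean)
qed

text \<open>
  The square root makes the singularity \<open>1 / (z - a)\<close> integrable uniformly in \<open>a\<close>, even when \<open>a\<close> is
  very close to the circle.
\<close>

lemma circle_mean_inverse_sqrt_dist:
  assumes r: "r > 0" and a: "norm a \<noteq> r"
  shows "circle_mean r (\<lambda>z. 1 / sqrt (norm (z - a))) \<le> sqrt 2 / sqrt r"
proof (cases "norm a < r")
  case True
  define c where "c = cnj a / of_real (r\<^sup>2)"
  have eq: "1 / sqrt (norm (z - a)) = (1 / sqrt r) * (1 / sqrt (norm (1 - c * z)))" if z: "norm z = r" for z
  proof -
    have "of_real (r\<^sup>2) = z * cnj z" using complex_norm_square[of z] z by simp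
    then have "cnj (z - a) * z = of_real (r\<^sup>2) * (1 - c * z)"
      using r by (simp add: c_def algebra_simps)
    then have "norm (cnj (z - a) * z) = norm (of_real (r\<^sup>2) * (1 - c * z))" by simp
    then have "norm (z - a) * r = r\<^sup>2 * norm (1 - c * z)"
      using r by (simp only: norm_mult complex_mod_cnj norm_of_real z abs_power2)
    then have "norm (z - a) = r * norm (1 - c * z)" using r by (simp add: power2_eq_square)
    then show ?thesis by (simp add: real_sqrt_mult)
  qed
  have "circle_mean r (\<lambda>z. 1 / sqrt (norm (z - a))) = (1 / sqrt r) * circle_mean r (\<lambda>z. 1 / sqrt (norm (1 - c * z)))"
    unfolding circle_mean_cmult[symmetric] by (rule circle_mean_cong) (use eq r in auto)
  also have "\<dots> \<le> (1 / sqrt r) * sqrt 2"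
    by (intro mult_left_mono circle_mean_inverse_sqrt_one_minus)
       (use r True in \<open>auto simp: c_def norm_divide norm_mult power2_eq_square field_simps\<close>)
  finally show ?thesis by simp
next
  case False
  then have a: "norm a > r" using a by simp
  then have "a \<noteq> 0" "norm a > 0" using r by auto
  have eq: "1 / sqrt (norm (z - a)) = (1 / sqrt (norm a)) * (1 / sqrt (norm (1 - (1/a) * z)))" for z
  proof -
    have "z - a = - a * (1 - (1/a) * z)" using \<open>a \<noteq> 0\<close> by (simp add: field_simps)
    then have "norm (z - a) = norm a * norm (1 - (1/a) * z)" by (metis norm_minus_cancel norm_mult)
    then show ?thesis by (simp add: real_sqrt_mult)
  qed
  have "circle_mean r (\<lambda>z. 1 / sqrt (norm (z - a))) = (1 / sqrt (norm a)) * circle_mean r (\<lambda>z. 1 / sqrt (norm (1 - (1/a) * z)))"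
    unfolding circle_mean_cmult[symmetric] by (rule circle_mean_cong) (use eq r in auto)
  also have "\<dots> \<le> (1 / sqrt (norm a)) * sqrt 2"
    by (intro mult_left_mono circle_mean_inverse_sqrt_one_minus)
       (use r a \<open>a \<noteq> 0\<close> in \<open>auto simp: norm_divide\<close>)
  also have "\<dots> \<le> (1 / sqrt r) * sqrt 2"
    using a r \<open>norm a > 0\<close> by (intro mult_right_mono divide_left_mono mult_pos_pos) auto
  finally show ?thesis by simp
qed

text \<open>
  Jensen's inequality for the logarithm, obtained from its tangent at the mean value.
\<close>

lemma circle_mean_ln_concave:
  assumes cont: "continuous_on (sphere 0 r) h" and r: "r > 0" and pos: "\<And>z. norm z = r \<Longrightarrow> h z \<ge> 0"
  shows "circle_mean r (\<lambda>z. ln (1 + h z)) \<le> ln (1 + circle_mean r h)"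
proof -
  define m where "m = circle_mean r h"
  have m: "m \<ge> 0" unfolding m_def by (rule circle_mean_ge_const[OF cont r]) (use pos in auto)
  have "circle_mean r (\<lambda>z. ln (1 + h z)) \<le> circle_mean r (\<lambda>z. (ln (1 + m) - m / (1 + m)) + (1 / (1 + m)) * h z)"
  proof (rule circle_mean_mono)
    show "continuous_on (sphere 0 r) (\<lambda>z. ln (1 + h z))"
      by (intro continuous_intros cont) (use pos in force)
    fix z assume z: "norm (z::complex) = r"
    have "ln ((1 + h z) / (1 + m)) \<le> (1 + h z) / (1 + m) - 1"
      by (rule ln_le_minus_one) (use m pos[OF z] in auto)
    moreover have "ln ((1 + h z) / (1 + m)) = ln (1 + h z) - ln (1 + m)"
      using m pos[OF z] by (subst ln_div) auto
    moreover have "(1 + h z) / (1 + m) - 1 = (1 / (1 + m)) * h z - m / (1 + m)"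
      using m by (simp add: divide_simps)
    ultimately show "ln (1 + h z) \<le> (ln (1 + m) - m / (1 + m)) + (1 / (1 + m)) * h z" by linarith
  qed (intro continuous_intros cont r)+
  also have "\<dots> = ln (1 + m) - m / (1 + m) + (1 / (1 + m)) * m"
  proof -
    have "circle_mean r (\<lambda>z. (ln (1 + m) - m / (1 + m)) + (1 / (1 + m)) * h z)
      = circle_mean r (\<lambda>z. ln (1 + m) - m / (1 + m)) + circle_mean r (\<lambda>z. (1 / (1 + m)) * h z)"
      by (rule circle_mean_add) (intro continuous_intros cont r)+
    then show ?thesis by (simp only: circle_mean_const circle_mean_cmult m_def)
  qed
  also have "\<dots> = ln (1 + m)" by simp
  finally show ?thesis by (simp add: m_def)
qed

text \<open>
  In this form \<open>log_plus\<close> is visibly continuous at \<open>0\<close>.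
\<close>

lemma log_plus_eq_ln_max: "x \<ge> 0 \<Longrightarrow> log_plus x = ln (max 1 x)"
  by (cases "x = 0") (auto simp: log_plus_def max_def)

lemma continuous_on_log_plus_norm:
  fixes f :: "complex \<Rightarrow> complex"
  assumes "continuous_on S f"
  shows "continuous_on S (\<lambda>z. log_plus (norm (f z)))"
proof -
  have "continuous_on S (\<lambda>z. ln (max 1 (norm (f z))))"
    by (intro continuous_intros assms) (auto simp: max_def)
  then show ?thesis by (simp add: log_plus_eq_ln_max)
qed

lemma log_plus_le_ln_sqrt:
  assumes "x \<ge> 0"
  shows "log_plus x \<le> 2 * ln (1 + sqrt x)"
proof (cases "x = 0")
  case False
  then have "x > 0" using assms by simp
  have "ln x = 2 * ln (sqrt x)" using \<open>x > 0\<close> by (simp add: ln_sqrt)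
  also have "\<dots> \<le> 2 * ln (1 + sqrt x)"
    using \<open>x > 0\<close> by (intro mult_left_mono ln_mono) (auto simp: add_pos_pos)
  finally show ?thesis using assms by (simp add: log_plus_def)
qed (simp add: log_plus_def)

lemma has_field_derivative_prod_log:
  fixes \<nu> :: "'i \<Rightarrow> nat" and p l :: "'i \<Rightarrow> complex \<Rightarrow> complex"
  assumes "finite I" "\<And>i. i \<in> I \<Longrightarrow> (p i has_field_derivative (p i z * l i z)) (at z)"
  shows "((\<lambda>w. \<Prod>i\<in>I. p i w ^ \<nu> i) has_field_derivative
    ((\<Prod>i\<in>I. p i z ^ \<nu> i) * (\<Sum>i\<in>I. of_nat (\<nu> i) * l i z))) (at z)"
  using assms
proof (induction I)
  case (insert i I)
  have pow: "((\<lambda>w. p i w ^ \<nu> i) has_field_derivative (p i z ^ \<nu> i * (of_nat (\<nu> i) * l i z))) (at z)"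
  proof (cases "\<nu> i")
    case (Suc k)
    have "((\<lambda>w. p i w ^ \<nu> i) has_field_derivative (of_nat (\<nu> i) * (p i z * l i z * p i z ^ (\<nu> i - Suc 0)))) (at z)"
      by (rule DERIV_power) (use insert.prems in auto)
    then show ?thesis unfolding Suc by (simp add: algebra_simps)
  qed simp
  show ?case
    using DERIV_mult[OF pow insert.IH] insert.prems insert.hyps
    by (simp add: algebra_simps)
qed simp

lemma has_field_derivative_mult_log:
  fixes q P :: "complex \<Rightarrow> complex"
  assumes "(q has_field_derivative q') (at z)" "(P has_field_derivative P z * s) (at z)" "q z \<noteq> 0"
  shows "((\<lambda>z. q z * P z) has_field_derivative q z * P z * (q' / q z + s)) (at z)"
  using DERIV_mult[OF assms(1,2)] assms(3) by (simp add: algebra_simps)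

text \<open>
  Exchanging each factor \<open>z - b\<close> for the factor of \<open>norm_Blaschke_denominator\<close> removes the zeros from
  the disc without changing \<open>\<bar>h\<bar>\<close> on its boundary. The price is a controlled change of the
  logarithmic derivative.
\<close>

lemma zero_free_replacement:
  assumes h: "h holomorphic_on UNIV" "h w \<noteq> 0" and R: "R > 0" and nz: "\<And>z. norm z = R \<Longrightarrow> h z \<noteq> 0"
  obtains k R' where "R < R'" "k holomorphic_on ball 0 R'" "\<forall>z\<in>ball 0 R'. k z \<noteq> 0"
    "\<forall>z. norm z = R \<longrightarrow> norm (k z) = norm (h z)"
    "\<forall>z. norm z < R \<longrightarrow> h z \<noteq> 0 \<longrightarrow> norm (deriv h z / h z - deriv k z / k z) \<le>
       (\<Sum>b | norm b \<le> R \<and> h b = 0. real (nat (zorder h b)) * (1 / norm (z - b) + 1 / (R - norm z)))"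
proof -
  define Z where "Z = {b. norm b \<le> R \<and> h b = 0}"
  define \<nu> where "\<nu> b = nat (zorder h b)" for b
  have "finite Z" using finite_zeros_disc[OF h] by (auto simp: Z_def)
  have Z: "norm b < R" if "b \<in> Z" for b using that nz[of b] by (force simp: Z_def)
  obtain q R1 where q0: "R < R1" "q holomorphic_on ball 0 R1" "\<forall>z\<in>ball 0 R1. q z \<noteq> 0"
    "\<forall>z\<in>ball 0 R1. h z = q z * (\<Prod>b\<in>Z. (z - b) ^ \<nu> b)"
    by (rule zero_factorization[OF h R, folded Z_def \<nu>_def])
  note q = q0(1,2) q0(3)[rule_format, unfolded mem_ball_0] q0(4)[rule_format, unfolded mem_ball_0]
  \<comment> \<open>The new factors vanish only outside the disc of radius \<open>R\<^sup>2 / \<beta>\<close>; the entry \<open>R/2\<close> keeps \<open>\<beta>\<close> positive.\<close>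
  define \<beta> where "\<beta> = Max (insert (R/2) (norm ` Z))"
  have \<beta>: "R/2 \<le> \<beta>" "\<beta> < R" "\<And>b. b \<in> Z \<Longrightarrow> norm b \<le> \<beta>"
  proof -
    show "R/2 \<le> \<beta>" unfolding \<beta>_def by (rule Max_ge) (use \<open>finite Z\<close> in auto)
    show "norm b \<le> \<beta>" if "b \<in> Z" for b
      unfolding \<beta>_def by (rule Max_ge) (use \<open>finite Z\<close> that in auto)
    show "\<beta> < R" unfolding \<beta>_def using \<open>finite Z\<close> R Z by auto
  qed
  define R' where "R' = min R1 (R\<^sup>2 / \<beta>)"
  have R': "R < R'" "R' \<le> R1" using \<beta> R q(1) by (auto simp: R'_def field_simps power2_eq_square)
  define p where "p b z = of_real R - cnj b * z / of_real R" for b z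
  have p_nz: "p b z \<noteq> 0" if "norm z < R'" "b \<in> Z" for b z
  proof
    assume "p b z = 0"
    then have "cnj b * z = of_real (R * R)" using R by (auto simp: p_def field_simps)
    then have "norm (cnj b * z) = norm (of_real (R * R) :: complex)" by simp
    then have "norm b * norm z = R * R" using R by (simp add: norm_mult)
    moreover have "norm b * norm z \<le> \<beta> * norm z" using \<beta>(3)[OF that(2)] by (intro mult_right_mono) auto
    moreover have "\<beta> * norm z < R * R" using that(1) \<beta> R by (auto simp: R'_def field_simps power2_eq_square)
    ultimately show False by linarith
  qed
  have norm_p: "norm (p b z) = norm (z - b)" if "norm z = R" for b z
    unfolding p_def by (rule norm_Blaschke_denominator[OF R that])
  define k where "k z = q z * (\<Prod>b\<in>Z. p b z ^ \<nu> b)" for z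
  have hol_k: "k holomorphic_on ball 0 R'"
    unfolding k_def p_def
    by (intro holomorphic_intros holomorphic_on_subset[OF q(2)]) (use R R' in auto)
  have nz_k: "k z \<noteq> 0" if "norm z < R'" for z
    using q(3)[of z] p_nz[OF that] \<open>finite Z\<close> R' that by (auto simp: k_def)
  have circ: "norm (k z) = norm (h z)" if "norm z = R" for z
    using q(4)[of z] q(1) that norm_p[OF that] by (simp add: k_def norm_mult norm_power flip: prod_norm)
  have diff: "norm (deriv h z / h z - deriv k z / k z) \<le> (\<Sum>b\<in>Z. real (\<nu> b) * (1 / norm (z - b) + 1 / (R - norm z)))"
    if z: "norm z < R" "h z \<noteq> 0" for z
  proof -
    have zR1: "norm z < R1" and zR': "norm z < R'" using z q(1) R' by auto
    have ne: "z \<noteq> b" if "b \<in> Z" for b using that z(2) by (auto simp: Z_def)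
    have dq: "(q has_field_derivative deriv q z) (at z)"
      by (rule holomorphic_derivI[OF q(2)]) (use zR1 in auto)
    have "((\<lambda>z. \<Prod>b\<in>Z. (z - b) ^ \<nu> b) has_field_derivative (\<Prod>b\<in>Z. (z - b) ^ \<nu> b) * (\<Sum>b\<in>Z. \<nu> b * (1 / (z - b)))) (at z)"
      using ne by (intro has_field_derivative_prod_log \<open>finite Z\<close>) (auto intro!: derivative_eq_intros)
    from has_field_derivative_mult_log[OF dq this q(3)[OF zR1]]
    have "((\<lambda>z. q z * (\<Prod>b\<in>Z. (z - b) ^ \<nu> b)) has_field_derivative
       h z * (deriv q z / q z + (\<Sum>b\<in>Z. \<nu> b * (1 / (z - b))))) (at z)"
      using q(4)[OF zR1] by simp
    then have "(h has_field_derivative h z * (deriv q z / q z + (\<Sum>b\<in>Z. \<nu> b * (1 / (z - b))))) (at z)"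
      by (rule has_field_derivative_transform_within_open[where S = "ball 0 R1"]) (use zR1 q(4) in auto)
    then have dh: "deriv h z / h z = deriv q z / q z + (\<Sum>b\<in>Z. \<nu> b * (1 / (z - b)))"
      using z(2) by (simp add: DERIV_imp_deriv)
    have "((\<lambda>z. \<Prod>b\<in>Z. p b z ^ \<nu> b) has_field_derivative (\<Prod>b\<in>Z. p b z ^ \<nu> b) * (\<Sum>b\<in>Z. \<nu> b * (- cnj b / R / p b z))) (at z)"
      by (intro has_field_derivative_prod_log[where l = "\<lambda>b z. - cnj b / R / p b z"] \<open>finite Z\<close>)
         (use p_nz[OF zR'] R in \<open>auto simp: p_def intro!: derivative_eq_intros\<close>)
    from has_field_derivative_mult_log[OF dq this q(3)[OF zR1]]
    have "(k has_field_derivative k z * (deriv q z / q z + (\<Sum>b\<in>Z. \<nu> b * (- cnj b / R / p b z)))) (at z)"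
      unfolding k_def[abs_def] .
    then have dk: "deriv k z / k z = deriv q z / q z + (\<Sum>b\<in>Z. \<nu> b * (- cnj b / R / p b z))"
      using nz_k[OF zR'] by (simp add: DERIV_imp_deriv)
    have "deriv h z / h z - deriv k z / k z = (\<Sum>b\<in>Z. \<nu> b * (1 / (z - b) + cnj b / R / p b z))"
      unfolding dh dk by (simp add: sum_subtractf[symmetric] algebra_simps)
    also have "norm \<dots> \<le> (\<Sum>b\<in>Z. norm (\<nu> b * (1 / (z - b) + cnj b / R / p b z)))"
      by (rule norm_sum)
    also have "\<dots> \<le> (\<Sum>b\<in>Z. real (\<nu> b) * (1 / norm (z - b) + 1 / (R - norm z)))"
    proof (rule sum_mono)
      fix b assume b: "b \<in> Z"
      have "norm (cnj b * z / of_real R) \<le> norm z"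
        using Z[OF b] R by (auto simp: norm_mult norm_divide field_simps intro!: mult_right_mono)
      moreover have "norm (of_real R :: complex) - norm (cnj b * z / of_real R) \<le> norm (p b z)"
        unfolding p_def by (rule norm_triangle_ineq2)
      ultimately have "R - norm z \<le> norm (p b z)" using R by simp
      moreover have "norm (cnj b / R) \<le> 1" using Z[OF b] R by (simp add: norm_divide)
      ultimately have "norm (cnj b / R / p b z) \<le> 1 / (R - norm z)"
        using z unfolding norm_divide[of "cnj b / R"] by (intro frac_le) auto
      moreover have "norm (1 / (z - b)) = 1 / norm (z - b)" by (simp add: norm_divide)
      ultimately have "norm (1 / (z - b) + cnj b / R / p b z) \<le> 1 / norm (z - b) + 1 / (R - norm z)"
        using norm_triangle_ineq[of "1 / (z - b)" "cnj b / R / p b z"] by linarith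
      then show "norm (\<nu> b * (1 / (z - b) + cnj b / R / p b z)) \<le> real (\<nu> b) * (1 / norm (z - b) + 1 / (R - norm z))"
        unfolding norm_mult by (intro mult_mono) auto
    qed
    finally show ?thesis .
  qed
  show thesis
    by (rule that[of R' k]) (use R' hol_k nz_k circ diff in \<open>auto simp: Z_def \<nu>_def\<close>)
qed

lemma sqrt_add_le: "0 \<le> x \<Longrightarrow> 0 \<le> y \<Longrightarrow> sqrt (x + y) \<le> sqrt x + sqrt y"
  by (rule real_le_lsqrt) (auto simp: power2_sum)

lemma sqrt_sum_le:
  assumes "\<And>i. i \<in> I \<Longrightarrow> f i \<ge> 0"
  shows "sqrt (\<Sum>i\<in>I. f i) \<le> (\<Sum>i\<in>I. sqrt (f i))"
  using assms
proof (induction I rule: infinite_finite_induct)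
  case (insert i I)
  then have "sqrt (f i + sum f I) \<le> sqrt (f i) + sqrt (sum f I)"
    by (intro sqrt_add_le sum_nonneg) auto
  with insert show ?case by force
qed auto

lemma norm_diff_le_chain:
  fixes x y a b :: "'a::real_normed_vector"
  shows "norm (x - y) \<le> norm (x - a) + norm (a - b) + norm (y - b)"
  using norm_triangle_ineq[of "x - a" "a - y"] norm_triangle_ineq[of "a - b" "b - y"]
  by (simp add: norm_minus_commute)

definition zero_count :: "real \<Rightarrow> (complex \<Rightarrow> complex) \<Rightarrow> real" where
  "zero_count R h = (\<Sum>b | norm b \<le> R \<and> h b = 0. real (nat (zorder h b)))"

text \<open>
  The square root of the sum is taken term by term, where it is subadditive; this is what makes the
  bound proportional to the number of zeros and independent of their position.
\<close>

lemma circle_mean_sqrt_zero_sum: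
  assumes h: "h holomorphic_on UNIV" "h w \<noteq> 0" and r: "0 < r" "r < R" and nz: "\<And>z. norm z = r \<Longrightarrow> h z \<noteq> 0"
  defines "s \<equiv> \<lambda>z. \<Sum>b | norm b \<le> R \<and> h b = 0. real (nat (zorder h b)) * (1 / norm (z - b) + 1 / (R - r))"
  shows "circle_mean r (\<lambda>z. sqrt (s z)) \<le> zero_count R h * (sqrt 2 / sqrt r + 1 / sqrt (R - r))"
    "continuous_on (sphere 0 r) s"
proof -
  define Z where "Z = {b. norm b \<le> R \<and> h b = 0}"
  define \<nu> where "\<nu> b = nat (zorder h b)" for b
  have "finite Z" using finite_zeros_disc[OF h] by (auto simp: Z_def)
  have ne: "norm b \<noteq> r" if "b \<in> Z" for b using that nz[of b] by (auto simp: Z_def)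
  have s_eq: "s z = (\<Sum>b\<in>Z. real (\<nu> b) * (1 / norm (z - b) + 1 / (R - r)))" for z
    by (simp add: s_def Z_def \<nu>_def)
  show cont: "continuous_on (sphere 0 r) s"
    unfolding s_eq[abs_def] by (intro continuous_intros) (use ne in force)
  have cont1: "continuous_on (sphere 0 r) (\<lambda>z. 1 / sqrt (norm (z - b)))" if "b \<in> Z" for b
    by (intro continuous_intros) (use ne that in force)
  have "sqrt (s z) \<le> (\<Sum>b\<in>Z. real (\<nu> b) * (1 / sqrt (norm (z - b)) + 1 / sqrt (R - r)))" if "norm z = r" for z
  proof -
    have "sqrt (s z) \<le> (\<Sum>b\<in>Z. sqrt (real (\<nu> b) * (1 / norm (z - b) + 1 / (R - r))))"
      unfolding s_eq by (rule sqrt_sum_le) (use r in auto)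
    also have "\<dots> \<le> (\<Sum>b\<in>Z. real (\<nu> b) * (1 / sqrt (norm (z - b)) + 1 / sqrt (R - r)))"
    proof (rule sum_mono)
      fix b
      have "sqrt (real (\<nu> b)) \<le> real (\<nu> b)"
        by (cases "\<nu> b") (auto intro!: real_le_lsqrt simp: power2_eq_square)
      moreover have "sqrt (1 / norm (z - b) + 1 / (R - r)) \<le> sqrt (1 / norm (z - b)) + sqrt (1 / (R - r))"
        by (rule sqrt_add_le) (use r in auto)
      ultimately show "sqrt (real (\<nu> b) * (1 / norm (z - b) + 1 / (R - r))) \<le> real (\<nu> b) * (1 / sqrt (norm (z - b)) + 1 / sqrt (R - r))"
        unfolding real_sqrt_mult using r by (intro mult_mono) (auto simp: real_sqrt_divide)
    qed
    finally show ?thesis .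
  qed
  then have "circle_mean r (\<lambda>z. sqrt (s z)) \<le> circle_mean r (\<lambda>z. \<Sum>b\<in>Z. real (\<nu> b) * (1 / sqrt (norm (z - b)) + 1 / sqrt (R - r)))"
    by (intro circle_mean_mono r(1) continuous_on_real_sqrt cont continuous_on_sum continuous_on_mult
        continuous_on_add continuous_on_const cont1)
  also have "\<dots> = (\<Sum>b\<in>Z. circle_mean r (\<lambda>z. real (\<nu> b) * (1 / sqrt (norm (z - b)) + 1 / sqrt (R - r))))"
    by (rule circle_mean_sum[OF \<open>finite Z\<close> _ r(1)]) (intro continuous_intros cont1)
  also have "\<dots> = (\<Sum>b\<in>Z. real (\<nu> b) * (circle_mean r (\<lambda>z. 1 / sqrt (norm (z - b))) + 1 / sqrt (R - r)))"
    unfolding circle_mean_cmult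
    by (intro sum.cong refl arg_cong2[where f = "(*)"], subst circle_mean_add) (auto intro!: cont1 r continuous_intros)
  also have "\<dots> \<le> (\<Sum>b\<in>Z. real (\<nu> b) * (sqrt 2 / sqrt r + 1 / sqrt (R - r)))"
    by (intro sum_mono mult_left_mono add_right_mono circle_mean_inverse_sqrt_dist) (use r ne in auto)
  finally show "circle_mean r (\<lambda>z. sqrt (s z)) \<le> zero_count R h * (sqrt 2 / sqrt r + 1 / sqrt (R - r))"
    by (simp add: sum_distrib_right zero_count_def Z_def \<nu>_def)
qed

text \<open>
  The lemma on the logarithmic derivative for \<open>X / Y\<close>, before any choice of \<open>R\<close>. After removal of
  the zeros, \<open>X / Y\<close> is an exponential \<open>exp L\<close>, and \<open>L'\<close> is bounded by the boundary values of
  \<open>ln \<bar>X\<bar> - ln \<bar>Y\<bar>\<close>. The remaining terms are reciprocal distances to zeros, which are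
  integrable after taking square roots. Concavity of the logarithm then moves the mean inside.
\<close>

lemma log_derivative_lemma:
  assumes X: "X holomorphic_on UNIV" and Y: "Y holomorphic_on UNIV" and r: "0 < r" "r < R"
    and nzr: "\<And>z. norm z = r \<Longrightarrow> X z \<noteq> 0" "\<And>z. norm z = r \<Longrightarrow> Y z \<noteq> 0"
    and nzR: "\<And>z. norm z = R \<Longrightarrow> X z \<noteq> 0" "\<And>z. norm z = R \<Longrightarrow> Y z \<noteq> 0"
  shows "circle_mean r (\<lambda>z. log_plus (norm (deriv X z / X z - deriv Y z / Y z))) \<le>
    2 * ln (1 + (sqrt (2 * R / (R - r)\<^sup>2 * circle_mean R (\<lambda>z. \<bar>ln (norm (X z)) - ln (norm (Y z))\<bar>))
      + (zero_count R X + zero_count R Y) * (sqrt 2 / sqrt r + 1 / sqrt (R - r))))"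
proof -
  have R: "R > 0" using r by simp
  have "X (of_real r) \<noteq> 0" "Y (of_real r) \<noteq> 0" using nzr r by auto
  note X' = X this(1) and Y' = Y this(2)
  define sX where "sX z = (\<Sum>b | norm b \<le> R \<and> X b = 0. real (nat (zorder X b)) * (1 / norm (z - b) + 1 / (R - r)))" for z
  define sY where "sY z = (\<Sum>b | norm b \<le> R \<and> Y b = 0. real (nat (zorder Y b)) * (1 / norm (z - b) + 1 / (R - r)))" for z
  define T where "T = 2 * R / (R - r)\<^sup>2 * circle_mean R (\<lambda>z. \<bar>ln (norm (X z)) - ln (norm (Y z))\<bar>)"
  obtain k1 R1 where k1: "R < R1" "k1 holomorphic_on ball 0 R1" "\<forall>z\<in>ball 0 R1. k1 z \<noteq> 0"
    "\<forall>z. norm z = R \<longrightarrow> norm (k1 z) = norm (X z)"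
    "\<forall>z. norm z < R \<longrightarrow> X z \<noteq> 0 \<longrightarrow> norm (deriv X z / X z - deriv k1 z / k1 z) \<le>
       (\<Sum>b | norm b \<le> R \<and> X b = 0. real (nat (zorder X b)) * (1 / norm (z - b) + 1 / (R - norm z)))"
    by (rule zero_free_replacement[OF X' R nzR(1)])
  obtain k2 R2 where k2: "R < R2" "k2 holomorphic_on ball 0 R2" "\<forall>z\<in>ball 0 R2. k2 z \<noteq> 0"
    "\<forall>z. norm z = R \<longrightarrow> norm (k2 z) = norm (Y z)"
    "\<forall>z. norm z < R \<longrightarrow> Y z \<noteq> 0 \<longrightarrow> norm (deriv Y z / Y z - deriv k2 z / k2 z) \<le>
       (\<Sum>b | norm b \<le> R \<and> Y b = 0. real (nat (zorder Y b)) * (1 / norm (z - b) + 1 / (R - norm z)))"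
    by (rule zero_free_replacement[OF Y' R nzR(2)])
  define R' where "R' = min R1 R2"
  have R': "R < R'" "R' \<le> R1" "R' \<le> R2" using k1(1) k2(1) by (auto simp: R'_def)
  have h1: "k1 holomorphic_on ball 0 R'" "k2 holomorphic_on ball 0 R'"
    using k1(2) k2(2) R' by (auto elim!: holomorphic_on_subset)
  have n1: "k1 z \<noteq> 0" "k2 z \<noteq> 0" if "z \<in> ball 0 R'" for z
    using that k1(3) k2(3) R' by auto
  obtain L where L: "L holomorphic_on ball 0 R'" "\<And>z. z \<in> ball 0 R' \<Longrightarrow> exp (L z) = k1 z / k2 z"
  proof (rule holomorphic_logarithm_exists[where A = "ball 0 R'" and f = "\<lambda>z. k1 z / k2 z" and ?z0.0 = 0])
    show "(\<lambda>z. k1 z / k2 z) holomorphic_on ball 0 R'"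
      using n1 h1 by (intro holomorphic_intros) auto
  qed (use R' R n1 in auto)
  have bound: "norm (deriv X z / X z - deriv Y z / Y z) \<le> T + (sX z + sY z)" if z: "norm z = r" for z
  proof -
    have zb: "z \<in> ball 0 R'" using z r R' by auto
    have dL: "deriv L z = deriv k1 z / k1 z - deriv k2 z / k2 z"
    proof -
      have "((\<lambda>z. exp (L z)) has_field_derivative exp (L z) * deriv L z) (at z)"
        by (rule DERIV_fun_exp) (use holomorphic_derivI[OF L(1) open_ball zb] in auto)
      moreover have "((\<lambda>z. k1 z / k2 z) has_field_derivative
          (deriv k1 z * k2 z - k1 z * deriv k2 z) / (k2 z * k2 z)) (at z)"
        by (rule DERIV_divide[OF holomorphic_derivI[OF h1(1) open_ball zb] holomorphic_derivI[OF h1(2) open_ball zb] n1(2)[OF zb]])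
      then have "((\<lambda>z. exp (L z)) has_field_derivative
          (deriv k1 z * k2 z - k1 z * deriv k2 z) / (k2 z * k2 z)) (at z)"
        by (rule has_field_derivative_transform_within_open[where S = "ball 0 R'"]) (use zb L(2) in auto)
      ultimately have "exp (L z) * deriv L z = (deriv k1 z * k2 z - k1 z * deriv k2 z) / (k2 z * k2 z)"
        by (rule DERIV_unique)
      then show ?thesis using L(2)[OF zb] n1[OF zb] by (simp add: field_simps)
    qed
    have "norm (deriv L z) \<le> 2 * R / (R - norm z)\<^sup>2 * circle_mean R (\<lambda>\<zeta>. \<bar>Re (L \<zeta>)\<bar>)"
      by (rule norm_deriv_le_circle_mean_Re[OF L(1) R R'(1)]) (use z r in auto)
    also have "circle_mean R (\<lambda>\<zeta>. \<bar>Re (L \<zeta>)\<bar>) = circle_mean R (\<lambda>z. \<bar>ln (norm (X z)) - ln (norm (Y z))\<bar>)"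
    proof (rule circle_mean_cong[OF _ R])
      fix \<zeta> :: complex assume \<zeta>: "norm \<zeta> = R"
      then have \<zeta>b: "\<zeta> \<in> ball 0 R'" using R' by auto
      have "Re (L \<zeta>) = ln (norm (exp (L \<zeta>)))" by (simp add: norm_exp_eq_Re)
      also have "\<dots> = ln (norm (X \<zeta>)) - ln (norm (Y \<zeta>))"
        unfolding L(2)[OF \<zeta>b] norm_divide using n1[OF \<zeta>b] k1(4) k2(4) \<zeta> nzR by (subst ln_div) auto
      finally show "\<bar>Re (L \<zeta>)\<bar> = \<bar>ln (norm (X \<zeta>)) - ln (norm (Y \<zeta>))\<bar>" by simp
    qed
    finally have "norm (deriv k1 z / k1 z - deriv k2 z / k2 z) \<le> T" using z by (simp add: T_def dL)
    moreover have "norm (deriv X z / X z - deriv k1 z / k1 z) \<le> sX z"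
      using k1(5) nzr(1)[OF z] z r by (auto simp: sX_def)
    moreover have "norm (deriv Y z / Y z - deriv k2 z / k2 z) \<le> sY z"
      using k2(5) nzr(2)[OF z] z r by (auto simp: sY_def)
    moreover have "norm (deriv X z / X z - deriv Y z / Y z) \<le>
        norm (deriv X z / X z - deriv k1 z / k1 z) + norm (deriv k1 z / k1 z - deriv k2 z / k2 z)
        + norm (deriv Y z / Y z - deriv k2 z / k2 z)"
      by (rule norm_diff_le_chain)
    ultimately show ?thesis by linarith
  qed
  have cs: "continuous_on (sphere 0 r) sX" "continuous_on (sphere 0 r) sY"
    using circle_mean_sqrt_zero_sum(2)[OF X' r nzr(1)] circle_mean_sqrt_zero_sum(2)[OF Y' r nzr(2)]
    by (simp_all add: sX_def[abs_def] sY_def[abs_def])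
  have pos: "sX z \<ge> 0" "sY z \<ge> 0" for z
    using r by (auto simp: sX_def sY_def intro!: sum_nonneg)
  have lnXY: "continuous_on (sphere 0 R) (\<lambda>z. ln (norm (X z)))" "continuous_on (sphere 0 R) (\<lambda>z. ln (norm (Y z)))"
    using continuous_on_ln_norm_entire[OF X nzR(1)] continuous_on_ln_norm_entire[OF Y nzR(2)] by auto
  have "circle_mean R (\<lambda>z. \<bar>ln (norm (X z)) - ln (norm (Y z))\<bar>) \<ge> 0"
    by (rule circle_mean_ge_const[OF _ R]) (auto intro!: continuous_intros lnXY)
  then have "T \<ge> 0" using r unfolding T_def by auto
  define H where "H z = sqrt T + (sqrt (sX z) + sqrt (sY z))" for z
  have cH: "continuous_on (sphere 0 r) H" unfolding H_def by (intro continuous_intros cs)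
  have H0: "H z \<ge> 0" for z using pos \<open>T \<ge> 0\<close> by (simp add: H_def)
  have "circle_mean r (\<lambda>z. log_plus (norm (deriv X z / X z - deriv Y z / Y z))) \<le> circle_mean r (\<lambda>z. 2 * ln (1 + H z))"
  proof (rule circle_mean_mono[OF _ _ r(1)])
    have c: "continuous_on (sphere 0 r) (\<lambda>z. deriv X z / X z - deriv Y z / Y z)"
      using nzr
      by (intro continuous_intros holomorphic_on_imp_continuous_on holomorphic_deriv[OF X, THEN holomorphic_on_subset]
        holomorphic_deriv[OF Y, THEN holomorphic_on_subset] holomorphic_on_subset[OF X] holomorphic_on_subset[OF Y]) auto
    show "continuous_on (sphere 0 r) (\<lambda>z. log_plus (norm (deriv X z / X z - deriv Y z / Y z)))"
      by (rule continuous_on_log_plus_norm[OF c])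
    show "continuous_on (sphere 0 r) (\<lambda>z. 2 * ln (1 + H z))"
      by (intro continuous_intros cH) (use H0 in \<open>smt (verit)\<close>)
    fix z :: complex assume z: "norm z = r"
    have "log_plus (norm (deriv X z / X z - deriv Y z / Y z)) \<le> 2 * ln (1 + sqrt (norm (deriv X z / X z - deriv Y z / Y z)))"
      by (rule log_plus_le_ln_sqrt) simp
    also have "\<dots> \<le> 2 * ln (1 + H z)"
    proof -
      have "sqrt (norm (deriv X z / X z - deriv Y z / Y z)) \<le> sqrt (T + (sX z + sY z))"
        using bound[OF z] by simp
      also have "\<dots> \<le> H z" unfolding H_def
        using sqrt_add_le[OF \<open>T \<ge> 0\<close> add_nonneg_nonneg[OF pos], of z z] sqrt_add_le[OF pos, of z z] by linarith
      finally show ?thesis by (intro mult_left_mono ln_mono) (auto simp: add_pos_nonneg)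
    qed
    finally show "log_plus (norm (deriv X z / X z - deriv Y z / Y z)) \<le> 2 * ln (1 + H z)" .
  qed
  also have "\<dots> \<le> 2 * ln (1 + circle_mean r H)"
    unfolding circle_mean_cmult using circle_mean_ln_concave[OF cH r(1) H0] by simp
  also have "circle_mean r H = sqrt T + (circle_mean r (\<lambda>z. sqrt (sX z)) + circle_mean r (\<lambda>z. sqrt (sY z)))"
    unfolding H_def by (simp add: circle_mean_add r cs continuous_intros)
  also have "2 * ln (1 + \<dots>) \<le> 2 * ln (1 + (sqrt T + (zero_count R X + zero_count R Y) * (sqrt 2 / sqrt r + 1 / sqrt (R - r))))"
  proof (intro mult_left_mono ln_mono add_left_mono)
    show "circle_mean r (\<lambda>z. sqrt (sX z)) + circle_mean r (\<lambda>z. sqrt (sY z)) \<le>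
       (zero_count R X + zero_count R Y) * (sqrt 2 / sqrt r + 1 / sqrt (R - r))"
      using circle_mean_sqrt_zero_sum(1)[OF X' r nzr(1)] circle_mean_sqrt_zero_sum(1)[OF Y' r nzr(2)]
      unfolding sX_def sY_def distrib_right by linarith
    have "0 \<le> circle_mean r (\<lambda>z. sqrt (sX z))" "0 \<le> circle_mean r (\<lambda>z. sqrt (sY z))"
      by (rule circle_mean_ge_const; use cs pos r in \<open>auto intro!: continuous_intros\<close>)+
    then show "0 < 1 + (sqrt T + (circle_mean r (\<lambda>z. sqrt (sX z)) + circle_mean r (\<lambda>z. sqrt (sY z))))"
      using \<open>T \<ge> 0\<close> by (simp add: add_pos_nonneg)
  qed simp
  finally show ?thesis by (simp add: T_def)
qed

section \<open>Exceptional radii and growth\<close>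

lemma countable_zero_radii:
  assumes "h holomorphic_on UNIV" "h w \<noteq> 0"
  shows "countable (norm ` {z. h z = 0})"
proof -
  have "{z. h z = 0} = (\<Union>n::nat. {z. norm z \<le> n \<and> h z = 0})"
    using real_arch_simple by auto
  also have "countable \<dots>"
    using finite_zeros_disc[OF assms] by (auto intro: countable_finite)
  finally show ?thesis by (rule countable_image)
qed

lemma exists_radius_avoiding_countable:
  fixes C :: "real set"
  assumes "countable C" "a < b"
  obtains r where "a < r" "r < b" "r \<notin> C"
proof -
  have "\<not> {a<..<b} \<subseteq> C"
    using assms uncountable_open_interval countable_subset by blast
  then obtain r where "r \<in> {a<..<b}" "r \<notin> C" by blast
  then show ?thesis using that by auto
qed

text \<open>
  A dyadic version of Borel's growth lemma. If \<open>\<Phi>\<close> doubles within a distance \<open>1 / \<Phi> r\<close> of \<open>r\<close>, and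
  \<open>\<Phi> r\<close> lies between \<open>2^k\<close> and \<open>2^Suc k\<close>, then \<open>\<Phi>\<close> has left this range after that distance.
  So the bad radii of level \<open>k\<close> have diameter at most \<open>2^(-k)\<close>. The set \<open>X\<close> consists
  of admissible radii.
\<close>

lemma Borel_growth:
  fixes \<Phi> :: "real \<Rightarrow> real" and X :: "real set"
  assumes mono: "\<And>r s. r \<in> X \<Longrightarrow> s \<in> X \<Longrightarrow> r \<le> s \<Longrightarrow> \<Phi> r \<le> \<Phi> s"
    and ge1: "\<And>r. r \<in> X \<Longrightarrow> 1 \<le> \<Phi> r"
  obtains E where "E \<in> sets lebesgue" "emeasure lebesgue E < \<infinity>"
    "\<And>r s. r \<in> X - E \<Longrightarrow> s \<in> X \<Longrightarrow> r < s \<Longrightarrow> s \<le> r + 1 / \<Phi> r \<Longrightarrow> \<Phi> s \<le> 2 * \<Phi> r"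
proof -
  \<comment> \<open>The bad radii, and below their dyadic levels.\<close>
  define B where "B = {r \<in> X. \<exists>s\<in>X. r < s \<and> s \<le> r + 1 / \<Phi> r \<and> \<Phi> s > 2 * \<Phi> r}"
  define L where "L k = {r \<in> B. 2 ^ k \<le> \<Phi> r \<and> \<Phi> r < 2 ^ Suc k}" for k :: nat
  have close: "r' - r \<le> (1/2) ^ k" if rr': "r \<in> L k" "r' \<in> L k" for r r' k
  proof (rule ccontr)
    assume far: "\<not> r' - r \<le> (1/2) ^ k"
    obtain s where s: "s \<in> X" "r < s" "s \<le> r + 1 / \<Phi> r" "\<Phi> s > 2 * \<Phi> r"
      using rr'(1) by (auto simp: L_def B_def)
    have "1 / \<Phi> r \<le> 1 / 2 ^ k"
      using rr'(1) ge1[of r] by (intro divide_left_mono mult_pos_pos) (auto simp: L_def B_def)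
    then have "s \<le> r'" using far s(3) by (simp add: power_one_over)
    then have "\<Phi> s \<le> \<Phi> r'" using rr'(2) s(1) by (intro mono) (auto simp: L_def B_def)
    then show False using s(4) that by (auto simp: L_def)
  qed
  define I where "I k = (if L k = {} then {} else {(SOME r. r \<in> L k) - (1/2)^k .. (SOME r. r \<in> L k) + (1/2)^k})" for k
  have LI: "L k \<subseteq> I k" for k
  proof
    fix r assume r: "r \<in> L k"
    then have "(SOME r. r \<in> L k) \<in> L k" by (rule someI)
    from close[OF r this] close[OF this r] r show "r \<in> I k" by (auto simp: I_def)
  qed
  define E where "E = (\<Union>k. I k)"
  have I_sets: "range I \<subseteq> sets lebesgue" by (auto simp: I_def)
  have I_meas: "emeasure lebesgue (I k) \<le> ennreal (2 * (1/2)^k)" for k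
    by (auto simp: I_def simp flip: ennreal_plus)
  have "emeasure lebesgue E \<le> (\<Sum>k. emeasure lebesgue (I k))"
    unfolding E_def by (rule emeasure_subadditive_countably[OF I_sets])
  also have "\<dots> \<le> (\<Sum>k. ennreal (2 * (1/2)^k))"
    by (intro suminf_le I_meas) auto
  also have "\<dots> = ennreal (\<Sum>k. 2 * (1/2)^k)"
    by (intro suminf_ennreal2 summable_mult summable_geometric) auto
  also have "\<dots> < \<infinity>" by simp
  finally have "emeasure lebesgue E < \<infinity>" .
  moreover have "E \<in> sets lebesgue" unfolding E_def using I_sets by auto
  moreover have "\<Phi> s \<le> 2 * \<Phi> r" if "r \<in> X - E" "s \<in> X" "r < s" "s \<le> r + 1 / \<Phi> r" for r s
  proof (rule ccontr)
    assume "\<not> \<Phi> s \<le> 2 * \<Phi> r"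
    then have "r \<in> B" using that by (auto simp: B_def)
    obtain n where n: "\<Phi> r < 2 ^ n" using real_arch_pow[of 2 "\<Phi> r"] by auto
    define N where "N = (LEAST n. \<Phi> r < 2 ^ n)"
    have N: "\<Phi> r < 2 ^ N" unfolding N_def by (rule LeastI[of _ n]) (rule n)
    moreover have "1 \<le> \<Phi> r" using ge1 that(1) by auto
    ultimately obtain k where k: "N = Suc k" by (cases N) auto
    have "\<not> \<Phi> r < 2 ^ k" using not_less_Least[of k "\<lambda>n. \<Phi> r < 2 ^ n"] k by (simp add: N_def)
    then have "r \<in> L k" using N \<open>r \<in> B\<close> by (auto simp: L_def k)
    then show False using LI that(1) by (auto simp: E_def)
  qed
  ultimately show thesis by (intro that)
qed

lemma proximity_altdef: "proximity r f = circle_mean r (\<lambda>z. log_plus (norm (f z)))"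
  by (simp add: proximity_def circle_mean_def)

text \<open>
  Great Picard theorem at infinity. If \<open>g\<close> or \<open>1 / g\<close> had a limit there, \<open>g\<close> would be a polynomial.
\<close>

lemma transcendental_takes_value_infinitely_often:
  assumes "transcendental_entire g"
  obtains c where "infinite {z. g z = c}"
proof -
  have g: "g holomorphic_on UNIV" and np: "\<not> (\<exists>p. g = poly p)"
    using assms by (auto simp: transcendental_entire_def)
  have poly: False if lim: "((inverse \<circ> g) \<longlongrightarrow> l) at_infinity" for l
  proof -
    obtain a n where "\<And>z. g z = (\<Sum>i\<le>n. a i * z ^ i)" using pole_at_infinity[OF g lim] by blast
    then have "g = poly (\<Sum>i\<le>n. monom (a i) i)" by (auto simp: poly_sum poly_monom)
    with np show False by blast
  qed
  have 1: "\<not> ((g \<circ> inverse) \<longlongrightarrow> l) (at 0)" for l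
  proof
    assume "((g \<circ> inverse) \<longlongrightarrow> l) (at 0)"
    then have lim: "(g \<longlongrightarrow> l) at_infinity" by (simp add: lim_at_infinity_0)
    have "g = poly [:l:]" using Liouville_weak[OF g lim] by auto
    with np show False by blast
  qed
  have 2: "\<not> ((inverse \<circ> (g \<circ> inverse)) \<longlongrightarrow> l) (at 0)" for l
    using poly[of l] lim_at_infinity_0[of "inverse \<circ> g" l] by (auto simp: o_assoc)
  have hol: "(g \<circ> inverse) holomorphic_on (UNIV - {0})"
    by (intro holomorphic_on_compose_gen[OF _ g] holomorphic_intros) auto
  obtain a where a: "\<And>w. w \<noteq> a \<Longrightarrow> infinite {x. x \<in> UNIV - {0} \<and> (g \<circ> inverse) x = w}"
    using great_Picard_infinite[OF open_UNIV UNIV_I hol 1 2] by blast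
  have "infinite {x. x \<in> UNIV - {0} \<and> (g \<circ> inverse) x = a + 1}" by (rule a) simp
  then have "infinite (inverse ` {x. x \<in> UNIV - {0} \<and> (g \<circ> inverse) x = a + 1})"
    by (subst finite_image_iff) (auto intro: inj_onI)
  then have "infinite {z. g z = a + 1}"
    by (rule infinite_super[rotated]) auto
  then show thesis by (rule that)
qed

text \<open>
  If \<open>X = g - c\<close> has infinitely many zeros, then any \<open>d\<close> of them contribute \<open>d * ln R\<close> up to a
  constant to the mean of \<open>ln \<bar>X\<bar>\<close>, and this mean exceeds the proximity function of \<open>g\<close> by a
  constant at most. The function \<open>X\<close> is part of the conclusion because the estimate holds on the
  circles that avoid its zeros.
\<close>

lemma transcendental_proximity_growth:
  assumes "transcendental_entire g"
  obtains X w where "X holomorphic_on UNIV" "X w \<noteq> 0"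
    "\<And>K. \<exists>r1. \<forall>R\<ge>r1. (\<forall>z::complex. norm z = R \<longrightarrow> X z \<noteq> 0) \<longrightarrow> K * ln R \<le> proximity R g"
proof -
  have g: "g holomorphic_on UNIV" and np: "\<not> (\<exists>p. g = poly p)"
    using assms by (auto simp: transcendental_entire_def)
  obtain c where c: "infinite {z. g z = c}" by (rule transcendental_takes_value_infinitely_often[OF assms])
  define X where "X z = g z - c" for z
  have X: "X holomorphic_on UNIV" unfolding X_def by (intro holomorphic_intros g)
  obtain w where w: "X w \<noteq> 0"
    using np by (metis X_def ext right_minus_eq poly_pCons poly_0 add.right_neutral mult_zero_right)
  obtain r0 where r0: "0 < r0" "r0 < 1" "r0 \<notin> norm ` {z. X z = 0}"
    using exists_radius_avoiding_countable[OF countable_zero_radii[OF X w], of 0 1] by auto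
  have "\<exists>r1. \<forall>R\<ge>r1. (\<forall>z::complex. norm z = R \<longrightarrow> X z \<noteq> 0) \<longrightarrow> K * ln R \<le> proximity R g" for K
  proof -
    obtain Z where Z: "finite Z" "card Z = nat \<lceil>K + 1\<rceil>" "Z \<subseteq> {z. g z = c}"
      using infinite_arbitrarily_large[OF c] by blast
    define C where "C = (\<Sum>b\<in>Z. ln (max r0 (norm b))) - log_mean r0 X + log_plus (norm c) + ln 2"
    define r1 where "r1 = Max (insert (max 1 (exp C)) (norm ` Z))"
    have r1: "max 1 (exp C) \<le> r1" "\<And>z. z \<in> Z \<Longrightarrow> norm z \<le> r1"
      unfolding r1_def by (rule Max_ge; use Z(1) in auto)+
    have "K * ln R \<le> proximity R g" if R: "R \<ge> r1" "\<forall>z::complex. norm z = R \<longrightarrow> X z \<noteq> 0" for R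
    proof -
      have R1: "R \<ge> 1" "exp C \<le> R" using r1(1) R by auto
      have lnR: "ln R \<ge> 0" "ln R \<ge> C" using R1 by (auto simp: ln_ge_iff)
      have "log_mean r0 X + card Z * ln R - (\<Sum>b\<in>Z. ln (max r0 (norm b))) \<le> log_mean R X"
      proof (rule log_mean_many_zeros[OF X w Z(1)])
        show "norm z \<le> R" if "z \<in> Z" for z using r1(2)[OF that] R by simp
      qed (use Z r0 R R1 in \<open>auto simp: X_def\<close>)
      also have "log_mean R X \<le> circle_mean R (\<lambda>z. log_plus (norm (g z)) + (log_plus (norm c) + ln 2))"
        unfolding log_mean_def
      proof (rule circle_mean_mono)
        show "continuous_on (sphere 0 R) (\<lambda>z. ln (norm (X z)))"
          by (rule continuous_on_ln_norm_entire[OF X]) (use R in auto)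
        show "continuous_on (sphere 0 R) (\<lambda>z. log_plus (norm (g z)) + (log_plus (norm c) + ln 2))"
          by (intro continuous_intros continuous_on_log_plus_norm holomorphic_on_imp_continuous_on holomorphic_on_subset[OF g]) auto
        fix z :: complex assume z: "norm z = R"
        have "norm (X z) \<le> norm (g z) + norm c" unfolding X_def by (rule norm_triangle_ineq4)
        also have "\<dots> \<le> max 1 (norm (g z)) * max 1 (norm c) + max 1 (norm (g z)) * max 1 (norm c)"
          using mult_mono[of "norm (g z)" "max 1 (norm (g z))" 1 "max 1 (norm c)"]
            mult_mono[of 1 "max 1 (norm (g z))" "norm c" "max 1 (norm c)"] by (intro add_mono) auto
        finally have "ln (norm (X z)) \<le> ln (2 * (max 1 (norm (g z)) * max 1 (norm c)))"
          using R z by (intro ln_mono) (auto simp: mult_ac)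
        also have "\<dots> = ln 2 + (ln (max 1 (norm (g z))) + ln (max 1 (norm c)))"
          by (subst ln_mult_pos; (subst ln_mult_pos)?) (auto intro!: mult_pos_pos simp: max_def)
        finally show "ln (norm (X z)) \<le> log_plus (norm (g z)) + (log_plus (norm c) + ln 2)"
          by (simp add: log_plus_eq_ln_max)
      qed (use R1 in auto)
      also have "\<dots> = proximity R g + (log_plus (norm c) + ln 2)"
        unfolding proximity_altdef
        by (subst circle_mean_add) (use R1 in \<open>auto intro!: continuous_on_log_plus_norm holomorphic_on_imp_continuous_on holomorphic_on_subset[OF g]\<close>)
      finally have "card Z * ln R - C \<le> proximity R g" by (simp add: C_def)
      moreover have "(K + 1) * ln R \<le> card Z * ln R"
        using lnR Z(2) by (intro mult_right_mono) linarith+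
      ultimately show ?thesis using lnR by (simp add: algebra_simps)
    qed
    then show ?thesis by blast
  qed
  then show thesis by (rule that[OF X w])
qed

section \<open>Meromorphic functions as quotients of entire functions\<close>

text \<open>
  Both sides are sums over the poles, by Jensen's formula and by integrating the step function that
  counts them. A pole \<open>b \<noteq> 0\<close> contributes \<open>ln R - ln (max r0 \<bar>b\<bar>)\<close> times its order on the left and
  \<open>ln R - ln \<bar>b\<bar>\<close> times its order on the right. The pole at \<open>0\<close> is covered by \<open>r0 \<ge> 1\<close>.
\<close>

lemma log_mean_le_pole_counting:
  assumes v: "v holomorphic_on UNIV" "v w \<noteq> 0"
    and pole: "\<And>z. is_pole a z \<longleftrightarrow> v z = 0" "\<And>z. v z = 0 \<Longrightarrow> zorder v z = - zorder a z"
    and r: "1 \<le> r0" "r0 \<le> R" and nz: "\<And>z. norm z = r0 \<Longrightarrow> v z \<noteq> 0" "\<And>z. norm z = R \<Longrightarrow> v z \<noteq> 0"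
  shows "log_mean R v - log_mean r0 v \<le> pole_counting R a"
proof -
  define Z where "Z = {b. norm b \<le> R \<and> v b = 0}"
  define \<nu> where "\<nu> b = nat (zorder v b)" for b
  define Z' where "Z' = Z - {0}"
  have "finite Z" "finite Z'" using finite_zeros_disc[OF v] by (auto simp: Z_def Z'_def)
  have count: "real (pole_count t a) = (\<Sum>b\<in>Z. if norm b \<le> t then real (\<nu> b) else 0)" if "t \<le> R" for t
  proof -
    have "pole_count t a = (\<Sum>b | norm b \<le> t \<and> v b = 0. \<nu> b)"
      unfolding pole_count_def pole \<nu>_def by (rule sum.cong) (use pole(2) in auto)
    also have "\<dots> = (\<Sum>b\<in>{b\<in>Z. norm b \<le> t}. \<nu> b)"
      by (rule sum.cong) (use that in \<open>auto simp: Z_def\<close>)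
    also have "\<dots> = (\<Sum>b\<in>Z. if norm b \<le> t then \<nu> b else 0)"
      by (rule sum.inter_filter) fact
    finally show ?thesis by (simp add: if_distrib cong: if_cong)
  qed
  have count0: "real (pole_count 0 a) = (if 0 \<in> Z then real (\<nu> 0) else 0)"
    using count[of 0] r \<open>finite Z\<close> by (simp add: sum.delta)
  have split: "(\<Sum>b\<in>Z. f b) = (\<Sum>b\<in>Z'. f b) + (if 0 \<in> Z then f 0 else 0)" for f :: "complex \<Rightarrow> real"
    using \<open>finite Z\<close> by (auto simp: Z'_def sum.remove)
  have "((\<lambda>t. if t \<in> {norm b..R} then \<nu> b / t else 0) has_integral (\<nu> b * (ln R - ln (norm b)))) {0..R}" if "b \<in> Z'" for b
  proof -
    have b: "0 < norm b" "norm b \<le> R" using that by (auto simp: Z'_def Z_def)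
    have "((\<lambda>t. \<nu> b / t) has_integral (\<nu> b * ln R - \<nu> b * ln (norm b))) {norm b..R}"
    proof (rule fundamental_theorem_of_calculus[OF b(2)])
      fix t assume "t \<in> {norm b..R}"
      then have "((\<lambda>t. \<nu> b * ln t) has_field_derivative \<nu> b / t) (at t within {norm b..R})"
        using less_le_trans[OF b(1), of t] by (auto intro!: derivative_eq_intros)
      then show "((\<lambda>t. \<nu> b * ln t) has_vector_derivative \<nu> b / t) (at t within {norm b..R})"
        by (simp add: has_real_derivative_iff_has_vector_derivative)
    qed
    moreover have "{norm b..R} \<subseteq> {0..R}" using b by auto
    ultimately show ?thesis
      using has_integral_restrict[of "{norm b..R}" "{0..R}" "\<lambda>t. \<nu> b / t"] by (simp add: right_diff_distrib)
  qed
  then have "((\<lambda>t. \<Sum>b\<in>Z'. if t \<in> {norm b..R} then \<nu> b / t else 0) has_integral (\<Sum>b\<in>Z'. \<nu> b * (ln R - ln (norm b)))) {0..R}"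
    by (intro has_integral_sum \<open>finite Z'\<close>) auto
  then have "((\<lambda>t. (real (pole_count t a) - real (pole_count 0 a)) / t) has_integral (\<Sum>b\<in>Z'. \<nu> b * (ln R - ln (norm b)))) {0..R}"
  proof (rule has_integral_eq[rotated])
    fix t assume t: "t \<in> {0..R}"
    have "real (pole_count t a) - real (pole_count 0 a) = (\<Sum>b\<in>Z'. if norm b \<le> t then real (\<nu> b) else 0)"
      using count[of t] count0 t by (simp add: split)
    then show "(\<Sum>b\<in>Z'. if t \<in> {norm b..R} then \<nu> b / t else 0) = (real (pole_count t a) - real (pole_count 0 a)) / t"
      using t by (simp add: sum_divide_distrib if_distrib[of "\<lambda>x. x / t"] cong: if_cong)
  qed
  then have N: "pole_counting R a = (\<Sum>b\<in>Z'. \<nu> b * (ln R - ln (norm b))) + (if 0 \<in> Z then \<nu> 0 * ln R else 0)"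
    by (simp add: pole_counting_def integral_unique count0)
  have "log_mean R v - log_mean r0 v = (\<Sum>b\<in>Z. \<nu> b * (ln R - ln (max r0 (norm b))))"
    unfolding Z_def \<nu>_def using Jensen_difference[OF v _ r(2) nz] r by simp
  also have "\<dots> = (\<Sum>b\<in>Z'. \<nu> b * (ln R - ln (max r0 (norm b)))) + (if 0 \<in> Z then \<nu> 0 * (ln R - ln r0) else 0)"
    using r by (simp add: split)
  also have "\<dots> \<le> pole_counting R a"
    unfolding N
  proof (intro add_mono sum_mono mult_left_mono)
    fix b assume "b \<in> Z'"
    then show "ln R - ln (max r0 (norm b)) \<le> ln R - ln (norm b)" using r by (simp add: Z'_def)
  qed (use r in \<open>auto intro!: mult_left_mono\<close>)
  finally show ?thesis .
qed

text \<open>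
  Weierstrass factorization. The quotient describes \<open>a\<close> only outside a sparse set, since the values
  of \<open>a\<close> at its singularities are arbitrary.
\<close>

lemma meromorphic_quotient:
  assumes mero: "a meromorphic_on UNIV" and nz: "\<not> identically_zero a"
  obtains u wu v wv where "u holomorphic_on UNIV" "u wu \<noteq> 0" "v holomorphic_on UNIV" "v wv \<noteq> 0"
    "\<And>z. u z \<noteq> 0 \<or> v z \<noteq> 0" "{z. a z \<noteq> u z / v z} sparse_in UNIV"
    "\<And>z. is_pole a z \<longleftrightarrow> v z = 0" "\<And>z. v z = 0 \<Longrightarrow> zorder v z = - zorder a z"
proof -
  have iso: "isolated_singularity_at a z" for z
    using mero meromorphic_on_isolated_singularity meromorphic_on_subset by blast
  obtain h f1 f2 where
    hol: "h holomorphic_on UNIV" "f1 holomorphic_on UNIV" "f2 holomorphic_on UNIV"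
    and f1: "\<forall>z. f1 z = 0 \<longleftrightarrow> \<not>is_pole (remove_sings a) z \<and> remove_sings a z = 0"
    and f2: "\<forall>z. f2 z = 0 \<longleftrightarrow> is_pole (remove_sings a) z"
    and "\<forall>z. \<not>is_pole (remove_sings a) z \<longrightarrow> zorder f1 z = zorder (remove_sings a) z"
    and ord: "\<forall>z. is_pole (remove_sings a) z \<longrightarrow> zorder f2 z = - zorder (remove_sings a) z"
    and h: "\<forall>z. h z \<noteq> 0" and eq: "\<forall>z. remove_sings a z = h z * f1 z / f2 z"
    using weierstrass_factorization_meromorphic_UNIV[OF remove_sings_nicely_meromorphic[OF mero]] by blast
  have "\<forall>\<^sub>\<approx>z. remove_sings a z = a z" by (rule eventually_remove_sings_eq[OF mero])
  then have ev: "\<forall>\<^sub>\<approx>z. a z = h z * f1 z / f2 z" by eventually_elim (use eq in auto)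
  have "\<exists>z. a z \<noteq> 0 \<and> a z = h z * f1 z / f2 z"
  proof (rule ccontr)
    assume none: "\<not> ?thesis"
    from ev have "\<forall>\<^sub>\<approx>z. a z = 0" by eventually_elim (use none in metis)
    with nz show False by (simp add: identically_zero_def)
  qed
  then obtain z0 where "a z0 \<noteq> 0" "a z0 = h z0 * f1 z0 / f2 z0" by blast
  then have z0: "h z0 * f1 z0 \<noteq> 0" "f2 z0 \<noteq> 0" by auto
  show thesis
  proof (rule that[of "\<lambda>z. h z * f1 z" z0 f2 z0])
    show "{z. a z \<noteq> h z * f1 z / f2 z} sparse_in UNIV"
      using ev by (simp add: eventually_cosparse)
  qed (use z0 hol f1 f2 ord h iso in \<open>auto intro!: holomorphic_intros\<close>)
qed

section \<open>The second main theorem for a small target function\<close>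

lemma continuous_on_ln_max_norm:
  fixes A B :: "complex \<Rightarrow> complex"
  assumes "A holomorphic_on UNIV" "B holomorphic_on UNIV" "\<And>z. norm z = r \<Longrightarrow> A z \<noteq> 0 \<or> B z \<noteq> 0"
  shows "continuous_on (sphere 0 r) (\<lambda>z. ln (max (norm (A z)) (norm (B z))))"
  by (intro continuous_intros holomorphic_on_imp_continuous_on holomorphic_on_subset[OF assms(1)] holomorphic_on_subset[OF assms(2)])
     (use assms(3) in \<open>auto simp: max_def split: if_splits\<close>)

lemma log_mean_le_log_max_mean:
  assumes "A holomorphic_on UNIV" "B holomorphic_on UNIV" "r > 0" "\<And>z. norm z = r \<Longrightarrow> A z \<noteq> 0"
  shows "log_mean r A \<le> log_max_mean r A B"
  unfolding log_mean_def log_max_mean_def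
  by (intro circle_mean_mono continuous_on_ln_norm_entire continuous_on_ln_max_norm ln_mono) (use assms in auto)

lemma log_max_mean_commute: "log_max_mean r A B = log_max_mean r B A"
  by (simp add: log_max_mean_def max.commute)

text \<open>
  Since \<open>\<bar>x - y\<bar> = 2 * max x y - x - y\<close>.
\<close>

lemma log_quotient_mean:
  assumes X: "X holomorphic_on UNIV" and Y: "Y holomorphic_on UNIV" and r: "r > 0"
    and nz: "\<And>z. norm z = r \<Longrightarrow> X z \<noteq> 0" "\<And>z. norm z = r \<Longrightarrow> Y z \<noteq> 0"
  shows "circle_mean r (\<lambda>z. \<bar>ln (norm (X z)) - ln (norm (Y z))\<bar>) = 2 * log_max_mean r X Y - log_mean r X - log_mean r Y"
proof -
  note c = continuous_on_ln_norm_entire[OF X nz(1)] continuous_on_ln_norm_entire[OF Y nz(2)]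
    continuous_on_ln_max_norm[OF X Y, of r]
  have "circle_mean r (\<lambda>z. \<bar>ln (norm (X z)) - ln (norm (Y z))\<bar>)
    = circle_mean r (\<lambda>z. 2 * ln (max (norm (X z)) (norm (Y z))) - ln (norm (X z)) - ln (norm (Y z)))"
  proof (rule circle_mean_cong[OF _ r])
    fix z :: complex assume z: "norm z = r"
    have "norm (X z) > 0" "norm (Y z) > 0" using nz z by auto
    then show "\<bar>ln (norm (X z)) - ln (norm (Y z))\<bar> = 2 * ln (max (norm (X z)) (norm (Y z))) - ln (norm (X z)) - ln (norm (Y z))"
      by (cases "norm (X z) \<le> norm (Y z)") (auto simp: max_def abs_if)
  qed
  also have "\<dots> = circle_mean r (\<lambda>z. 2 * ln (max (norm (X z)) (norm (Y z)))) - log_mean r X - log_mean r Y"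
    unfolding log_mean_def using nz
    by (subst circle_mean_diff, (intro continuous_intros c r; auto)+)+ simp
  finally show ?thesis by (simp add: circle_mean_cmult log_max_mean_def)
qed

text \<open>
  The lemma on the logarithmic derivative with \<open>R\<close> at distance about \<open>1 / \<Phi>\<close> from \<open>r\<close>, where the
  characteristic is still at most of the size of \<open>\<Phi>\<close>. The resulting bound is polynomial in \<open>r\<close> and
  \<open>\<Phi>\<close> inside the logarithm. Two radii \<open>R1 < R2\<close> are needed: one for the boundary values and a
  larger one to bound the number of zeros up to \<open>R1\<close>. The countable set \<open>C\<close> collects the radii of
  circles that carry zeros.
\<close>

lemma log_derivative_growth:
  assumes X: "X holomorphic_on UNIV" and Y: "Y holomorphic_on UNIV"
    and r: "1 \<le> r0" "r0 < r" and \<Phi>: "1 \<le> \<Phi>" and C: "countable C"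
    and nz: "\<And>s z. r0 \<le> s \<Longrightarrow> s \<notin> C \<Longrightarrow> norm z = s \<Longrightarrow> X z \<noteq> 0" "\<And>s z. r0 \<le> s \<Longrightarrow> s \<notin> C \<Longrightarrow> norm z = s \<Longrightarrow> Y z \<noteq> 0"
    and C0: "r0 \<notin> C" "r \<notin> C"
    and growth: "\<And>s. s \<notin> C \<Longrightarrow> r < s \<Longrightarrow> s \<le> r + 1 / \<Phi> \<Longrightarrow> log_max_mean s X Y \<le> 2 * \<Phi> + ln 2"
  defines "c \<equiv> 6 + \<bar>log_mean r0 X\<bar> + \<bar>log_mean r0 Y\<bar>"
  shows "circle_mean r (\<lambda>z. log_plus (norm (deriv X z / X z - deriv Y z / Y z))) \<le>
    2 * ln (97 * c) + 2 * ln r + 6 * ln \<Phi>"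
proof -
  define \<delta> where "\<delta> = 1 / \<Phi>"
  have \<delta>: "0 < \<delta>" "\<delta> \<le> 1" using \<Phi> by (auto simp: \<delta>_def)
  obtain R1 where R1: "r + \<delta>/4 < R1" "R1 < r + \<delta>/2" "R1 \<notin> C"
    by (rule exists_radius_avoiding_countable[OF C, of "r + \<delta>/4" "r + \<delta>/2"]) (use \<delta> in auto)
  obtain R2 where R2: "r + 3*\<delta>/4 < R2" "R2 < r + \<delta>" "R2 \<notin> C"
    by (rule exists_radius_avoiding_countable[OF C, of "r + 3*\<delta>/4" "r + \<delta>"]) (use \<delta> in auto)
  have ord: "r0 < R1" "r < R1" "R1 < R2" "r0 < R2" "0 < r0" "0 < R1" "0 < r" "0 < R2"
    using r R1 R2 \<delta> by auto
  note nzX = nz(1)[of r0] nz(1)[of r] nz(1)[of R1] nz(1)[of R2]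
  note nzY = nz(2)[of r0] nz(2)[of r] nz(2)[of R1] nz(2)[of R2]
  have X0: "X (of_real r) \<noteq> 0" "Y (of_real r) \<noteq> 0" using nzX(2) nzY(2) r C0 by auto
  have ln2: "ln 2 \<le> (1::real)" using ln_le_minus_one[of 2] by simp
  have U1: "log_max_mean R1 X Y \<le> 2 * \<Phi> + ln 2" and U2: "log_max_mean R2 X Y \<le> 2 * \<Phi> + ln 2"
    by (rule growth; use R1 R2 \<delta> \<delta>_def in linarith)+
  have c: "c \<ge> 6" by (simp add: c_def)
  have c\<Phi>: "6 * \<Phi> + (\<bar>log_mean r0 X\<bar> + \<bar>log_mean r0 Y\<bar>) \<le> c * \<Phi>"
    using mult_left_mono[of 1 \<Phi> "\<bar>log_mean r0 X\<bar> + \<bar>log_mean r0 Y\<bar>"] \<Phi> by (simp add: c_def algebra_simps)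
  define D where "D = circle_mean R1 (\<lambda>z. \<bar>ln (norm (X z)) - ln (norm (Y z))\<bar>)"
  have "D = 2 * log_max_mean R1 X Y - log_mean R1 X - log_mean R1 Y"
    unfolding D_def by (rule log_quotient_mean[OF X Y]) (use ord nzX(3) nzY(3) R1 in auto)
  moreover have "log_mean r0 X \<le> log_mean R1 X" "log_mean r0 Y \<le> log_mean R1 Y"
    using log_mean_mono[OF X X0(1), of r0 R1] log_mean_mono[OF Y X0(2), of r0 R1] ord nzX nzY R1 C0 by auto
  ultimately have D: "D \<le> c * \<Phi>" using U1 c\<Phi> ln2 \<Phi> by linarith
  have D0: "D \<ge> 0" unfolding D_def
    by (rule circle_mean_ge_const) (use ord nzX(3) nzY(3) R1 in \<open>auto intro!: continuous_intros continuous_on_ln_norm_entire X Y\<close>)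
  define n where "n = zero_count R1 X + zero_count R1 Y"
  have n0: "n \<ge> 0" by (auto simp: n_def zero_count_def intro!: add_nonneg_nonneg sum_nonneg)
  have "zero_count R1 X * (ln R2 - ln R1) \<le> log_mean R2 X - log_mean r0 X"
    unfolding zero_count_def by (rule zero_count_bound[OF X X0(1)]) (use ord nzX R2 C0 in auto)
  moreover have "zero_count R1 Y * (ln R2 - ln R1) \<le> log_mean R2 Y - log_mean r0 Y"
    unfolding zero_count_def by (rule zero_count_bound[OF Y X0(2)]) (use ord nzY R2 C0 in auto)
  moreover have "log_mean R2 X \<le> log_max_mean R2 X Y"
    by (rule log_mean_le_log_max_mean[OF X Y]) (use ord nzX R2 in auto)
  moreover have "log_mean R2 Y \<le> log_max_mean R2 X Y"
    unfolding log_max_mean_commute[of _ X] by (rule log_mean_le_log_max_mean[OF Y X]) (use ord nzY R2 in auto)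
  ultimately have "n * (ln R2 - ln R1) \<le> c * \<Phi>"
    using U2 c\<Phi> ln2 \<Phi> unfolding n_def distrib_right by linarith
  moreover have "ln R2 - ln R1 \<ge> 1 / (8 * r * \<Phi>)"
  proof -
    have "ln (R1 / R2) \<le> R1 / R2 - 1" by (rule ln_le_minus_one) (use ord in auto)
    then have "ln R2 - ln R1 \<ge> (R2 - R1) / R2" using ord by (simp add: ln_div diff_divide_distrib)
    moreover have "(R2 - R1) / R2 \<ge> (\<delta> / 4) / (2 * r)"
      by (intro frac_le) (use R1 R2 \<delta> r in linarith)+
    ultimately show ?thesis by (simp add: \<delta>_def mult_ac)
  qed
  ultimately have "n * (1 / (8 * r * \<Phi>)) \<le> c * \<Phi>"
    using n0 by (meson mult_left_mono order_trans)
  then have n: "n \<le> 8 * c * r * \<Phi>\<^sup>2" using ord \<Phi> by (simp add: field_simps power2_eq_square)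
  have rp: "1 \<le> r" using r by simp
  \<comment> \<open>From here on all quantities in the bound are estimated by monomials in \<open>r\<close> and \<open>\<Phi>\<close>.\<close>
  have gap: "R1 - r \<ge> 1 / (4 * \<Phi>)" using R1 by (simp add: \<delta>_def)
  have T: "sqrt (2 * R1 / (R1 - r)\<^sup>2 * D) \<le> 64 * c * r * \<Phi> ^ 3"
  proof -
    have "1 / (R1 - r)\<^sup>2 \<le> 1 / (1 / (4 * \<Phi>))\<^sup>2"
      using gap \<Phi> ord by (intro divide_left_mono power_mono mult_pos_pos zero_less_power) auto
    also have "\<dots> = 16 * \<Phi>\<^sup>2" by (simp add: power_divide power_mult_distrib)
    finally have "1 / (R1 - r)\<^sup>2 \<le> 16 * \<Phi>\<^sup>2" .
    moreover have "2 * R1 \<le> 4 * r" using R1 \<delta> r by linarith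
    ultimately have "2 * R1 * (1 / (R1 - r)\<^sup>2) * D \<le> 4 * r * (16 * \<Phi>\<^sup>2) * (c * \<Phi>)"
      by - (rule mult_mono[OF mult_mono]; use D D0 ord rp in simp)
    then have "2 * R1 / (R1 - r)\<^sup>2 * D \<le> 64 * c * r * \<Phi> ^ 3"
      by (simp add: power2_eq_square power3_eq_cube mult_ac)
    then have "sqrt (2 * R1 / (R1 - r)\<^sup>2 * D) \<le> sqrt (64 * c * r * \<Phi> ^ 3)" by simp
    also have "\<dots> \<le> 64 * c * r * \<Phi> ^ 3"
    proof -
      have "1 \<le> 64 * c * r * \<Phi> ^ 3"
        using c rp \<Phi> by (intro order_trans[OF _ mult_mono[of 1 "64 * c * r" 1 "\<Phi> ^ 3"]] order_trans[OF _ mult_mono[of 1 "64 * c" 1 r]]) auto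
      then have "64 * c * r * \<Phi> ^ 3 * 1 \<le> (64 * c * r * \<Phi> ^ 3) * (64 * c * r * \<Phi> ^ 3)" by (intro mult_left_mono) auto
      with \<open>1 \<le> 64 * c * r * \<Phi> ^ 3\<close> show ?thesis by (intro real_le_lsqrt) (auto simp: power2_eq_square)
    qed
    finally show ?thesis .
  qed
  have S: "sqrt 2 / sqrt r + 1 / sqrt (R1 - r) \<le> 4 * \<Phi>"
  proof -
    have "sqrt 2 / sqrt r \<le> 2 / 1"
      using rp real_sqrt_le_mono[of 2 4] by (intro frac_le) auto
    moreover have "1 / sqrt (R1 - r) \<le> 1 / sqrt (1 / (4 * \<Phi>))"
      using gap \<Phi> ord by (intro divide_left_mono mult_pos_pos) auto
    moreover have "1 / sqrt (1 / (4 * \<Phi>)) = 2 * sqrt \<Phi>" by (simp add: real_sqrt_divide real_sqrt_mult)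
    moreover have "sqrt \<Phi> \<le> \<Phi>" using \<Phi> by (intro real_le_lsqrt) (auto simp: power2_eq_square)
    ultimately show ?thesis using \<Phi> by linarith
  qed
  have "n * (sqrt 2 / sqrt r + 1 / sqrt (R1 - r)) \<le> (8 * c * r * \<Phi>\<^sup>2) * (4 * \<Phi>)"
    using n S n0 ord c \<Phi> by (intro mult_mono) auto
  also have "\<dots> = 32 * c * r * \<Phi> ^ 3" by (simp add: power2_eq_square power3_eq_cube)
  finally have nS: "n * (sqrt 2 / sqrt r + 1 / sqrt (R1 - r)) \<le> 32 * c * r * \<Phi> ^ 3" .
  have one: "1 \<le> c * r * \<Phi> ^ 3"
    using c rp \<Phi> by (intro order_trans[OF _ mult_mono[of 1 "c * r" 1 "\<Phi> ^ 3"]] order_trans[OF _ mult_mono[of 1 "c" 1 r]]) auto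
  have "circle_mean r (\<lambda>z. log_plus (norm (deriv X z / X z - deriv Y z / Y z))) \<le>
    2 * ln (1 + (sqrt (2 * R1 / (R1 - r)\<^sup>2 * D) + n * (sqrt 2 / sqrt r + 1 / sqrt (R1 - r))))"
    unfolding D_def n_def
  proof (rule log_derivative_lemma[OF X Y ord(7,2)])
    show "X z \<noteq> 0" "Y z \<noteq> 0" if "norm z = r" for z
      using that nzX(2) nzY(2) r C0 by simp_all
    show "X z \<noteq> 0" "Y z \<noteq> 0" if "norm z = R1" for z
      using that nzX(3) nzY(3) ord R1 by simp_all
  qed
  also have "\<dots> \<le> 2 * ln (97 * c * r * \<Phi> ^ 3)"
  proof (intro mult_left_mono ln_mono)
    show "0 < 1 + (sqrt (2 * R1 / (R1 - r)\<^sup>2 * D) + n * (sqrt 2 / sqrt r + 1 / sqrt (R1 - r)))"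
      using n0 D0 ord by (intro add_pos_nonneg add_nonneg_nonneg mult_nonneg_nonneg) auto
  qed (use T nS one in linarith)+
  also have "ln (97 * c * r * \<Phi> ^ 3) = ln (97 * c) + ln r + 3 * ln \<Phi>"
    using c rp \<Phi> by (simp add: ln_mult_pos ln_realpow)
  finally show ?thesis by simp
qed

lemma log_le_linear:
  fixes x d :: real
  assumes "x > 0" "d > 0"
  shows "ln x \<le> d * x - 1 - ln d"
  using ln_le_minus_one[of "d * x"] assms by (simp add: ln_mult_pos)

text \<open>
  The Wronskian of \<open>f^n * g * v\<close> and \<open>u\<close> with its factor \<open>f^(n - 1)\<close> removed.
\<close>

definition reduced_wronskian ::
  "nat \<Rightarrow> (complex \<Rightarrow> complex) \<Rightarrow> (complex \<Rightarrow> complex) \<Rightarrow> (complex \<Rightarrow> complex) \<Rightarrow> (complex \<Rightarrow> complex) \<Rightarrow> complex \<Rightarrow> complex" where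
  "reduced_wronskian n f g u v z = (of_nat n * deriv f z * g z + f z * deriv g z) * v z * u z
     + f z * g z * (deriv v z * u z - v z * deriv u z)"

lemma holomorphic_reduced_wronskian:
  assumes "f holomorphic_on UNIV" "g holomorphic_on UNIV" "u holomorphic_on UNIV" "v holomorphic_on UNIV"
  shows "reduced_wronskian n f g u v holomorphic_on UNIV"
  unfolding reduced_wronskian_def by (intro holomorphic_intros assms) auto

text \<open>
  A zero of \<open>f\<close> of order \<open>k\<close> is a zero of order \<open>n * k\<close> of \<open>f^n\<close>, and it is still one of order
  \<open>(n - 1) * k\<close> of the Wronskian. This is the source of the truncation in the second main theorem.
\<close>

lemma wronskian_factor:
  assumes hol: "f holomorphic_on UNIV" "g holomorphic_on UNIV" "u holomorphic_on UNIV" "v holomorphic_on UNIV" and n: "n > 0"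
  defines "A \<equiv> \<lambda>z. f z ^ n * g z * v z"
  shows "deriv A z * u z - A z * deriv u z = f z ^ (n - 1) * reduced_wronskian n f g u v z"
proof -
  have d: "(h has_field_derivative deriv h z) (at z)" if "h holomorphic_on UNIV" for h
    using holomorphic_derivI[OF that, of z] by simp
  obtain k where k: "n = Suc k" using n by (cases n) auto
  have "(A has_field_derivative (of_nat n * (deriv f z * f z ^ (n - Suc 0)) * g z + deriv g z * f z ^ n) * v z + deriv v z * (f z ^ n * g z)) (at z)"
    unfolding A_def by (intro DERIV_mult DERIV_power d hol)
  then have "deriv A z = (of_nat n * (deriv f z * f z ^ (n - Suc 0)) * g z + deriv g z * f z ^ n) * v z + deriv v z * (f z ^ n * g z)"
    by (rule DERIV_imp_deriv)
  then show ?thesis unfolding k by (simp add: A_def reduced_wronskian_def k algebra_simps)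
qed

text \<open>
  With \<open>F = f^n * g\<close>, \<open>A = F * v\<close> and \<open>C = A - u\<close>, the Wronskian \<open>W\<close> of \<open>A\<close> and \<open>u\<close> is also, up
  to sign, that of any two of \<open>A, u, C\<close>. Hence \<open>W / (C * u)\<close> and \<open>W / (C * A)\<close> are differences of
  logarithmic derivatives, and together they bound \<open>max \<bar>A\<bar> \<bar>u\<bar> * \<bar>W\<bar>\<close> by
  \<open>\<bar>A * u * C\<bar>\<close> times log-derivative terms. Since \<open>\<bar>A\<bar>\<close> contains \<open>\<bar>f\<bar>^n\<close> and \<open>\<bar>W\<bar>\<close> contains
  \<open>\<bar>f\<bar>^(n - 1)\<close>, only one factor \<open>\<bar>f\<bar>\<close> remains on the right.
\<close>

lemma second_main_pointwise:
  assumes hol: "f holomorphic_on UNIV" "g holomorphic_on UNIV" "u holomorphic_on UNIV" "v holomorphic_on UNIV" and n: "n > 0"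
  defines "A \<equiv> \<lambda>z. f z ^ n * g z * v z" and "C \<equiv> \<lambda>z. f z ^ n * g z * v z - u z"
  assumes nz: "f z \<noteq> 0" "g z \<noteq> 0" "u z \<noteq> 0" "v z \<noteq> 0" "C z \<noteq> 0" "reduced_wronskian n f g u v z \<noteq> 0"
  shows "log_plus (norm (f z ^ n * g z)) + ln (norm (reduced_wronskian n f g u v z))
    \<le> ln (max (norm (u z)) (norm (v z))) + ln (norm (f z)) + ln (norm (g z)) + ln (norm (C z))
      + log_plus (norm (deriv C z / C z - deriv u z / u z)) + log_plus (norm (deriv C z / C z - deriv A z / A z))"
proof -
  define Q where "Q = reduced_wronskian n f g u v z"
  define W where "W = deriv A z * u z - A z * deriv u z"
  have WQ: "W = f z ^ (n - 1) * Q"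
    unfolding W_def Q_def A_def by (rule wronskian_factor[OF hol n])
  have holA: "A holomorphic_on UNIV" unfolding A_def by (intro holomorphic_intros hol)
  have CA: "C w = A w - u w" for w by (simp add: C_def A_def)
  have dC: "deriv C z = deriv A z - deriv u z"
    unfolding CA[abs_def] by (intro deriv_diff holomorphic_on_imp_differentiable_at[OF _ open_UNIV] holA hol) auto
  define D1 where "D1 = deriv C z / C z - deriv u z / u z"
  define D2 where "D2 = deriv C z / C z - deriv A z / A z"
  have Anz: "A z \<noteq> 0" using nz by (simp add: A_def)
  have "D1 * (C z * u z) = W" unfolding D1_def W_def dC using nz(3,5) by (simp add: field_simps CA)
  then have W1: "norm W = norm D1 * norm (C z) * norm (u z)" by (metis norm_mult mult.assoc)
  have "D2 * (C z * A z) = W" unfolding D2_def W_def dC using Anz nz(5) by (simp add: field_simps CA)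
  then have W2: "norm W = norm D2 * norm (C z) * norm (A z)" by (metis norm_mult mult.assoc)
  define M where "M = max (norm (u z)) (norm (v z))"
  define E where "E = max 1 (norm D1) * max 1 (norm D2)"
  have E: "norm D1 \<le> E" "norm D2 \<le> E" "E > 0"
    unfolding E_def
    using mult_mono[of "norm D1" "max 1 (norm D1)" 1 "max 1 (norm D2)"]
      mult_mono[of 1 "max 1 (norm D1)" "norm D2" "max 1 (norm D2)"] by (auto simp: max_def intro!: mult_pos_pos)
  define F where "F = norm (f z ^ n * g z)"
  have normA: "norm (A z) = F * norm (v z)" by (simp add: A_def F_def norm_mult)
  have Mp: "M > 0" using nz by (auto simp: M_def max_def)
  have "max 1 F * norm (v z) * norm (u z) * norm W \<le> norm (A z) * norm (u z) * norm (C z) * E * M"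
  proof (cases "F \<le> 1")
    case True
    have "norm (u z) * norm W = norm (u z) * (norm D2 * norm (C z) * norm (A z))" by (simp add: W2)
    also have "\<dots> \<le> norm (u z) * (E * norm (C z) * norm (A z))"
      using E by (intro mult_left_mono mult_right_mono) auto
    finally have "norm (v z) * (norm (u z) * norm W) \<le> M * (norm (u z) * (E * norm (C z) * norm (A z)))"
      by (rule mult_mono[rotated]) (use Mp in \<open>auto simp: M_def\<close>)
    then show ?thesis using True by (simp add: max_def mult_ac)
  next
    case False
    have "norm (A z) * norm W = norm (A z) * (norm D1 * norm (C z) * norm (u z))" by (simp add: W1)
    also have "\<dots> \<le> norm (A z) * (E * norm (C z) * norm (u z))"
      using E by (intro mult_left_mono mult_right_mono) auto
    finally have "norm (u z) * (norm (A z) * norm W) \<le> M * (norm (A z) * (E * norm (C z) * norm (u z)))"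
      by (rule mult_mono[rotated]) (use Mp in \<open>auto simp: M_def\<close>)
    then show ?thesis using False by (simp add: max_def mult_ac normA)
  qed
  moreover have "norm (A z) = norm (f z) ^ (n - 1) * norm (f z) * norm (g z) * norm (v z)"
    using n by (simp add: A_def norm_mult norm_power flip: power_Suc2)
  moreover have "norm W = norm (f z) ^ (n - 1) * norm Q" by (simp add: WQ norm_mult norm_power)
  ultimately have "(max 1 F * norm Q) * (norm (v z) * norm (u z) * norm (f z) ^ (n - 1))
     \<le> (norm (f z) * norm (g z) * norm (C z) * E * M) * (norm (v z) * norm (u z) * norm (f z) ^ (n - 1))"
    by (simp add: mult_ac)
  then have "max 1 F * norm Q \<le> norm (f z) * norm (g z) * norm (C z) * E * M"
    by (rule mult_right_le_imp_le) (use nz in auto)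
  then have "ln (max 1 F * norm Q) \<le> ln (norm (f z) * norm (g z) * norm (C z) * E * M)"
    by (intro ln_mono) (use nz in \<open>auto simp: Q_def max_def\<close>)
  moreover have "ln (max 1 F * norm Q) = ln (max 1 F) + ln (norm Q)"
    using nz by (intro ln_mult_pos) (auto simp: Q_def max_def)
  moreover have "ln (norm (f z) * norm (g z) * norm (C z) * E * M) = ln (norm (f z)) + ln (norm (g z)) + ln (norm (C z)) + ln E + ln M"
    using nz E Mp by (simp add: ln_mult_pos)
  moreover have "ln E = ln (max 1 (norm D1)) + ln (max 1 (norm D2))"
    unfolding E_def by (rule ln_mult_pos) (auto simp: max_def)
  ultimately show ?thesis
    by (simp add: log_plus_eq_ln_max F_def Q_def M_def D1_def D2_def)
qed

text \<open>
  The derivative of \<open>A / B\<close> vanishes near \<open>z0\<close>; the identity then spreads by analytic continuation.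
\<close>

lemma vanishing_wronskian_proportional:
  assumes A: "A holomorphic_on UNIV" and B: "B holomorphic_on UNIV" and z0: "B z0 \<noteq> 0"
    and W: "\<And>z. deriv A z * B z - A z * deriv B z = 0"
  shows "A z = A z0 / B z0 * B z"
proof -
  have d: "(h has_field_derivative deriv h z) (at z)" if "h holomorphic_on UNIV" for h z
    using holomorphic_derivI[OF that, of z] by simp
  have "continuous (at z0) B" using B holomorphic_on_imp_continuous_on continuous_on_eq_continuous_at[of UNIV] by auto
  from continuous_at_avoid[OF this z0] obtain e where e: "e > 0" "\<And>y. dist z0 y < e \<Longrightarrow> B y \<noteq> 0" by auto
  have "\<exists>c. \<forall>x\<in>ball z0 e. A x / B x = c"
  proof (rule has_field_derivative_zero_constant)
    fix x assume x: "x \<in> ball z0 e"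
    then have "B x \<noteq> 0" using e by simp
    from DERIV_divide[OF d[OF A] d[OF B] this]
    have "((\<lambda>x. A x / B x) has_field_derivative 0) (at x)" using W[of x] by simp
    then show "((\<lambda>x. A x / B x) has_field_derivative 0) (at x within ball z0 e)"
      by (rule has_field_derivative_at_within)
  qed simp
  then obtain c where c: "\<And>x. x \<in> ball z0 e \<Longrightarrow> A x / B x = c" by blast
  have "c = A z0 / B z0" using c[of z0] e by simp
  have "A z = c * B z"
  proof (rule analytic_continuation_open[of "ball z0 e" UNIV A "\<lambda>z. c * B z"])
    show "A x = c * B x" if "x \<in> ball z0 e" for x
      using c[OF that] e(2)[of x] that by (auto simp: field_simps)
  qed (use e A B in \<open>auto intro!: holomorphic_intros simp: Convex.connected_UNIV\<close>)
  then show ?thesis using \<open>c = _\<close> by simp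
qed

text \<open>
  Since \<open>u\<close> and \<open>v\<close> have no common zero, \<open>v z \<noteq> 0\<close> at every zero \<open>z\<close> of \<open>F * v - u\<close>, so this is
  a zero of \<open>F - a\<close> in the sense of limits. In particular \<open>F * v - u\<close> cannot vanish identically.
\<close>

lemma difference_zeros:
  assumes F: "F holomorphic_on UNIV" and u: "u holomorphic_on UNIV" and v: "v holomorphic_on UNIV"
    and uv: "\<And>z. u z \<noteq> 0 \<or> v z \<noteq> 0" and sp: "{z. a z \<noteq> u z / v z} sparse_in UNIV"
    and fin: "finite {z. (\<lambda>w. F w - a w) \<midarrow>z\<rightarrow> 0}"
  shows "finite {z. F z * v z - u z = 0}" "\<exists>w. F w * v w - u w \<noteq> 0"
proof -
  have "(\<lambda>w. F w - a w) \<midarrow>z\<rightarrow> 0" if z: "F z * v z - u z = 0" for z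
  proof -
    have "v z \<noteq> 0" using z uv[of z] by auto
    have cont: "isCont h z" if "h holomorphic_on UNIV" for h
      using that holomorphic_on_imp_continuous_on continuous_on_eq_continuous_at[of UNIV h] by auto
    have "(\<lambda>w. F w - u w / v w) \<midarrow>z\<rightarrow> F z - u z / v z"
      using cont[OF F] cont[OF u] cont[OF v] \<open>v z \<noteq> 0\<close> unfolding isCont_def by (intro tendsto_intros)
    moreover have "F z - u z / v z = 0" using z \<open>v z \<noteq> 0\<close> by (simp add: field_simps)
    ultimately have lim: "(\<lambda>w. F w - u w / v w) \<midarrow>z\<rightarrow> 0" by simp
    have "\<forall>\<^sub>\<approx>w. a w = u w / v w" using sp by (simp add: eventually_cosparse)
    then have "\<forall>\<^sub>F w in at z. a w = u w / v w"
      by (rule eventually_cosparse_imp_eventually_at) auto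
    then have "\<forall>\<^sub>F w in at z. F w - u w / v w = F w - a w" by eventually_elim simp
    with lim show ?thesis by (rule Lim_transform_eventually)
  qed
  then have sub: "{z. F z * v z - u z = 0} \<subseteq> {z. (\<lambda>w. F w - a w) \<midarrow>z\<rightarrow> 0}" by blast
  with fin show fin': "finite {z. F z * v z - u z = 0}" by (rule finite_subset[rotated])
  show "\<exists>w. F w * v w - u w \<noteq> 0"
  proof (rule ccontr)
    assume "\<not> ?thesis"
    then have "{z. F z * v z - u z = 0} = UNIV" by auto
    with fin' show False by (simp add: infinite_UNIV_char_0)
  qed
qed

lemma log_max_mean_difference:
  assumes A: "A holomorphic_on UNIV" and B: "B holomorphic_on UNIV" and r: "r > 0"
    and nz: "\<And>z. norm z = r \<Longrightarrow> A z \<noteq> 0" "\<And>z. norm z = r \<Longrightarrow> B z \<noteq> 0"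
  shows "log_max_mean r (\<lambda>z. A z - B z) A \<le> log_max_mean r A B + ln 2"
    "log_max_mean r (\<lambda>z. A z - B z) B \<le> log_max_mean r A B + ln 2"
proof -
  have D: "(\<lambda>z. A z - B z) holomorphic_on UNIV" by (intro holomorphic_intros A B)
  have *: "log_max_mean r (\<lambda>z. A z - B z) Y \<le> log_max_mean r A B + ln 2"
    if Y: "Y holomorphic_on UNIV" "\<And>z. norm z = r \<Longrightarrow> Y z \<noteq> 0" "\<And>z. norm (Y z) \<le> max (norm (A z)) (norm (B z))" for Y
  proof -
    have "log_max_mean r (\<lambda>z. A z - B z) Y \<le> circle_mean r (\<lambda>z. ln (max (norm (A z)) (norm (B z))) + ln 2)"
      unfolding log_max_mean_def
    proof (rule circle_mean_mono)
      show "continuous_on (sphere 0 r) (\<lambda>z. ln (max (norm (A z - B z)) (norm (Y z))))"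
        using continuous_on_ln_max_norm[OF D Y(1)] Y(2) by auto
      show "continuous_on (sphere 0 r) (\<lambda>z. ln (max (norm (A z)) (norm (B z))) + ln 2)"
        by (intro continuous_intros continuous_on_ln_max_norm A B) (use nz in auto)
      fix z :: complex assume z: "norm z = r"
      have "norm (A z - B z) \<le> norm (A z) + norm (B z)" by (rule norm_triangle_ineq4)
      also have "\<dots> \<le> max (norm (A z)) (norm (B z)) * 2" by (simp add: max_def)
      finally have "max (norm (A z - B z)) (norm (Y z)) \<le> max (norm (A z)) (norm (B z)) * 2"
        using Y(3)[of z] norm_ge_zero[of "A z"] by linarith
      then have "ln (max (norm (A z - B z)) (norm (Y z))) \<le> ln (max (norm (A z)) (norm (B z)) * 2)"
        using Y(2)[OF z] by (intro ln_mono) (auto simp: less_max_iff_disj)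
      also have "\<dots> = ln (max (norm (A z)) (norm (B z))) + ln 2"
        using nz[OF z] by (intro ln_mult_pos) (auto simp: less_max_iff_disj)
      finally show "ln (max (norm (A z - B z)) (norm (Y z))) \<le> ln (max (norm (A z)) (norm (B z))) + ln 2" .
    qed (rule r)
    also have "\<dots> = log_max_mean r A B + ln 2"
      unfolding log_max_mean_def by (subst circle_mean_add) (use nz r in \<open>auto intro!: continuous_on_ln_max_norm A B\<close>)
    finally show ?thesis .
  qed
  show "log_max_mean r (\<lambda>z. A z - B z) A \<le> log_max_mean r A B + ln 2" by (rule *) (use A nz in auto)
  show "log_max_mean r (\<lambda>z. A z - B z) B \<le> log_max_mean r A B + ln 2" by (rule *) (use B nz in auto)
qed

lemma circle_mean_add6:
  assumes "r > 0" "continuous_on (sphere 0 r) \<phi>1" "continuous_on (sphere 0 r) \<phi>2" "continuous_on (sphere 0 r) \<phi>3"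
    "continuous_on (sphere 0 r) \<phi>4" "continuous_on (sphere 0 r) \<phi>5" "continuous_on (sphere 0 r) \<phi>6"
  shows "circle_mean r (\<lambda>z. \<phi>1 z + \<phi>2 z + \<phi>3 z + \<phi>4 z + \<phi>5 z + \<phi>6 z) =
      circle_mean r \<phi>1 + circle_mean r \<phi>2 + circle_mean r \<phi>3 + circle_mean r \<phi>4 + circle_mean r \<phi>5 + circle_mean r \<phi>6"
    "continuous_on (sphere 0 r) (\<lambda>z. \<phi>1 z + \<phi>2 z + \<phi>3 z + \<phi>4 z + \<phi>5 z + \<phi>6 z)"
  by (simp_all add: circle_mean_add continuous_on_add assms)

text \<open>
  Integrated form of the pointwise bound. If \<open>a = u / v\<close> is small and \<open>C\<close> has few zeros, it says that
  the characteristic of \<open>f^n * g\<close> is essentially at most \<open>N(r, 1/f) + N(r, 1/g)\<close>.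
\<close>

lemma second_main_inequality:
  assumes hol: "f holomorphic_on UNIV" "g holomorphic_on UNIV" "u holomorphic_on UNIV" "v holomorphic_on UNIV" and n: "n > 0" and r: "r > 0"
  defines "A \<equiv> \<lambda>z. f z ^ n * g z * v z" and "C \<equiv> \<lambda>z. f z ^ n * g z * v z - u z" and "Q \<equiv> reduced_wronskian n f g u v"
  assumes nz: "\<And>z. norm z = r \<Longrightarrow> f z \<noteq> 0" "\<And>z. norm z = r \<Longrightarrow> g z \<noteq> 0" "\<And>z. norm z = r \<Longrightarrow> u z \<noteq> 0"
     "\<And>z. norm z = r \<Longrightarrow> v z \<noteq> 0" "\<And>z. norm z = r \<Longrightarrow> C z \<noteq> 0" "\<And>z. norm z = r \<Longrightarrow> Q z \<noteq> 0"
  shows "proximity r (\<lambda>z. f z ^ n * g z) + log_mean r Q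
    \<le> log_max_mean r u v + log_mean r f + log_mean r g + log_mean r C
      + circle_mean r (\<lambda>z. log_plus (norm (deriv C z / C z - deriv u z / u z)))
      + circle_mean r (\<lambda>z. log_plus (norm (deriv C z / C z - deriv A z / A z)))"
proof -
  have holA: "A holomorphic_on UNIV" unfolding A_def by (intro holomorphic_intros hol)
  have holC: "C holomorphic_on UNIV" unfolding C_def by (intro holomorphic_intros hol)
  have holQ: "Q holomorphic_on UNIV" unfolding Q_def by (rule holomorphic_reduced_wronskian[OF hol])
  have Anz: "A z \<noteq> 0" if "norm z = r" for z using nz that by (simp add: A_def)
  have cF: "continuous_on (sphere 0 r) (\<lambda>z. log_plus (norm (f z ^ n * g z)))"
    by (intro continuous_on_log_plus_norm continuous_intros holomorphic_on_imp_continuous_on holomorphic_on_subset[OF hol(1)] holomorphic_on_subset[OF hol(2)]) auto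
  have cD: "continuous_on (sphere 0 r) (\<lambda>z. log_plus (norm (deriv X z / X z - deriv Y z / Y z)))"
    if X: "X holomorphic_on UNIV" and Y: "Y holomorphic_on UNIV" and "\<And>z. norm z = r \<Longrightarrow> X z \<noteq> 0" "\<And>z. norm z = r \<Longrightarrow> Y z \<noteq> 0" for X Y
    using that(3,4)
    by (intro continuous_on_log_plus_norm continuous_intros holomorphic_on_imp_continuous_on holomorphic_deriv[OF X, THEN holomorphic_on_subset]
        holomorphic_deriv[OF Y, THEN holomorphic_on_subset] holomorphic_on_subset[OF X] holomorphic_on_subset[OF Y]) auto
  have cuv: "continuous_on (sphere 0 r) (\<lambda>z. ln (max (norm (u z)) (norm (v z))))"
    by (rule continuous_on_ln_max_norm[OF hol(3,4)]) (use nz(3) in blast)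
  have cQ: "continuous_on (sphere 0 r) (\<lambda>z. ln (norm (Q z)))"
    by (rule continuous_on_ln_norm_entire[OF holQ]) (use nz(6) in blast)
  have cf: "continuous_on (sphere 0 r) (\<lambda>z. ln (norm (f z)))"
    by (rule continuous_on_ln_norm_entire[OF hol(1)]) (use nz(1) in blast)
  have cg: "continuous_on (sphere 0 r) (\<lambda>z. ln (norm (g z)))"
    by (rule continuous_on_ln_norm_entire[OF hol(2)]) (use nz(2) in blast)
  have cC: "continuous_on (sphere 0 r) (\<lambda>z. ln (norm (C z)))"
    by (rule continuous_on_ln_norm_entire[OF holC]) (use nz(5) in blast)
  have c1: "continuous_on (sphere 0 r) (\<lambda>z. log_plus (norm (deriv C z / C z - deriv u z / u z)))"
    by (rule cD[OF holC hol(3)]) (use nz in blast)+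
  have c2: "continuous_on (sphere 0 r) (\<lambda>z. log_plus (norm (deriv C z / C z - deriv A z / A z)))"
    by (rule cD[OF holC holA]) (use nz Anz in blast)+
  note sum = circle_mean_add6[OF r cuv cf cg cC c1 c2]
  have "circle_mean r (\<lambda>z. log_plus (norm (f z ^ n * g z)) + ln (norm (Q z))) \<le>
    circle_mean r (\<lambda>z. ln (max (norm (u z)) (norm (v z))) + ln (norm (f z)) + ln (norm (g z)) + ln (norm (C z))
      + log_plus (norm (deriv C z / C z - deriv u z / u z)) + log_plus (norm (deriv C z / C z - deriv A z / A z)))"
  proof (rule circle_mean_mono[OF _ _ r])
    fix z :: complex assume z: "norm z = r"
    note nz' = nz(1)[OF z] nz(2)[OF z] nz(3)[OF z] nz(4)[OF z] nz(5)[OF z, unfolded C_def] nz(6)[OF z, unfolded Q_def]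
    show "log_plus (norm (f z ^ n * g z)) + ln (norm (Q z)) \<le>
      ln (max (norm (u z)) (norm (v z))) + ln (norm (f z)) + ln (norm (g z)) + ln (norm (C z))
      + log_plus (norm (deriv C z / C z - deriv u z / u z)) + log_plus (norm (deriv C z / C z - deriv A z / A z))"
      using second_main_pointwise[OF hol n nz'] by (simp only: A_def C_def Q_def)
  qed (use sum(2) cF cQ in \<open>simp_all add: continuous_on_add\<close>)
  moreover have "circle_mean r (\<lambda>z. log_plus (norm (f z ^ n * g z)) + ln (norm (Q z))) = proximity r (\<lambda>z. f z ^ n * g z) + log_mean r Q"
    unfolding proximity_altdef log_mean_def by (intro circle_mean_add cF cQ r)
  moreover have "circle_mean r (\<lambda>z. ln (max (norm (u z)) (norm (v z))) + ln (norm (f z)) + ln (norm (g z)) + ln (norm (C z))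
      + log_plus (norm (deriv C z / C z - deriv u z / u z)) + log_plus (norm (deriv C z / C z - deriv A z / A z)))
    = log_max_mean r u v + log_mean r f + log_mean r g + log_mean r C
      + circle_mean r (\<lambda>z. log_plus (norm (deriv C z / C z - deriv u z / u z)))
      + circle_mean r (\<lambda>z. log_plus (norm (deriv C z / C z - deriv A z / A z)))"
    unfolding log_max_mean_def log_mean_def
    by (rule sum(1))
  ultimately show ?thesis by simp
qed

lemma countable_union_zero_radii:
  assumes "finite H" "\<And>h. h \<in> H \<Longrightarrow> h holomorphic_on UNIV" "\<And>h. h \<in> H \<Longrightarrow> \<exists>w. h w \<noteq> 0"
  shows "countable (\<Union>h\<in>H. norm ` {z. h z = 0})"
proof (rule countable_UN)
  show "countable H" using assms(1) by (rule countable_finite)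
  fix h assume "h \<in> H"
  then obtain w where "h w \<noteq> 0" using assms(3) by blast
  then show "countable (norm ` {z. h z = 0})"
    using countable_zero_radii[OF assms(2)[OF \<open>h \<in> H\<close>]] by blast
qed

text \<open>
  The second main theorem for the targets \<open>0\<close>, \<open>\<infinity>\<close> and a function \<open>a\<close> such that \<open>F - a\<close> has finitely
  many zeros. The function \<open>U\<close> is the characteristic of \<open>F / a\<close> in Cartan's form, and the last property asks for
  \<open>\<Phi>\<close> to control \<open>U\<close> shortly after \<open>r\<close>. Leaving \<open>\<Phi>\<close> open allows one common growth function,
  hence one common set of good radii, for two pairs \<open>F, a\<close>. Likewise the countable set \<open>C\<close> of excluded
  radii may be enlarged.
\<close>

lemma second_main_estimate:
  assumes f: "f holomorphic_on UNIV" "f zf \<noteq> 0" and g: "g holomorphic_on UNIV" "g zg \<noteq> 0" and n: "n > 0"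
  defines "F \<equiv> \<lambda>z. f z ^ n * g z"
  assumes mero: "a meromorphic_on UNIV" and nz: "\<not> identically_zero a" and fin: "finite {z. (\<lambda>w. F w - a w) \<midarrow>z\<rightarrow> 0}"
  obtains C0 r0 c U where "countable C0" "1 \<le> r0" "0 \<le> c"
    "\<forall>r s. r0 < r \<longrightarrow> r \<le> s \<longrightarrow> r \<notin> C0 \<longrightarrow> s \<notin> C0 \<longrightarrow> U r \<le> U s"
    "\<forall>r. r0 < r \<longrightarrow> r \<notin> C0 \<longrightarrow> - c \<le> U r"
    "\<forall>r. r0 < r \<longrightarrow> r \<notin> C0 \<longrightarrow> U r \<le> proximity r F + nevanlinna_T r a + c"
    "\<forall>r C \<Phi>. r0 < r \<longrightarrow> r \<notin> C \<longrightarrow> C0 \<subseteq> C \<longrightarrow> countable C \<longrightarrow> 1 \<le> \<Phi> \<longrightarrow>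
       (\<forall>s. s \<notin> C \<longrightarrow> r < s \<longrightarrow> s \<le> r + 1 / \<Phi> \<longrightarrow> U s \<le> 2 * \<Phi>) \<longrightarrow>
       proximity r F \<le> nevanlinna_T r a + log_mean r f + log_mean r g + c * (1 + ln r + ln \<Phi>)"
proof -
  obtain u wu v wv where u: "u holomorphic_on UNIV" "u wu \<noteq> 0" and v: "v holomorphic_on UNIV" "v wv \<noteq> 0"
    and uv: "\<And>z. u z \<noteq> 0 \<or> v z \<noteq> 0" and sp: "{z. a z \<noteq> u z / v z} sparse_in UNIV"
    and pole: "\<And>z. is_pole a z \<longleftrightarrow> v z = 0" "\<And>z. v z = 0 \<Longrightarrow> zorder v z = - zorder a z"
    by (rule meromorphic_quotient[OF mero nz]) (rule that)
  define A where "A = (\<lambda>z. f z ^ n * g z * v z)"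
  define C where "C = (\<lambda>z. f z ^ n * g z * v z - u z)"
  define Q where "Q = reduced_wronskian n f g u v"
  \<comment> \<open>If the Wronskian vanishes identically, \<open>1\<close> takes the place of \<open>Q\<close>, so that it excludes no radii.\<close>
  define Q' where "Q' = (if \<exists>w. Q w \<noteq> 0 then Q else (\<lambda>_. 1))"
  have F: "F holomorphic_on UNIV" unfolding F_def by (intro holomorphic_intros f g)
  have A: "A holomorphic_on UNIV" unfolding A_def by (intro holomorphic_intros f g v)
  have C: "C holomorphic_on UNIV" unfolding C_def by (intro holomorphic_intros f g u v)
  have Q: "Q holomorphic_on UNIV" unfolding Q_def by (rule holomorphic_reduced_wronskian[OF f(1) g(1) u(1) v(1)])
  have Q': "Q' holomorphic_on UNIV" "\<exists>w. Q' w \<noteq> 0" by (auto simp: Q'_def Q)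
  have finC: "finite {z. C z = 0}" "\<exists>w. C w \<noteq> 0"
    using difference_zeros[OF F u(1) v(1) uv sp fin] by (simp_all add: C_def F_def)
  define C0 where "C0 = (\<Union>h\<in>{f, g, u, v, C, Q'}. norm ` {z. h z = 0}) \<union> norm ` {z. a z \<noteq> u z / v z}"
  have "countable {z. a z \<noteq> u z / v z}"
    using sparse_imp_countable[OF open_UNIV sp] by simp
  moreover have "countable (\<Union>h\<in>{f, g, u, v, C, Q'}. norm ` {z. h z = 0})"
    by (rule countable_union_zero_radii) (use f g u v C finC Q' in auto)
  ultimately have countC0: "countable C0" unfolding C0_def by (intro countable_Un countable_image)
  have free: "f z \<noteq> 0" "g z \<noteq> 0" "u z \<noteq> 0" "v z \<noteq> 0" "C z \<noteq> 0" "Q' z \<noteq> 0" "A z \<noteq> 0" "a z = u z / v z"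
    if "norm z \<notin> C0" for z
  proof -
    show "f z \<noteq> 0" "g z \<noteq> 0" "u z \<noteq> 0" "v z \<noteq> 0" "C z \<noteq> 0" "Q' z \<noteq> 0" "a z = u z / v z"
      using that by (auto simp: C0_def)
    then show "A z \<noteq> 0" by (simp add: A_def)
  qed
  obtain r0 where r0: "1 < r0" "r0 < 2" "r0 \<notin> C0" by (rule exists_radius_avoiding_countable[OF countC0, of 1 2]) auto
  have pos: "0 < r0" "1 \<le> r0" using r0 by auto
  have lower: "log_mean r0 h \<le> log_mean r h" if "h holomorphic_on UNIV" "h w \<noteq> 0" "r0 < r" "r \<notin> C0" "\<And>z. norm z \<notin> C0 \<Longrightarrow> h z \<noteq> 0" for h w r
    using that r0 pos by (intro log_mean_mono) auto
  define U where "U s = log_max_mean s A u" for s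
  have T: "log_max_mean r u v \<le> nevanlinna_T r a + log_mean r0 v" and pc: "pole_counting r a \<ge> 0"
    if r: "r0 < r" "r \<notin> C0" for r
  proof -
    have r': "0 < r" using r pos by simp
    have le: "log_mean r v - log_mean r0 v \<le> pole_counting r a"
      by (rule log_mean_le_pole_counting[OF v pole]) (use r r0 free pos in auto)
    then show "pole_counting r a \<ge> 0" using lower[OF v r] free(4) by simp
    have "log_max_mean r u v = circle_mean r (\<lambda>z. log_plus (norm (a z)) + ln (norm (v z)))"
      unfolding log_max_mean_def
    proof (rule circle_mean_cong[OF _ r'])
      fix z :: complex assume z: "norm z = r"
      have nz: "u z \<noteq> 0" "v z \<noteq> 0" "a z = u z / v z" using free z r by auto
      have "max (norm (u z)) (norm (v z)) = max 1 (norm (a z)) * norm (v z)"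
      proof -
        have "norm (u z) = norm (a z) * norm (v z)" using nz by (simp add: norm_divide)
        then show ?thesis by (simp add: max_mult_distrib_right max.commute)
      qed
      then have "ln (max (norm (u z)) (norm (v z))) = ln (max 1 (norm (a z))) + ln (norm (v z))"
        using nz by (simp add: ln_mult_pos less_max_iff_disj)
      then show "ln (max (norm (u z)) (norm (v z))) = log_plus (norm (a z)) + ln (norm (v z))"
        by (simp add: log_plus_eq_ln_max)
    qed
    also have "\<dots> = proximity r a + log_mean r v"
      unfolding proximity_altdef log_mean_def
    proof (rule circle_mean_add[OF _ _ r'])
      have "continuous_on (sphere 0 r) (\<lambda>z. u z / v z)"
        by (intro continuous_intros holomorphic_on_imp_continuous_on holomorphic_on_subset[OF u(1)] holomorphic_on_subset[OF v(1)])
           (use free r in auto)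
      then have "continuous_on (sphere 0 r) a"
        by (rule continuous_on_eq) (use free(8) r in auto)
      then show "continuous_on (sphere 0 r) (\<lambda>z. log_plus (norm (a z)))" by (rule continuous_on_log_plus_norm)
      show "continuous_on (sphere 0 r) (\<lambda>z. ln (norm (v z)))"
        by (rule continuous_on_ln_norm_entire[OF v(1)]) (use free r in auto)
    qed
    finally show "log_max_mean r u v \<le> nevanlinna_T r a + log_mean r0 v"
      using le by (simp add: nevanlinna_T_def)
  qed
  obtain d where d: "\<And>R. r0 \<le> R \<Longrightarrow> (\<And>z. norm z = R \<Longrightarrow> C z \<noteq> 0) \<Longrightarrow>
    log_mean R C \<le> log_mean r0 C + d * (ln R - ln r0)" "d \<ge> 0"
  proof -
    obtain w where w: "C w \<noteq> 0" using finC(2) by blast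
    show thesis
      by (rule log_mean_finite_zeros[OF C w finC(1) pos(1)]) (use that free(5) r0 in auto)
  qed
  define k where "k = A (of_real r0) / u (of_real r0)"
  define c1 where "c1 = 6 + \<bar>log_mean r0 C\<bar> + \<bar>log_mean r0 u\<bar>"
  define c2 where "c2 = 6 + \<bar>log_mean r0 C\<bar> + \<bar>log_mean r0 A\<bar>"
  define K where "K = \<bar>log_mean r0 v\<bar> + \<bar>log_mean r0 C\<bar> + \<bar>log_mean r0 Q'\<bar> + \<bar>log_mean r0 A\<bar> + \<bar>log_mean r0 f\<bar> + \<bar>log_mean r0 g\<bar>
     + log_plus (norm k) + 2 * ln (97 * c1) + 2 * ln (97 * c2)"
  define c where "c = K + d + 12"
  have "log_plus (norm k) \<ge> 0" by (simp add: log_plus_def)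
  moreover have "ln (97 * c1) \<ge> 0" "ln (97 * c2) \<ge> 0" by (auto simp: c1_def c2_def intro!: ln_ge_zero)
  ultimately have K0: "K \<ge> 0" "\<bar>log_mean r0 v\<bar> \<le> K" "\<bar>log_mean r0 A\<bar> \<le> K" "log_plus (norm k) + \<bar>log_mean r0 f\<bar> + \<bar>log_mean r0 g\<bar> \<le> K"
    "\<bar>log_mean r0 v\<bar> + \<bar>log_mean r0 C\<bar> + \<bar>log_mean r0 Q'\<bar> + 2 * ln (97 * c1) + 2 * ln (97 * c2) \<le> K"
    by (auto simp: K_def)
  have c0: "c \<ge> 0" "K \<le> c" using K0 d(2) by (auto simp: c_def)
  have 1: "U r \<le> U s" if "r0 < r" "r \<le> s" "r \<notin> C0" "s \<notin> C0" for r s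
    unfolding U_def using that pos free by (intro log_max_mean_mono[OF A u(1)]) auto
  have 2: "- c \<le> U r" if r: "r0 < r" "r \<notin> C0" for r
  proof -
    have "log_mean r0 A \<le> log_mean r A" using r r0 pos free(7) by (intro log_mean_mono[OF A, of "of_real r0"]) auto
    also have "\<dots> \<le> U r" unfolding U_def by (rule log_mean_le_log_max_mean[OF A u(1)]) (use r pos free in auto)
    finally show ?thesis using K0 c0 by linarith
  qed
  have 3: "U r \<le> proximity r F + nevanlinna_T r a + c" if r: "r0 < r" "r \<notin> C0" for r
  proof -
    have r': "0 < r" using r pos by simp
    have cF: "continuous_on (sphere 0 r) (\<lambda>z. log_plus (norm (F z)))"
      by (intro continuous_on_log_plus_norm holomorphic_on_imp_continuous_on holomorphic_on_subset[OF F]) auto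
    have cuv: "continuous_on (sphere 0 r) (\<lambda>z. ln (max (norm (u z)) (norm (v z))))"
      by (rule continuous_on_ln_max_norm[OF u(1) v(1) uv])
    have "U r \<le> circle_mean r (\<lambda>z. log_plus (norm (F z)) + ln (max (norm (u z)) (norm (v z))))"
      unfolding U_def log_max_mean_def
    proof (rule circle_mean_mono[OF _ _ r'])
      show "continuous_on (sphere 0 r) (\<lambda>z. ln (max (norm (A z)) (norm (u z))))"
        by (rule continuous_on_ln_max_norm[OF A u(1)]) (use free r in auto)
      show "continuous_on (sphere 0 r) (\<lambda>z. log_plus (norm (F z)) + ln (max (norm (u z)) (norm (v z))))"
        by (intro continuous_intros cF cuv)
      fix z :: complex assume z: "norm z = r"
      have nz: "u z \<noteq> 0" "A z \<noteq> 0" using free z r by auto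
      have "norm (A z) \<le> max 1 (norm (F z)) * max (norm (u z)) (norm (v z))"
        unfolding A_def F_def norm_mult[of _ "v z"] by (intro mult_mono) (auto simp: max_def)
      moreover have "norm (u z) \<le> max 1 (norm (F z)) * max (norm (u z)) (norm (v z))"
        using mult_mono[of 1 "max 1 (norm (F z))" "norm (u z)" "max (norm (u z)) (norm (v z))"] by auto
      ultimately have "ln (max (norm (A z)) (norm (u z))) \<le> ln (max 1 (norm (F z)) * max (norm (u z)) (norm (v z)))"
        using nz by (intro ln_mono) (auto simp: less_max_iff_disj)
      also have "\<dots> = log_plus (norm (F z)) + ln (max (norm (u z)) (norm (v z)))"
        using nz by (simp add: log_plus_eq_ln_max ln_mult_pos less_max_iff_disj)
      finally show "ln (max (norm (A z)) (norm (u z))) \<le> log_plus (norm (F z)) + ln (max (norm (u z)) (norm (v z)))" .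
    qed
    also have "\<dots> = proximity r F + log_max_mean r u v"
      unfolding proximity_altdef log_max_mean_def by (intro circle_mean_add cF cuv r')
    finally show ?thesis using T[OF r] K0 c0 by linarith
  qed
  have 4: "proximity r F \<le> nevanlinna_T r a + log_mean r f + log_mean r g + c * (1 + ln r + ln \<Phi>)"
    if r: "r0 < r" and "r \<notin> Cs" "C0 \<subseteq> Cs" and Cs: "countable Cs" and \<Phi>: "1 \<le> \<Phi>"
      and growth: "\<And>s. s \<notin> Cs \<Longrightarrow> r < s \<Longrightarrow> s \<le> r + 1 / \<Phi> \<Longrightarrow> U s \<le> 2 * \<Phi>" for r Cs \<Phi>
  proof -
    have rC0: "r \<notin> C0" using that by auto
    have r': "0 < r" "ln r \<ge> 0" "ln \<Phi> \<ge> 0" using r pos \<Phi> by auto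
    show ?thesis
    proof (cases "\<exists>w. Q w \<noteq> 0")
      case True
      then have QQ': "Q' = Q" by (simp add: Q'_def)
      \<comment> \<open>The base radius \<open>r0\<close> avoids the zeros but may belong to \<open>Cs\<close>; it lies below \<open>r\<close>, so releasing it is harmless.\<close>
      define Cb where "Cb = Cs - {r0}"
      have Cb: "countable Cb" "r0 \<notin> Cb" "r \<notin> Cb" using Cs that by (auto simp: Cb_def)
      have free': "norm z \<notin> C0" if "norm z \<notin> Cb" for z :: complex
        using that \<open>C0 \<subseteq> Cs\<close> r0 by (auto simp: Cb_def)
      have U_s: "U s \<le> 2 * \<Phi>" if "s \<notin> Cb" "r < s" "s \<le> r + 1 / \<Phi>" for s
        using growth[of s] that r by (auto simp: Cb_def)
      have diff: "log_max_mean s C A \<le> 2 * \<Phi> + ln 2" "log_max_mean s C u \<le> 2 * \<Phi> + ln 2"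
        if s: "s \<notin> Cb" "r < s" "s \<le> r + 1 / \<Phi>" for s
      proof -
        have "C = (\<lambda>z. A z - u z)" by (simp add: C_def A_def)
        moreover have "0 < s" "A z \<noteq> 0" "u z \<noteq> 0" if "norm z = s" for z
          using s r' free free' that by auto
        ultimately show "log_max_mean s C A \<le> 2 * \<Phi> + ln 2" "log_max_mean s C u \<le> 2 * \<Phi> + ln 2"
          using log_max_mean_difference[OF A u(1), of s] U_s[OF s] r' s by (auto simp: U_def)
      qed
      have L1: "circle_mean r (\<lambda>z. log_plus (norm (deriv C z / C z - deriv u z / u z))) \<le> 2 * ln (97 * c1) + 2 * ln r + 6 * ln \<Phi>"
        unfolding c1_def by (rule log_derivative_growth[OF C u(1) pos(2) r \<Phi> Cb(1)]) (use free free' diff Cb in auto)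
      have L2: "circle_mean r (\<lambda>z. log_plus (norm (deriv C z / C z - deriv A z / A z))) \<le> 2 * ln (97 * c2) + 2 * ln r + 6 * ln \<Phi>"
        unfolding c2_def by (rule log_derivative_growth[OF C A pos(2) r \<Phi> Cb(1)]) (use free free' diff Cb in auto)
      have main: "proximity r F + log_mean r Q
        \<le> log_max_mean r u v + log_mean r f + log_mean r g + log_mean r C
          + circle_mean r (\<lambda>z. log_plus (norm (deriv C z / C z - deriv u z / u z)))
          + circle_mean r (\<lambda>z. log_plus (norm (deriv C z / C z - deriv A z / A z)))"
        unfolding F_def C_def A_def Q_def
        by (rule second_main_inequality[OF f(1) g(1) u(1) v(1) n r'(1)])
           (use free rC0 QQ' in \<open>auto simp: C_def Q_def\<close>)
      have JC: "log_mean r C \<le> log_mean r0 C + d * ln r"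
      proof -
        have "log_mean r C \<le> log_mean r0 C + d * (ln r - ln r0)"
          by (rule d(1)) (use r rC0 free in auto)
        moreover have "d * (ln r - ln r0) \<le> d * ln r" using d(2) pos by (intro mult_left_mono) auto
        ultimately show ?thesis by linarith
      qed
      obtain wq where "Q wq \<noteq> 0" using True by blast
      have JQ: "log_mean r0 Q' \<le> log_mean r Q"
        using lower[OF Q \<open>Q wq \<noteq> 0\<close> r rC0] free(6) QQ' by simp
      have "proximity r F \<le> nevanlinna_T r a + log_mean r f + log_mean r g + (K + (d + 4) * ln r + 12 * ln \<Phi>)"
        using main L1 L2 JC JQ T[OF r rC0] K0(5) by (simp add: distrib_right)
      also have "K + (d + 4) * ln r + 12 * ln \<Phi> \<le> c * 1 + c * ln r + c * ln \<Phi>"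
        using K0(1) d(2) r' c0 by (intro add_mono mult_right_mono) (auto simp: c_def)
      finally show ?thesis by (simp add: distrib_left add.assoc)
    next
      case False
      \<comment> \<open>A vanishing Wronskian makes \<open>F\<close> a constant multiple of \<open>a\<close>, and the estimate is immediate.\<close>
      have z0: "u (of_real r0) \<noteq> 0" using free(3)[of "of_real r0"] r0 pos by simp
      have prop_eq: "A z = k * u z" for z
        unfolding k_def
        by (rule vanishing_wronskian_proportional[OF A u(1) z0])
           (use wronskian_factor[OF f(1) g(1) u(1) v(1) n] False in \<open>simp add: A_def Q_def\<close>)
      have ca: "continuous_on (sphere 0 r) (\<lambda>z. log_plus (norm (a z)))"
      proof -
        have "continuous_on (sphere 0 r) (\<lambda>z. u z / v z)"
          by (intro continuous_intros holomorphic_on_imp_continuous_on holomorphic_on_subset[OF u(1)] holomorphic_on_subset[OF v(1)])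
             (use free rC0 in auto)
        then have "continuous_on (sphere 0 r) a"
          by (rule continuous_on_eq) (use free(8) rC0 in auto)
        then show ?thesis by (rule continuous_on_log_plus_norm)
      qed
      have "proximity r F \<le> circle_mean r (\<lambda>z. log_plus (norm k) + log_plus (norm (a z)))"
        unfolding proximity_altdef
      proof (rule circle_mean_mono[OF _ _ r'(1)])
        show "continuous_on (sphere 0 r) (\<lambda>z. log_plus (norm (F z)))"
          by (intro continuous_on_log_plus_norm holomorphic_on_imp_continuous_on holomorphic_on_subset[OF F]) auto
        show "continuous_on (sphere 0 r) (\<lambda>z. log_plus (norm k) + log_plus (norm (a z)))"
          by (intro continuous_intros ca)
        fix z :: complex assume z: "norm z = r"
        have "v z \<noteq> 0" "a z * v z = u z" using free(4,8)[of z] z rC0 by auto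
        then have "F z * v z = (k * a z) * v z"
          using prop_eq[of z] by (simp only: A_def F_def mult.assoc)
        then have "F z = k * a z" using \<open>v z \<noteq> 0\<close> by simp
        then have "norm (F z) = norm k * norm (a z)" by (simp add: norm_mult)
        then have "max 1 (norm (F z)) \<le> max 1 (norm k) * max 1 (norm (a z))"
          using mult_mono[of "norm k" "max 1 (norm k)" "norm (a z)" "max 1 (norm (a z))"]
            mult_mono[of 1 "max 1 (norm k)" 1 "max 1 (norm (a z))"] by auto
        then have "ln (max 1 (norm (F z))) \<le> ln (max 1 (norm k) * max 1 (norm (a z)))"
          by (intro ln_mono) (auto simp: less_max_iff_disj)
        then show "log_plus (norm (F z)) \<le> log_plus (norm k) + log_plus (norm (a z))"
          by (simp add: log_plus_eq_ln_max ln_mult_pos less_max_iff_disj)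
      qed
      also have "\<dots> = log_plus (norm k) + proximity r a"
        unfolding proximity_altdef by (subst circle_mean_add) (auto intro!: ca r')
      also have "\<dots> \<le> nevanlinna_T r a + log_plus (norm k)"
        using pc[OF r rC0] by (simp add: nevanlinna_T_def)
      also have "\<dots> \<le> nevanlinna_T r a + log_mean r f + log_mean r g + K"
        using lower[OF f r rC0 free(1)] lower[OF g r rC0 free(2)] K0(4) by linarith
      finally have "proximity r F \<le> nevanlinna_T r a + log_mean r f + log_mean r g + K" .
      moreover have "c * 1 \<le> c * (1 + ln r + ln \<Phi>)" using c0 r' by (intro mult_left_mono) auto
      ultimately show ?thesis using c0 by linarith
    qed
  qed
  show thesis
    by (rule that[of C0 r0 c U]) (use countC0 pos c0 1 2 3 4 in auto)
qed

section \<open>The coupled products\<close>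

lemma nevanlinna_T_entire:
  assumes "F holomorphic_on UNIV"
  shows "nevanlinna_T r F = proximity r F"
proof -
  have "\<not> is_pole F z" for z
    by (rule not_is_pole_holomorphic[of UNIV]) (use assms in auto)
  then have "pole_count t F = 0" for t by (simp add: pole_count_def)
  then show ?thesis by (simp add: nevanlinna_T_def pole_counting_def)
qed

text \<open>
  A half line has infinite measure.
\<close>

lemma exists_large_radius:
  fixes E C :: "real set" and R :: real
  assumes E: "E \<in> sets lebesgue" "emeasure lebesgue E < \<infinity>" and C: "countable C"
  obtains r where "r \<ge> R" "r \<notin> E" "r \<notin> C"
proof -
  have C': "C \<in> null_sets lebesgue"
    using countable_imp_null_set_lborel[OF C] by (simp add: null_sets_completionI)
  have "\<not> {R..} \<subseteq> E \<union> C"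
  proof
    assume sub: "{R..} \<subseteq> E \<union> C"
    define b where "b = measure lebesgue E + 1"
    have b: "b \<ge> 0" by (simp add: b_def)
    have "ennreal b = emeasure lebesgue {R..R + b}" using b by simp
    also have "\<dots> \<le> emeasure lebesgue (E \<union> C)"
      by (rule emeasure_mono) (use sub E C' in auto)
    also have "\<dots> = emeasure lebesgue E" by (rule emeasure_Un_null_set[OF E(1) C'])
    also have "\<dots> = ennreal (measure lebesgue E)"
      by (rule emeasure_eq_ennreal_measure) (use E(2) in auto)
    finally have "b \<le> measure lebesgue E" by (simp add: ennreal_le_iff)
    then show False by (simp add: b_def)
  qed
  then show thesis using that by auto
qed

lemma small_functionE:
  assumes "small_function a F"
  obtains E where "E \<in> sets lebesgue" "emeasure lebesgue E < \<infinity>"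
    "\<And>e. e > 0 \<Longrightarrow> \<exists>r1. \<forall>r\<ge>r1. r \<notin> E \<longrightarrow> \<bar>nevanlinna_T r a\<bar> \<le> e * \<bar>nevanlinna_T r F\<bar>"
proof -
  obtain E where E: "E \<in> sets lebesgue" "emeasure lebesgue E < \<infinity>"
    and o: "(\<lambda>r. nevanlinna_T r a) \<in> o[inf at_top (principal (- E))](\<lambda>r. nevanlinna_T r F)"
    using assms by (auto simp: small_function_def)
  have "\<exists>r1. \<forall>r\<ge>r1. r \<notin> E \<longrightarrow> \<bar>nevanlinna_T r a\<bar> \<le> e * \<bar>nevanlinna_T r F\<bar>" if "e > 0" for e
    using landau_o.smallD[OF o that] by (simp add: eventually_inf_principal eventually_at_top_linorder)
  with E show thesis by (rule that)
qed

lemma log_mean_power_mult: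
  assumes f: "f holomorphic_on UNIV" and g: "g holomorphic_on UNIV" and r: "r > 0"
    and nz: "\<And>z. norm z = r \<Longrightarrow> f z \<noteq> 0" "\<And>z. norm z = r \<Longrightarrow> g z \<noteq> 0"
  shows "log_mean r (\<lambda>z. f z ^ n * g z) = n * log_mean r f + log_mean r g"
proof -
  have c: "continuous_on (sphere 0 r) (\<lambda>z. n * ln (norm (f z)))" "continuous_on (sphere 0 r) (\<lambda>z. ln (norm (g z)))"
    using nz by (auto intro!: continuous_on_mult_left continuous_on_ln_norm_entire f g)
  have "log_mean r (\<lambda>z. f z ^ n * g z) = circle_mean r (\<lambda>z. n * ln (norm (f z)) + ln (norm (g z)))"
    unfolding log_mean_def
  proof (rule circle_mean_cong[OF _ r])
    fix z :: complex assume "norm z = r"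
    then show "ln (norm (f z ^ n * g z)) = n * ln (norm (f z)) + ln (norm (g z))"
      using nz by (simp add: norm_mult norm_power ln_mult_pos ln_realpow)
  qed
  also have "\<dots> = n * log_mean r f + log_mean r g"
    unfolding log_mean_def circle_mean_cmult[symmetric]
    by (rule circle_mean_add[OF c r])
  finally show ?thesis .
qed

lemma log_mean_le_proximity:
  assumes F: "F holomorphic_on UNIV" and r: "r > 0" and nz: "\<And>z. norm z = r \<Longrightarrow> F z \<noteq> 0"
  shows "log_mean r F \<le> proximity r F"
  unfolding log_mean_def proximity_altdef
proof (rule circle_mean_mono[OF _ _ r])
  show "continuous_on (sphere 0 r) (\<lambda>z. ln (norm (F z)))"
    by (rule continuous_on_ln_norm_entire[OF F]) (use nz in auto)
  show "continuous_on (sphere 0 r) (\<lambda>z. log_plus (norm (F z)))"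
    by (intro continuous_on_log_plus_norm holomorphic_on_imp_continuous_on holomorphic_on_subset[OF F]) auto
qed (simp add: log_plus_def)

lemma proximity_nonneg:
  assumes F: "F holomorphic_on UNIV" and r: "r > 0"
  shows "0 \<le> proximity r F"
  unfolding proximity_altdef
proof (rule circle_mean_ge_const[OF _ r])
  show "continuous_on (sphere 0 r) (\<lambda>z. log_plus (norm (F z)))"
    by (intro continuous_on_log_plus_norm holomorphic_on_imp_continuous_on holomorphic_on_subset[OF F]) auto
qed (simp add: log_plus_def)

text \<open>
  Writing \<open>F = f^n * g\<close> and \<open>G = g^m * f\<close>, elimination of \<open>f\<close> gives \<open>g^(m * n - 1) = G^n / F\<close>. So \<open>F\<close> and
  \<open>G\<close> cannot both grow slowly if \<open>g\<close> is transcendental.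
\<close>

lemma proximity_le_of_power_products:
  assumes f: "f holomorphic_on UNIV" and g: "g holomorphic_on UNIV" and r: "r > 0"
    and nz: "\<And>z. norm z = r \<Longrightarrow> f z \<noteq> 0" "\<And>z. norm z = r \<Longrightarrow> g z \<noteq> 0" and mn: "m * n \<ge> 2"
  shows "proximity r g \<le> n * proximity r (\<lambda>z. g z ^ m * f z) + proximity r (\<lambda>z. f z ^ n * g z) - log_mean r (\<lambda>z. f z ^ n * g z)"
proof -
  define F where "F z = f z ^ n * g z" for z
  define G where "G z = g z ^ m * f z" for z
  have hol: "F holomorphic_on UNIV" "G holomorphic_on UNIV" unfolding F_def G_def by (intro holomorphic_intros f g)+
  have cp: "continuous_on (sphere 0 r) (\<lambda>z. log_plus (norm (h z)))" if "h holomorphic_on UNIV" for h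
    by (intro continuous_on_log_plus_norm holomorphic_on_imp_continuous_on holomorphic_on_subset[OF that]) auto
  have cl: "continuous_on (sphere 0 r) (\<lambda>z. ln (norm (F z)))"
    by (rule continuous_on_ln_norm_entire[OF hol(1)]) (use nz in \<open>auto simp: F_def\<close>)
  have cs: "continuous_on (sphere 0 r) (\<lambda>z. n * log_plus (norm (G z)) + log_plus (norm (F z)))"
    by (intro continuous_intros cp hol)
  have "proximity r g \<le> circle_mean r (\<lambda>z. (n * log_plus (norm (G z)) + log_plus (norm (F z))) - ln (norm (F z)))"
    unfolding proximity_altdef
  proof (rule circle_mean_mono[OF cp[OF g] _ r])
    show "continuous_on (sphere 0 r) (\<lambda>z. (n * log_plus (norm (G z)) + log_plus (norm (F z))) - ln (norm (F z)))"
      by (intro continuous_on_diff cs cl)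
    fix z :: complex assume z: "norm z = r"
    note nz' = nz(1)[OF z] nz(2)[OF z]
    have ge: "ln (norm (F z)) \<le> log_plus (norm (F z))" "ln (norm (G z)) \<le> log_plus (norm (G z))" "0 \<le> log_plus (norm (G z))"
      by (auto simp: log_plus_def)
    then have nG: "n * ln (norm (G z)) \<le> n * log_plus (norm (G z))" "0 \<le> n * log_plus (norm (G z))"
      by (auto intro: mult_left_mono)
    have lF: "ln (norm (F z)) = n * ln (norm (f z)) + ln (norm (g z))"
      using nz' by (simp add: F_def norm_mult norm_power ln_mult_pos ln_realpow)
    have lG: "ln (norm (G z)) = m * ln (norm (g z)) + ln (norm (f z))"
      using nz' by (simp add: G_def norm_mult norm_power ln_mult_pos ln_realpow)
    have eq: "n * ln (norm (G z)) - ln (norm (F z)) = (real (m * n) - 1) * ln (norm (g z))"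
      unfolding lF lG by (simp add: algebra_simps)
    show "log_plus (norm (g z)) \<le> (n * log_plus (norm (G z)) + log_plus (norm (F z))) - ln (norm (F z))"
    proof (cases "ln (norm (g z)) \<le> 0")
      case True
      then have "log_plus (norm (g z)) = 0" by (simp add: log_plus_def)
      then show ?thesis using ge nG by linarith
    next
      case False
      have "real (m * n) \<ge> 2" using mn by (metis of_nat_le_iff of_nat_numeral)
      then have "1 * ln (norm (g z)) \<le> (real (m * n) - 1) * ln (norm (g z))"
        using False by (intro mult_right_mono) auto
      moreover have "log_plus (norm (g z)) = ln (norm (g z))" using False by (simp add: log_plus_def)
      moreover have "0 \<le> log_plus (norm (F z))" by (simp add: log_plus_def)
      ultimately show ?thesis using nG eq by linarith
    qed
  qed
  also have "\<dots> = circle_mean r (\<lambda>z. n * log_plus (norm (G z)) + log_plus (norm (F z))) - circle_mean r (\<lambda>z. ln (norm (F z)))"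
    by (intro circle_mean_diff cs cl r)
  also have "circle_mean r (\<lambda>z. n * log_plus (norm (G z)) + log_plus (norm (F z)))
     = circle_mean r (\<lambda>z. n * log_plus (norm (G z))) + circle_mean r (\<lambda>z. log_plus (norm (F z)))"
    by (intro circle_mean_add cp hol r continuous_intros)
  finally show ?thesis unfolding circle_mean_cmult proximity_altdef log_mean_def F_def G_def by simp
qed

text \<open>
  Here \<open>x\<close> and \<open>y\<close> stand for the counting functions of the zeros of \<open>f\<close> and \<open>g\<close>, and \<open>p\<close> and \<open>q\<close>
  for the characteristics of \<open>f^n * g\<close> and \<open>g^m * f\<close>. Comparing the upper bound \<open>x + y\<close> for \<open>p\<close> with
  the lower bound \<open>n * x + y\<close> makes \<open>x\<close> small, and symmetrically \<open>y\<close>; then \<open>p\<close> and \<open>q\<close> are small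
  compared with their own sum.
\<close>

lemma coupled_estimates_contradiction:
  fixes x y p q e S :: real and m n :: nat
  assumes n: "n \<ge> 2" "m \<ge> 2" and S: "S = p + q" "S > 0" and e: "e = S / 48"
    and p: "p \<le> x + y + 4 * e" and q: "q \<le> y + x + 4 * e"
    and low: "n * x + y \<le> p" "m * y + x \<le> q"
  shows False
proof -
  have *: "t \<le> 4 * e" if "k * t \<le> t + 4 * e" "k \<ge> 2" for t :: real and k :: nat
  proof (cases "t \<le> 0")
    case True
    then show ?thesis using e S by simp
  next
    case False
    have "2 * t \<le> k * t" using that(2) False by (intro mult_right_mono) auto
    with that show ?thesis by linarith
  qed
  have "x \<le> 4 * e" by (rule *[of n]) (use low p n in auto)
  moreover have "y \<le> 4 * e" by (rule *[of m]) (use low q n in auto)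
  ultimately have "S \<le> 24 * e" using p q S by linarith
  with e S show False by simp
qed

theorem corollary2p3:
  fixes f g :: "complex \<Rightarrow> complex" and m n :: nat
  assumes "transcendental_entire f" and "transcendental_entire g"
    and "m > 0" and "n > 0" and "min m n \<ge> 2"
  shows "\<not> (\<exists>a1 a2. a1 meromorphic_on UNIV \<and> a2 meromorphic_on UNIV \<and>
            \<not> identically_zero a1 \<and> \<not> identically_zero a2 \<and>
            gen_picard_exceptional a1 (\<lambda>z. f z ^ n * g z) \<and>
            gen_picard_exceptional a2 (\<lambda>z. g z ^ m * f z))"
proof
  define F where "F = (\<lambda>z. f z ^ n * g z)"
  define G where "G = (\<lambda>z. g z ^ m * f z)"
  assume "\<exists>a1 a2. a1 meromorphic_on UNIV \<and> a2 meromorphic_on UNIV \<and>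
            \<not> identically_zero a1 \<and> \<not> identically_zero a2 \<and>
            gen_picard_exceptional a1 (\<lambda>z. f z ^ n * g z) \<and>
            gen_picard_exceptional a2 (\<lambda>z. g z ^ m * f z)"
  then obtain a b where a: "a meromorphic_on UNIV" "\<not> identically_zero a" "small_function a F" "finite {z. (\<lambda>w. F w - a w) \<midarrow>z\<rightarrow> 0}"
    and b: "b meromorphic_on UNIV" "\<not> identically_zero b" "small_function b G" "finite {z. (\<lambda>w. G w - b w) \<midarrow>z\<rightarrow> 0}"
    by (auto simp: gen_picard_exceptional_def F_def G_def)
  have mn: "m \<ge> 2" "n \<ge> 2" using assms(5) by auto
  have hol: "f holomorphic_on UNIV" "g holomorphic_on UNIV"
    using assms by (auto simp: transcendental_entire_def)
  have nonzero: "\<exists>z. h z \<noteq> 0" if "transcendental_entire h" for h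
  proof (rule ccontr)
    assume "\<not> ?thesis"
    then have "h = poly 0" by auto
    with that show False by (auto simp: transcendental_entire_def)
  qed
  obtain zf zg where zf: "f zf \<noteq> 0" and zg: "g zg \<noteq> 0" using nonzero assms(1,2) by blast
  have holF: "F holomorphic_on UNIV" and holG: "G holomorphic_on UNIV"
    unfolding F_def G_def by (intro holomorphic_intros hol)+
  obtain Ca ra ca Ua where Ca: "countable Ca" "1 \<le> ra" "0 \<le> ca"
    and U0: "\<forall>r s. ra < r \<longrightarrow> r \<le> s \<longrightarrow> r \<notin> Ca \<longrightarrow> s \<notin> Ca \<longrightarrow> Ua r \<le> Ua s"
      "\<forall>r. ra < r \<longrightarrow> r \<notin> Ca \<longrightarrow> - ca \<le> Ua r"
      "\<forall>r. ra < r \<longrightarrow> r \<notin> Ca \<longrightarrow> Ua r \<le> proximity r F + nevanlinna_T r a + ca"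
    and main0: "\<forall>r C \<Phi>. ra < r \<longrightarrow> r \<notin> C \<longrightarrow> Ca \<subseteq> C \<longrightarrow> countable C \<longrightarrow> 1 \<le> \<Phi> \<longrightarrow>
       (\<forall>s. s \<notin> C \<longrightarrow> r < s \<longrightarrow> s \<le> r + 1 / \<Phi> \<longrightarrow> Ua s \<le> 2 * \<Phi>) \<longrightarrow>
       proximity r F \<le> nevanlinna_T r a + log_mean r f + log_mean r g + ca * (1 + ln r + ln \<Phi>)"
    by (rule second_main_estimate[OF hol(1) zf hol(2) zg assms(4) a(1,2) a(4)[unfolded F_def], folded F_def])
  note Ua = U0[rule_format] and main_a = main0[rule_format]
  obtain Cb rb cb Ub where Cb: "countable Cb" "1 \<le> rb" "0 \<le> cb"
    and U0: "\<forall>r s. rb < r \<longrightarrow> r \<le> s \<longrightarrow> r \<notin> Cb \<longrightarrow> s \<notin> Cb \<longrightarrow> Ub r \<le> Ub s"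
      "\<forall>r. rb < r \<longrightarrow> r \<notin> Cb \<longrightarrow> - cb \<le> Ub r"
      "\<forall>r. rb < r \<longrightarrow> r \<notin> Cb \<longrightarrow> Ub r \<le> proximity r G + nevanlinna_T r b + cb"
    and main0: "\<forall>r C \<Phi>. rb < r \<longrightarrow> r \<notin> C \<longrightarrow> Cb \<subseteq> C \<longrightarrow> countable C \<longrightarrow> 1 \<le> \<Phi> \<longrightarrow>
       (\<forall>s. s \<notin> C \<longrightarrow> r < s \<longrightarrow> s \<le> r + 1 / \<Phi> \<longrightarrow> Ub s \<le> 2 * \<Phi>) \<longrightarrow>
       proximity r G \<le> nevanlinna_T r b + log_mean r g + log_mean r f + cb * (1 + ln r + ln \<Phi>)"
    by (rule second_main_estimate[OF hol(2) zg hol(1) zf assms(3) b(1,2) b(4)[unfolded G_def], folded G_def])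
  note Ub = U0[rule_format] and main_b = main0[rule_format]
  obtain Ea where Ea: "Ea \<in> sets lebesgue" "emeasure lebesgue Ea < \<infinity>"
    "\<And>e. e > 0 \<Longrightarrow> \<exists>r1. \<forall>r\<ge>r1. r \<notin> Ea \<longrightarrow> \<bar>nevanlinna_T r a\<bar> \<le> e * \<bar>nevanlinna_T r F\<bar>"
    by (rule small_functionE[OF a(3)]) (rule that)
  obtain Eb where Eb: "Eb \<in> sets lebesgue" "emeasure lebesgue Eb < \<infinity>"
    "\<And>e. e > 0 \<Longrightarrow> \<exists>r1. \<forall>r\<ge>r1. r \<notin> Eb \<longrightarrow> \<bar>nevanlinna_T r b\<bar> \<le> e * \<bar>nevanlinna_T r G\<bar>"
    by (rule small_functionE[OF b(3)]) (rule that)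
  obtain X zX where X: "X holomorphic_on UNIV" "X zX \<noteq> 0"
    "\<And>K. \<exists>r1. \<forall>R\<ge>r1. (\<forall>z::complex. norm z = R \<longrightarrow> X z \<noteq> 0) \<longrightarrow> K * ln R \<le> proximity R g"
    by (rule transcendental_proximity_growth[OF assms(2)]) (rule that)
  define C where "C = Ca \<union> Cb \<union> norm ` {z. f z = 0} \<union> norm ` {z. g z = 0} \<union> norm ` {z. X z = 0}"
  have C: "countable C"
    unfolding C_def using Ca(1) Cb(1) countable_zero_radii[OF hol(1) zf] countable_zero_radii[OF hol(2) zg]
      countable_zero_radii[OF X(1,2)] by auto
  have free: "f z \<noteq> 0" "g z \<noteq> 0" "X z \<noteq> 0" "F z \<noteq> 0" "G z \<noteq> 0" if "norm z \<notin> C" for z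
    using that by (auto simp: C_def F_def G_def)
  define c where "c = ca + cb"
  have c: "0 \<le> c" "ca \<le> c" "cb \<le> c" using Ca Cb by (auto simp: c_def)
  define r0 where "r0 = max ra rb"
  have r0: "1 \<le> r0" "ra \<le> r0" "rb \<le> r0" using Ca Cb by (auto simp: r0_def)
  define Y where "Y = {r. r0 < r \<and> r \<notin> C}"
  \<comment> \<open>One growth function for both products; the constant makes it at least \<open>1\<close> and above \<open>Ua\<close> and \<open>Ub\<close>.\<close>
  define \<Phi> where "\<Phi> r = Ua r + Ub r + c + 1" for r
  have \<Phi>_bounds: "1 \<le> \<Phi> r" "Ua r \<le> \<Phi> r" "Ub r \<le> \<Phi> r" if "r \<in> Y" for r
    using Ua(2)[of r] Ub(2)[of r] that r0 Ca Cb by (auto simp: \<Phi>_def Y_def C_def c_def)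
  have \<Phi>_mono: "\<Phi> r \<le> \<Phi> s" if "r \<in> Y" "s \<in> Y" "r \<le> s" for r s
    using Ua(1)[of r s] Ub(1)[of r s] that r0 by (auto simp: \<Phi>_def Y_def C_def)
  obtain E where E: "E \<in> sets lebesgue" "emeasure lebesgue E < \<infinity>"
    "\<And>r s. r \<in> Y - E \<Longrightarrow> s \<in> Y \<Longrightarrow> r < s \<Longrightarrow> s \<le> r + 1 / \<Phi> r \<Longrightarrow> \<Phi> s \<le> 2 * \<Phi> r"
    by (rule Borel_growth[of Y \<Phi>]) (rule \<Phi>_mono \<Phi>_bounds(1) that; assumption)+
  obtain r1 where r1: "r0 < r1" "r1 < r0 + 1" "r1 \<notin> C"
    by (rule exists_radius_avoiding_countable[OF C, of r0 "r0 + 1"]) auto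
  \<comment> \<open>In the end \<open>S \<le> 24 * \<epsilon> * S\<close>, so \<open>\<epsilon> = 1 / 48\<close> leaves a factor \<open>1 / 2\<close>. The constants \<open>\<delta>\<close> and \<open>M\<close>
    are chosen such that the logarithmic error is absorbed as soon as \<open>S \<ge> M * (1 + ln r)\<close>.\<close>
  define \<epsilon> :: real where "\<epsilon> = 1 / 48"
  define \<delta> where "\<delta> = \<epsilon> / (3 * (c + 1))"
  have \<delta>: "\<delta> > 0" "c * \<delta> * 3 \<le> \<epsilon>" using c by (auto simp: \<delta>_def \<epsilon>_def field_simps)
  define k where "k = \<bar>log_mean r1 F\<bar>"
  define K where "K = c * \<delta> * (2 * c + 1) + c * \<bar>1 + ln \<delta>\<bar>"
  have K: "K \<ge> 0" using c \<delta> by (simp add: K_def)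
  define M where "M = (c + K) / \<epsilon> + 1"
  have M: "M \<ge> 1" "c \<le> \<epsilon> * M" "K \<le> \<epsilon> * M" using c K by (auto simp: M_def \<epsilon>_def)
  obtain R1 where R1: "\<And>R. R \<ge> R1 \<Longrightarrow> (\<forall>z::complex. norm z = R \<longrightarrow> X z \<noteq> 0) \<Longrightarrow> (2 * n * M + 1) * ln R \<le> proximity R g"
    using X(3) by blast
  obtain R2 where R2: "\<And>r. r \<ge> R2 \<Longrightarrow> r \<notin> Ea \<Longrightarrow> \<bar>nevanlinna_T r a\<bar> \<le> \<epsilon> * \<bar>nevanlinna_T r F\<bar>"
    using Ea(3)[of \<epsilon>] by (auto simp: \<epsilon>_def)
  obtain R3 where R3: "\<And>r. r \<ge> R3 \<Longrightarrow> r \<notin> Eb \<Longrightarrow> \<bar>nevanlinna_T r b\<bar> \<le> \<epsilon> * \<bar>nevanlinna_T r G\<bar>"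
    using Eb(3)[of \<epsilon>] by (auto simp: \<epsilon>_def)
  have "E \<union> Ea \<union> Eb \<in> sets lebesgue" "emeasure lebesgue (E \<union> Ea \<union> Eb) < \<infinity>"
  proof -
    have "emeasure lebesgue (E \<union> Ea \<union> Eb) \<le> emeasure lebesgue E + emeasure lebesgue Ea + emeasure lebesgue Eb"
      using E Ea Eb by (intro order_trans[OF emeasure_subadditive] add_mono emeasure_subadditive) auto
    also have "\<dots> < \<infinity>" using E Ea Eb by simp
    finally show "emeasure lebesgue (E \<union> Ea \<union> Eb) < \<infinity>" .
  qed (use E Ea Eb in auto)
  from exists_large_radius[OF this C, of "Max {r1, R1, R2, R3, exp 1, exp k}"]
  obtain r where "r \<ge> Max {r1, R1, R2, R3, exp 1, exp k}" and nE: "r \<notin> E" "r \<notin> Ea" "r \<notin> Eb" and rC: "r \<notin> C"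
    by auto
  then have r: "r1 \<le> r" "R1 \<le> r" "R2 \<le> r" "R3 \<le> r" "exp 1 \<le> r" "exp k \<le> r" by auto
  have r': "0 < r" "r0 < r" "r \<in> Y" using r r1 r0 rC by (auto simp: Y_def)
  have ln_r: "1 \<le> ln r" "k \<le> ln r" using r r' by (auto simp: ln_ge_iff)
  define S where "S = proximity r F + proximity r G"
  have p0: "0 \<le> proximity r F" "0 \<le> proximity r G" using proximity_nonneg holF holG r' by auto
  have S_large: "M * (1 + ln r) \<le> S"
  proof -
    have "log_mean r1 F \<le> log_mean r F"
      using log_mean_mono[OF holF free(4)[of "of_real r1"], of r1 r] r r1 r0 free(4) rC by auto
    moreover have "proximity r g \<le> n * proximity r G + proximity r F - log_mean r F"
      unfolding F_def G_def
    proof (rule proximity_le_of_power_products[OF hol r'(1)])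
      show "2 \<le> m * n" using mult_le_mono[OF mn] by simp
    qed (use free rC in auto)
    moreover have "n * proximity r G + proximity r F \<le> n * S"
    proof -
      have "1 * proximity r F \<le> n * proximity r F" using mn p0 by (intro mult_right_mono) auto
      then show ?thesis by (simp add: S_def distrib_left)
    qed
    moreover have "(2 * n * M + 1) * ln r \<le> proximity r g" by (rule R1) (use r free rC in auto)
    ultimately have "(2 * n * M + 1) * ln r \<le> n * S + k" by (simp add: k_def)
    then have "n * (2 * M * ln r) \<le> n * S" using ln_r by (simp add: algebra_simps)
    then have "2 * M * ln r \<le> S" using mn by simp
    moreover have "M * (1 + ln r) \<le> M * (2 * ln r)" using ln_r M by (intro mult_left_mono) auto
    ultimately show ?thesis by simp
  qed
  have M_le: "M * 1 \<le> M * (1 + ln r)" using M ln_r by (intro mult_left_mono) auto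
  have S_pos: "S > 0" using S_large M M_le by linarith
  have Ta: "nevanlinna_T r a \<le> \<epsilon> * proximity r F" and Tb: "nevanlinna_T r b \<le> \<epsilon> * proximity r G"
    using R2[of r] R3[of r] r nE p0 by (auto simp: nevanlinna_T_entire holF holG)
  have \<epsilon>S: "\<epsilon> * proximity r F \<le> \<epsilon> * S" "\<epsilon> * proximity r G \<le> \<epsilon> * S" "\<epsilon> * S \<le> S"
    using p0 S_pos by (auto simp: S_def \<epsilon>_def)
  have \<Phi>_le: "\<Phi> r \<le> 3 * S + (2 * c + 1)"
  proof -
    have "nevanlinna_T r a + nevanlinna_T r b \<le> S"
      using Ta Tb p0 by (simp add: S_def \<epsilon>_def)
    moreover have "Ua r \<le> proximity r F + nevanlinna_T r a + ca" "Ub r \<le> proximity r G + nevanlinna_T r b + cb"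
      using Ua(3)[of r] Ub(3)[of r] r' r0 rC by (auto simp: C_def)
    moreover have "\<Phi> r = Ua r + Ub r + (ca + cb) + 1" by (simp add: \<Phi>_def c_def)
    moreover have "S = proximity r F + proximity r G" "c = ca + cb" by (simp_all only: S_def c_def)
    ultimately have "\<Phi> r \<le> 2 * S + (2 * c + 1)" by linarith
    then show ?thesis using S_pos by linarith
  qed
  have err: "c * (1 + ln r + ln (\<Phi> r)) \<le> 3 * (\<epsilon> * S)"
  proof -
    have \<Phi>1: "\<Phi> r \<ge> 1" using \<Phi>_bounds r' by simp
    have "ln (\<Phi> r) \<le> \<delta> * \<Phi> r - 1 - ln \<delta>" by (rule log_le_linear) (use \<Phi>1 \<delta> in auto)
    also have "\<dots> \<le> \<delta> * (3 * S + (2 * c + 1)) + \<bar>1 + ln \<delta>\<bar>"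
      using mult_left_mono[OF \<Phi>_le, of \<delta>] \<delta> by linarith
    finally have "c * ln (\<Phi> r) \<le> c * (\<delta> * (3 * S + (2 * c + 1)) + \<bar>1 + ln \<delta>\<bar>)" using c by (intro mult_left_mono) auto
    also have "\<dots> = (c * \<delta> * 3) * S + K" by (simp add: K_def algebra_simps)
    also have "\<dots> \<le> \<epsilon> * S + K" using \<delta> S_pos by (intro add_right_mono mult_right_mono) auto
    finally have "c * ln (\<Phi> r) \<le> \<epsilon> * S + K" .
    moreover have "K \<le> \<epsilon> * S"
    proof -
      have "\<epsilon> * M \<le> \<epsilon> * S" using S_large M_le by (intro mult_left_mono) (auto simp: \<epsilon>_def)
      with M show ?thesis by linarith
    qed
    ultimately have "c * ln (\<Phi> r) \<le> 2 * (\<epsilon> * S)" by linarith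
    moreover have "c * (1 + ln r) \<le> \<epsilon> * S"
    proof -
      have "c * (1 + ln r) \<le> (\<epsilon> * M) * (1 + ln r)" using M ln_r by (intro mult_right_mono) auto
      also have "\<dots> \<le> \<epsilon> * S" using mult_left_mono[OF S_large, of \<epsilon>] by (simp add: \<epsilon>_def)
      finally show ?thesis .
    qed
    ultimately show ?thesis by (simp add: distrib_left)
  qed
  have growth: "\<Phi> s \<le> 2 * \<Phi> r \<and> s \<in> Y" if "s \<notin> C" "r < s" "s \<le> r + 1 / \<Phi> r" for s
  proof -
    have "s \<in> Y" using that r' by (simp add: Y_def)
    then show ?thesis using E(3)[of r s] that r' nE by auto
  qed
  have L: "0 \<le> 1 + ln r + ln (\<Phi> r)" using ln_r \<Phi>_bounds(1)[OF r'(3)] by simp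
  have pF: "proximity r F \<le> log_mean r f + log_mean r g + 4 * (\<epsilon> * S)"
  proof -
    have "proximity r F \<le> nevanlinna_T r a + log_mean r f + log_mean r g + ca * (1 + ln r + ln (\<Phi> r))"
    proof (rule main_a[OF _ rC _ C])
      show "Ua s \<le> 2 * \<Phi> r" if "s \<notin> C" "r < s" "s \<le> r + 1 / \<Phi> r" for s
        using growth[OF that] \<Phi>_bounds(2)[of s] by linarith
    qed (use r' r0 \<Phi>_bounds in \<open>auto simp: C_def\<close>)
    moreover have "ca * (1 + ln r + ln (\<Phi> r)) \<le> c * (1 + ln r + ln (\<Phi> r))" using c L by (intro mult_right_mono) auto
    ultimately show ?thesis using err Ta \<epsilon>S by linarith
  qed
  have pG: "proximity r G \<le> log_mean r g + log_mean r f + 4 * (\<epsilon> * S)"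
  proof -
    have "proximity r G \<le> nevanlinna_T r b + log_mean r g + log_mean r f + cb * (1 + ln r + ln (\<Phi> r))"
    proof (rule main_b[OF _ rC _ C])
      show "Ub s \<le> 2 * \<Phi> r" if "s \<notin> C" "r < s" "s \<le> r + 1 / \<Phi> r" for s
        using growth[OF that] \<Phi>_bounds(3)[of s] by linarith
    qed (use r' r0 \<Phi>_bounds in \<open>auto simp: C_def\<close>)
    moreover have "cb * (1 + ln r + ln (\<Phi> r)) \<le> c * (1 + ln r + ln (\<Phi> r))" using c L by (intro mult_right_mono) auto
    ultimately show ?thesis using err Tb \<epsilon>S by linarith
  qed
  have lowF: "n * log_mean r f + log_mean r g \<le> proximity r F"
    using log_mean_power_mult[OF hol r'(1), of n] log_mean_le_proximity[OF holF r'(1)] free rC by (simp add: F_def)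
  have lowG: "m * log_mean r g + log_mean r f \<le> proximity r G"
    using log_mean_power_mult[OF hol(2,1) r'(1), of m] log_mean_le_proximity[OF holG r'(1)] free rC by (simp add: G_def)
  show False
    by (rule coupled_estimates_contradiction[OF mn(2,1) S_def S_pos _ pF pG lowF lowG]) (simp add: \<epsilon>_def)
qed

end
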